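(* Let $p>2$ be a prime, let $G$ be a finite $p$-group and let $P$ be a $G$-group, i.e. a finite $p$-group with $G\subseteq \operatorname{Aut}(P)$, with $G$ acting naturally by automorphisms. Let $P_1 := G\ltimes P$ be the corresponding semidirect product. Assume that there exists a normal and $G$-invariant subgroup $M$ of $P$ such that 1. $\log_p[P:M]\leq 1$, 2. $[G,M]=\{e\}$ (commutator taken in $P_1$). Then there exist an integer $N\geq 1$ and a $G$-central series $C_i$, $0\leq i\leq N$, of $P$ such that 1. $C_0=P$, $C_1=\gamma_2^G(P)$, $C_N=\{e\}$, 2. $\log_p[C_i:C_{i+1}]\leq \mathcal{M}^G(P)-i+1$ for all $1\leq i\leq N-1$.
   Context: All $p$-groups are finite. $G$ and $P$ are regarded as subgroups of $P_1=G\ltimes P$, so that $g\cdot x = gxg^{-1}$ for $g\in G$, $x\in P$. Commutators are $[a,b]=aba^{-1}b^{-1}$; for subgroups $A,B$, $[A,B]$ is the subgroup generated by all $[a,b]$ with $a\in A$, $b\in B$; $AB$ denotes the subgroup generated by $A\cup B$. A subgroup $H$ of $P$ is $G$-invariant if $g\cdot h\in H$ for all $g\in G$, $h\in H$ (equivalently $[G,H]\subseteq H$). $\gamma_2^G(P) := P'[G,P]$, where $P'$ is the derived subgroup of $P$. A $G$-central series of $P$ is a finite sequence of subgroups $C_i$, $0\leq i\leq N$, of $P$ with $C_0=P$, $C_N=\{e\}$ such that for each $0\leq i\leq N-1$: $C_{i+1}\subseteq C_i$ and $[G,C_i]\subseteq C_{i+1}$. For $x\in P$, the $G$-breadth is $b^G(x)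 := \log_p[P_1:Z_{P_1}(x)]$, where $Z_{P_1}(x)$ is the centralizer of $x$ in $P_1$. $\mathcal{M}^G(P)$ is the least integer $k$ such that the set $\{x\in P \mid b^G(x)>k\}$ can be covered by two (possibly equal) proper subgroups of $P$ containing $\gamma_2^G(P)$. (This is defined for $P\neq\{e\}$; for $P=\{e\}$ one may take $N=1$, in which case condition 2 of the conclusion is vacuous and $\mathcal{M}^G(P)$ does not enter.) *)

theory Defs
  imports Complex_Main "HOL-Algebra.Algebra"
begin

definition p_group :: "nat \<Rightarrow> ('a, 'b) monoid_scheme \<Rightarrow> bool" where
  "p_group p H \<longleftrightarrow> group H \<and> (\<exists>n. order H = p ^ n)"

definition log_index :: "nat \<Rightarrow> ('a, 'b) monoid_scheme \<Rightarrow> 'a set \<Rightarrow> 'a set \<Rightarrow> real" where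
  "log_index p \<Gamma> H K = log (real p) (real (card (rcosets\<^bsub>\<Gamma>\<lparr>carrier := H\<rparr>\<^esub> K)))"

definition comm_subgroup :: "('a, 'b) monoid_scheme \<Rightarrow> 'a set \<Rightarrow> 'a set \<Rightarrow> 'a set" where
  "comm_subgroup \<Gamma> A B =
     generate \<Gamma> {a \<otimes>\<^bsub>\<Gamma>\<^esub> b \<otimes>\<^bsub>\<Gamma>\<^esub> inv\<^bsub>\<Gamma>\<^esub> a \<otimes>\<^bsub>\<Gamma>\<^esub> inv\<^bsub>\<Gamma>\<^esub> b | a b. a \<in> A \<and> b \<in> B}"

definition centralizer :: "('a, 'b) monoid_scheme \<Rightarrow> 'a \<Rightarrow> 'a set" where
  "centralizer \<Gamma> x = {z \<in> carrier \<Gamma>. z \<otimes>\<^bsub>\<Gamma>\<^esub> x = x \<otimes>\<^bsub>\<Gamma>\<^esub> z}"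

(* The group G is given by its underlying set, a subgroup of AutoGroup P.
   The pair (g, x) stands for the product x g, so that g x = g(x) g in the semidirect product. *)

definition semidirect :: "('a, 'b) monoid_scheme \<Rightarrow> ('a \<Rightarrow> 'a) set \<Rightarrow> (('a \<Rightarrow> 'a) \<times> 'a) monoid" where
  "semidirect P G =
     \<lparr>carrier = G \<times> carrier P,
      monoid.mult = (\<lambda>(g, x) (h, y). (g \<otimes>\<^bsub>AutoGroup P\<^esub> h, x \<otimes>\<^bsub>P\<^esub> g y)),
      one = (\<one>\<^bsub>AutoGroup P\<^esub>, \<one>\<^bsub>P\<^esub>)\<rparr>"

definition embG :: "('a, 'b) monoid_scheme \<Rightarrow> ('a \<Rightarrow> 'a) \<Rightarrow> ('a \<Rightarrow> 'a) \<times> 'a" where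
  "embG P g = (g, \<one>\<^bsub>P\<^esub>)"

definition embP :: "('a, 'b) monoid_scheme \<Rightarrow> 'a \<Rightarrow> ('a \<Rightarrow> 'a) \<times> 'a" where
  "embP P x = (\<one>\<^bsub>AutoGroup P\<^esub>, x)"

definition G_comm :: "('a, 'b) monoid_scheme \<Rightarrow> ('a \<Rightarrow> 'a) set \<Rightarrow> 'a set \<Rightarrow> (('a \<Rightarrow> 'a) \<times> 'a) set" where
  "G_comm P G H = comm_subgroup (semidirect P G) (embG P ` G) (embP P ` H)"

definition G_invariant :: "('a \<Rightarrow> 'a) set \<Rightarrow> 'a set \<Rightarrow> bool" where
  "G_invariant G H \<longleftrightarrow> (\<forall>g\<in>G. \<forall>h\<in>H. g h \<in> H)"

(* P'[G,P] is formed in the semidirect product and then read as a subset of P. *)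

definition gamma2 :: "('a, 'b) monoid_scheme \<Rightarrow> ('a \<Rightarrow> 'a) set \<Rightarrow> 'a set" where
  "gamma2 P G = {x \<in> carrier P.
     embP P x \<in> generate (semidirect P G)
       (derived (semidirect P G) (embP P ` carrier P) \<union> G_comm P G (carrier P))}"

definition G_central_series ::
  "('a, 'b) monoid_scheme \<Rightarrow> ('a \<Rightarrow> 'a) set \<Rightarrow> nat \<Rightarrow> (nat \<Rightarrow> 'a set) \<Rightarrow> bool" where
  "G_central_series P G N C \<longleftrightarrow>
     (\<forall>i\<le>N. subgroup (C i) P) \<and> C 0 = carrier P \<and> C N = {\<one>\<^bsub>P\<^esub>} \<and>
     (\<forall>i<N. C (Suc i) \<subseteq> C i \<and> G_comm P G (C i) \<subseteq> embP P ` C (Suc i))"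

definition G_breadth :: "nat \<Rightarrow> ('a, 'b) monoid_scheme \<Rightarrow> ('a \<Rightarrow> 'a) set \<Rightarrow> 'a \<Rightarrow> real" where
  "G_breadth p P G x =
     log_index p (semidirect P G) (carrier (semidirect P G)) (centralizer (semidirect P G) (embP P x))"

(* Unspecified if P is trivial: a trivial group has no proper subgroup. *)

definition M_inv :: "nat \<Rightarrow> ('a, 'b) monoid_scheme \<Rightarrow> ('a \<Rightarrow> 'a) set \<Rightarrow> int" where
  "M_inv p P G = (LEAST k :: int. \<exists>H K.
     subgroup H P \<and> H \<noteq> carrier P \<and> gamma2 P G \<subseteq> H \<and>
     subgroup K P \<and> K \<noteq> carrier P \<and> gamma2 P G \<subseteq> K \<and>
     {x \<in> carrier P. G_breadth p P G x > real_of_int k} \<subseteq> H \<union> K)"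

lemma group_semidirect:
  assumes "group P" and G: "subgroup G (AutoGroup P)"
  shows "group (semidirect P G)"
proof -
  interpret P: group P by fact
  interpret A: group "AutoGroup P" by (rule P.AutoGroup)
  note GA = subgroup.mem_carrier[OF G]
  have hom: "g (x \<otimes>\<^bsub>P\<^esub> y) = g x \<otimes>\<^bsub>P\<^esub> g y" if "g \<in> G" "x \<in> carrier P" "y \<in> carrier P" for g x y
    using GA[OF that(1)] that by (auto simp: AutoGroup_def auto_def hom_def)
  have cl: "g x \<in> carrier P" if "g \<in> G" "x \<in> carrier P" for g x
    using GA[OF that(1)] that by (auto simp: AutoGroup_def auto_def hom_def)
  have mlt: "(g \<otimes>\<^bsub>AutoGroup P\<^esub> h) x = g (h x)" if "g \<in> G" "h \<in> G" "x \<in> carrier P" for g h x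
    using GA[OF that(1)] GA[OF that(2)] that(3)
    by (auto simp: AutoGroup_def BijGroup_def auto_def compose_def)
  have one: "\<one>\<^bsub>AutoGroup P\<^esub> x = x" if "x \<in> carrier P" for x
    using that by (simp add: AutoGroup_def BijGroup_def)
  show ?thesis
  proof (rule groupI, goal_cases)
    case (1 x y)
    then show ?case by (auto simp: semidirect_def cl subgroup.m_closed[OF G])
  next
    case 2
    then show ?case by (auto simp: semidirect_def subgroup.one_closed[OF G])
  next
    case (3 x y z)
    then show ?case
      by (auto simp: semidirect_def cl hom mlt subgroup.m_closed[OF G] P.m_assoc A.m_assoc GA)
  next
    case (4 x)
    then show ?case by (auto simp: semidirect_def one GA)
  next
    case (5 x)
    then obtain g y where x: "x = (g, y)" "g \<in> G" "y \<in> carrier P"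
      by (auto simp: semidirect_def)
    define g' where "g' = inv\<^bsub>AutoGroup P\<^esub> g"
    have g': "g' \<in> G" "g' \<otimes>\<^bsub>AutoGroup P\<^esub> g = \<one>\<^bsub>AutoGroup P\<^esub>"
      using x GA unfolding g'_def by (auto simp: subgroup.m_inv_closed[OF G])
    show ?case
      using x g' cl[of g' y]
      by (intro bexI[of _ "(g', inv\<^bsub>P\<^esub> (g' y))"]) (auto simp: semidirect_def)
  qed
qed

lemma semidirect_conj:
  assumes "group P" and G: "subgroup G (AutoGroup P)" and g: "g \<in> G" and x: "x \<in> carrier P"
  shows "embG P g \<otimes>\<^bsub>semidirect P G\<^esub> embP P x \<otimes>\<^bsub>semidirect P G\<^esub> inv\<^bsub>semidirect P G\<^esub> (embG P g)
    = embP P (g x)"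
proof -
  interpret P: group P by fact
  interpret A: group "AutoGroup P" by (rule P.AutoGroup)
  interpret S: group "semidirect P G" by (rule group_semidirect) fact+
  have gA: "g \<in> carrier (AutoGroup P)" using subgroup.mem_carrier[OF G g] .
  then have gx: "g x \<in> carrier P" and gh: "g \<in> hom P P"
    using x by (auto simp: AutoGroup_def auto_def hom_def)
  have g1: "g \<one>\<^bsub>P\<^esub> = \<one>\<^bsub>P\<^esub>" using hom_one[OF gh] P.group_axioms by simp
  have c: "embG P g \<in> carrier (semidirect P G)" "embP P (g x) \<in> carrier (semidirect P G)"
    "embP P x \<in> carrier (semidirect P G)"
    using g x gx subgroup.one_closed[OF G] by (auto simp: semidirect_def embG_def embP_def)
  have "embG P g \<otimes>\<^bsub>semidirect P G\<^esub> embP P x = embP P (g x) \<otimes>\<^bsub>semidirect P G\<^esub> embG P g"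
    using gA gx g1 x
    by (simp add: semidirect_def embG_def embP_def)
       (simp add: AutoGroup_def BijGroup_def)
  then show ?thesis using c by (simp add: S.m_assoc)
qed

end

theory Submission
  imports Defs
begin

text \<open>
  Let \<open>\<Gamma>\<close> be the semidirect product and \<open>k = M_inv p P G\<close>. The group \<open>gamma2 P G\<close> lies both in the derived
  subgroup \<open>\<Gamma>'\<close> and in \<open>M\<close>, on which \<open>G\<close> acts trivially. Hence any descending chain of subgroups of
  \<open>gamma2 P G\<close> continues \<open>P\<close> to a \<open>G\<close>-central series, and as a \<open>p\<close>-group has chains of subgroups of all
  possible orders, the theorem amounts to the inequality
  \<open>card (gamma2 P G) \<le> p ^ (k + (k - 1) + \<dots> + 1)\<close>, which follows from the same bound for \<open>\<Gamma>'\<close>.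

  The core is a statement on a single \<open>p\<close>-group (\<open>card_derived_le_covered\<close>): if all elements outside two
  hyperplanes, that is maximal subgroups, have breadth at most \<open>k\<close>, then the derived subgroup has order at
  most \<open>p ^ (k + (k - 1) + \<dots> + 1)\<close>. The proof is an induction on the group order with two kinds of
  reduction. First, one may factor out the group \<open>A\<close> of all commutators with an element \<open>z\<close> of the second
  centre: the breadth of every element outside the centralizer of \<open>z\<close> drops (\<open>breadth_drop\<close>). Second, one
  may pass to a hyperplane \<open>R\<close>: an element \<open>a\<close> outside \<open>R\<close> of breadth \<open>b\<close> yields a factor of \<open>p ^ b\<close> only
  (\<open>card_derived_le_hyperplane\<close>). If \<open>A\<close> has order \<open>p\<close>, both reductions together cost \<open>p ^ k\<close> and lead
  from \<open>k\<close> to \<open>k - 1\<close>, as required.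

  The difficulty is that the centralizer of \<open>z\<close> becomes a third subgroup on which nothing is known. If it is
  a hyperplane, this is repaired by the choice of \<open>R\<close>: as \<open>p\<close> is odd, there are at least four hyperplanes
  through the intersection of any two, so that \<open>R\<close> can be chosen such that two of the three exceptional
  hyperplanes coincide in it (\<open>off_pencil_bound\<close>), or \<open>R\<close> is the centralizer itself, in which elements have
  a smaller breadth for a different reason (\<open>breadth_drop_inside\<close>). If its index is at least \<open>p\<^sup>2\<close>, the
  centralizer is carried along as an additional exceptional subgroup, a hole. The induction therefore
  concerns groups with two hyperplanes and a list of holes whose indices grow so fast that the holes do
  not fill much of the group.

  In \<open>\<Gamma>\<close> itself, the breadth is controlled only for elements of \<open>P\<close>. An element \<open>g\<close> of \<open>G\<close> moves every
  element of \<open>P\<close> by a central element of \<open>M\<close>. Therefore, if \<open>M\<close> is a proper subgroup, \<open>G\<close> is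
  abelian and is central in the hyperplane \<open>F = G M\<close> of \<open>\<Gamma>\<close>; outside \<open>F\<close> the breadth of \<open>g y\<close> equals that
  of \<open>y \<in> P\<close>. So \<open>F\<close> is a third exceptional hyperplane from the start, and \<open>card_derived_le_split\<close> deals
  with it: the commutators with an element of the second centre whose centralizer is \<open>F\<close> are factored
  out. If \<open>F\<close> belongs to the pencil of the two given hyperplanes, what is then known on a fourth
  hyperplane of this pencil and on \<open>F\<close> suffices to continue (\<open>pencil_bound\<close>).
\<close>

section \<open>Commutators and centralizers\<close>

abbreviation cmt :: "('a, 'b) monoid_scheme \<Rightarrow> 'a \<Rightarrow> 'a \<Rightarrow> 'a" where
  "cmt G x y \<equiv> x \<otimes>\<^bsub>G\<^esub> y \<otimes>\<^bsub>G\<^esub> inv\<^bsub>G\<^esub> x \<otimes>\<^bsub>G\<^esub> inv\<^bsub>G\<^esub> y"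

context group begin

lemma inv_cancel_left: "x \<in> carrier G \<Longrightarrow> y \<in> carrier G \<Longrightarrow> inv x \<otimes> (x \<otimes> y) = y"
  by (simp flip: m_assoc)

lemma cancel_inv_left: "x \<in> carrier G \<Longrightarrow> y \<in> carrier G \<Longrightarrow> x \<otimes> (inv x \<otimes> y) = y"
  by (simp flip: m_assoc)

lemmas group_word = m_assoc inv_mult_group inv_cancel_left cancel_inv_left

lemma cmt_eq_one_iff:
  assumes "x \<in> carrier G" "y \<in> carrier G"
  shows "cmt G x y = \<one> \<longleftrightarrow> x \<otimes> y = y \<otimes> x"
proof
  assume h: "cmt G x y = \<one>"
  have "cmt G x y \<otimes> (y \<otimes> x) = x \<otimes> y" using assms by (simp add: group_word)
  then show "x \<otimes> y = y \<otimes> x" using h assms by simp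
next
  assume h: "x \<otimes> y = y \<otimes> x"
  have "cmt G x y = (x \<otimes> y) \<otimes> inv (y \<otimes> x)" using assms by (simp add: group_word)
  then show "cmt G x y = \<one>" using h assms by simp
qed

lemma cmt_mult_right:
  assumes "x \<in> carrier G" "g \<in> carrier G" "h \<in> carrier G"
  shows "cmt G x (g \<otimes> h) = cmt G x g \<otimes> (g \<otimes> cmt G x h \<otimes> inv g)"
  using assms by (simp add: group_word)

lemma cmt_mult_left:
  assumes "x \<in> carrier G" "y \<in> carrier G" "g \<in> carrier G"
  shows "cmt G (x \<otimes> y) g = (x \<otimes> cmt G y g \<otimes> inv x) \<otimes> cmt G x g"
  using assms by (simp add: group_word)

lemma inv_cmt:
  assumes "x \<in> carrier G" "g \<in> carrier G"
  shows "inv (cmt G x g) = cmt G g x"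
  using assms by (simp add: group_word)

lemma cmt_inv_right:
  assumes "x \<in> carrier G" "g \<in> carrier G"
  shows "cmt G x (inv g) = inv g \<otimes> inv (cmt G x g) \<otimes> g"
  using assms by (simp add: group_word)

lemma finite_sub: "finite (carrier G) \<Longrightarrow> subgroup H G \<Longrightarrow> finite H"
  using finite_subset subgroup.subset by blast

lemma card_sub_pos: "finite (carrier G) \<Longrightarrow> subgroup H G \<Longrightarrow> 0 < card H"
  using finite_sub subgroup.one_closed card_gt_0_iff by blast

text \<open>The fibres of the multiplication map on \<open>A \<times> B\<close> inject into \<open>A \<inter> B\<close>.\<close>
lemma card_mult_le_card_inter:
  assumes fin: "finite (carrier G)" and A: "subgroup A G" and B: "subgroup B G"
  shows "card A * card B \<le> card (carrier G) * card (A \<inter> B)"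
proof -
  let ?f = "\<lambda>(a, b). a \<otimes> b"
  have cA: "A \<subseteq> carrier G" and cB: "B \<subseteq> carrier G" using A B subgroup.subset by blast+
  have finA: "finite A" and finB: "finite B" using fin A B finite_sub by auto
  have fib: "card {q \<in> A \<times> B. ?f q = y} \<le> card (A \<inter> B)" for y
  proof (cases "{q \<in> A \<times> B. ?f q = y} = {}")
    case False
    then obtain a b where ab: "a \<in> A" "b \<in> B" "a \<otimes> b = y" by auto
    have c: "a \<in> carrier G" "b \<in> carrier G" using ab cA cB by auto
    let ?S = "{q \<in> A \<times> B. ?f q = y}"
    have inj: "inj_on (\<lambda>q. inv a \<otimes> fst q) ?S"
    proof (rule inj_onI)
      fix q1 q2 assume q: "q1 \<in> ?S" "q2 \<in> ?S" and e: "inv a \<otimes> fst q1 = inv a \<otimes> fst q2"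
      obtain a1 b1 a2 b2 where qq: "q1 = (a1, b1)" "q2 = (a2, b2)" by fastforce
      have d: "a1 \<in> carrier G" "b1 \<in> carrier G" "a2 \<in> carrier G" "b2 \<in> carrier G"
        "a1 \<otimes> b1 = y" "a2 \<otimes> b2 = y"
        using q qq cA cB by auto
      have "a1 = a2" using e qq c d by simp
      moreover have "b1 = b2" using calculation d by (metis l_cancel)
      ultimately show "q1 = q2" using qq by simp
    qed
    have img: "(\<lambda>q. inv a \<otimes> fst q) ` ?S \<subseteq> A \<inter> B"
    proof (rule image_subsetI)
      fix q assume q: "q \<in> ?S"
      obtain a1 b1 where qq: "q = (a1, b1)" by fastforce
      have h: "a1 \<in> A" "b1 \<in> B" "a1 \<otimes> b1 = y" using q qq by auto
      have d: "a1 \<in> carrier G" "b1 \<in> carrier G" using h cA cB by auto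
      have "a1 \<otimes> b1 = a \<otimes> b" using h ab by simp
      then have "inv a \<otimes> (a1 \<otimes> b1) \<otimes> inv b1 = inv a \<otimes> (a \<otimes> b) \<otimes> inv b1" by simp
      then have e: "inv a \<otimes> a1 = b \<otimes> inv b1" using c d by (simp add: group_word)
      have "inv a \<otimes> a1 \<in> A" using h ab A by (simp add: subgroup.m_closed subgroup.m_inv_closed)
      moreover have "b \<otimes> inv b1 \<in> B" using h ab B by (simp add: subgroup.m_closed subgroup.m_inv_closed)
      ultimately show "inv a \<otimes> fst q \<in> A \<inter> B" using e qq by simp
    qed
    from card_inj_on_le[OF inj img] finA show ?thesis by simp
  next
    case True
    show ?thesis unfolding True by simp
  qed
  have "card A * card B = card (A \<times> B)" by (simp add: card_cartesian_product)
  also have "\<dots> = (\<Sum>y\<in>?f ` (A \<times> B). card {q \<in> A \<times> B. ?f q = y})"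
    using sum.image_gen[of "A \<times> B" "\<lambda>_. 1::nat" ?f] finA finB by (simp only: card_eq_sum finite_cartesian_product)
  also have "\<dots> \<le> (\<Sum>y\<in>?f ` (A \<times> B). card (A \<inter> B))" by (rule sum_mono) (rule fib)
  also have "\<dots> = card (?f ` (A \<times> B)) * card (A \<inter> B)" by simp
  also have "\<dots> \<le> card (carrier G) * card (A \<inter> B)"
    using cA cB by (intro mult_right_mono card_mono fin) auto
  finally show ?thesis .
qed

lemma mult_mem_iff:
  assumes E: "subgroup E G" and g: "g \<in> E" and y: "y \<in> carrier G"
  shows "g \<otimes> y \<in> E \<longleftrightarrow> y \<in> E"
proof
  assume "g \<otimes> y \<in> E"
  then have "inv g \<otimes> (g \<otimes> y) \<in> E" by (rule subgroup.m_closed[OF E subgroup.m_inv_closed[OF E g]])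
  then show "y \<in> E" using y subgroup.mem_carrier[OF E g] by (simp add: inv_cancel_left)
qed (rule subgroup.m_closed[OF E g])

lemma mult_mem_iff_right:
  assumes E: "subgroup E G" and g: "g \<in> E" and y: "y \<in> carrier G"
  shows "y \<otimes> g \<in> E \<longleftrightarrow> y \<in> E"
proof
  assume "y \<otimes> g \<in> E"
  then have "(y \<otimes> g) \<otimes> inv g \<in> E" by (rule subgroup.m_closed[OF E _ subgroup.m_inv_closed[OF E g]])
  then show "y \<in> E" using y subgroup.mem_carrier[OF E g] by (simp add: m_assoc)
qed (use subgroup.m_closed[OF E _ g] in blast)

lemma subgroup_nat_pow:
  assumes S: "subgroup S G" and x: "x \<in> S" shows "x [^] (n::nat) \<in> S"
proof (induction n)
  case 0 show ?case using subgroup.one_closed[OF S] by simp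
next
  case (Suc n) then show ?case using subgroup.m_closed[OF S Suc x] by simp
qed

lemma exists_off_two_subgroups:
  assumes F: "subgroup F G" and U: "subgroup U G" "\<not> F \<subseteq> U" and V: "subgroup V G" "\<not> F \<subseteq> V"
  shows "\<exists>x\<in>F. x \<notin> U \<and> x \<notin> V"
proof (rule ccontr)
  assume no: "\<not> ?thesis"
  obtain u v where u: "u \<in> F" "u \<notin> U" and v: "v \<in> F" "v \<notin> V" using U(2) V(2) by blast
  have uV: "u \<in> V" and vU: "v \<in> U" using no u v by blast+
  have c: "u \<in> carrier G" "v \<in> carrier G" using u v subgroup.mem_carrier[OF F] by auto
  have "u \<otimes> v \<in> F" by (rule subgroup.m_closed[OF F u(1) v(1)])
  then consider "u \<otimes> v \<in> U" | "u \<otimes> v \<in> V" using no by blast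
  then show False
  proof cases
    case 1
    have "(u \<otimes> v) \<otimes> inv v \<in> U" by (rule subgroup.m_closed[OF U(1) 1 subgroup.m_inv_closed[OF U(1) vU]])
    then show False using u(2) c by (simp add: m_assoc)
  next
    case 2
    have "inv u \<otimes> (u \<otimes> v) \<in> V" by (rule subgroup.m_closed[OF V(1) subgroup.m_inv_closed[OF V(1) uV] 2])
    then show False using v(2) c by (simp add: inv_cancel_left)
  qed
qed

lemma subgroup_centralizer:
  assumes "x \<in> carrier G" shows "subgroup (centralizer G x) G"
proof (rule subgroupI)
  show "centralizer G x \<subseteq> carrier G" "centralizer G x \<noteq> {}"
    using assms by (auto simp: centralizer_def)
  fix a assume a: "a \<in> centralizer G x"
  then have "a \<otimes> x = x \<otimes> a" "a \<in> carrier G" by (auto simp: centralizer_def)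
  then have "inv a \<otimes> x = x \<otimes> inv a" using assms
    by (metis inv_closed inv_solve_left inv_solve_right m_assoc m_closed)
  then show "inv a \<in> centralizer G x" using a by (auto simp: centralizer_def)
  fix b assume b: "b \<in> centralizer G x"
  then show "a \<otimes> b \<in> centralizer G x" using a assms
    by (auto simp: centralizer_def) (metis m_assoc)
qed

lemma centralizer_iff_cmt:
  "x \<in> carrier G \<Longrightarrow> g \<in> centralizer G x \<longleftrightarrow> g \<in> carrier G \<and> cmt G x g = \<one>"
  by (auto simp: centralizer_def cmt_eq_one_iff)

end

text \<open>The elements whose commutator with \<open>x\<close> falls into \<open>A\<close>: for normal \<open>A\<close>, the preimage of a
  centralizer of the quotient by \<open>A\<close>.\<close>
definition centralizer_mod :: "('a, 'b) monoid_scheme \<Rightarrow> 'a set \<Rightarrow> 'a \<Rightarrow> 'a set" where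
  "centralizer_mod G A x = {g \<in> carrier G. cmt G x g \<in> A}"

lemma (in group) subgroup_centralizer_mod:
  assumes "A \<lhd> G" "x \<in> carrier G" shows "subgroup (centralizer_mod G A x) G"
proof -
  interpret A: normal A G by fact
  show ?thesis
  proof (rule subgroupI)
    show "centralizer_mod G A x \<subseteq> carrier G" by (auto simp: centralizer_mod_def)
    have "cmt G x \<one> = \<one>" using assms(2) by simp
    then have "\<one> \<in> centralizer_mod G A x" unfolding centralizer_mod_def by simp
    then show "centralizer_mod G A x \<noteq> {}" by blast
    fix g assume g: "g \<in> centralizer_mod G A x"
    then have gc: "g \<in> carrier G" "cmt G x g \<in> A" by (auto simp: centralizer_mod_def)
    have "cmt G x (inv g) \<in> A"
      using cmt_inv_right[OF assms(2) gc(1)] A.inv_op_closed1[OF gc(1)] gc A.m_inv_closed by metis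
    then show "inv g \<in> centralizer_mod G A x" using gc by (simp add: centralizer_mod_def)
    fix h assume h: "h \<in> centralizer_mod G A x"
    then have hc: "h \<in> carrier G" "cmt G x h \<in> A" by (auto simp: centralizer_mod_def)
    have "cmt G x (g \<otimes> h) \<in> A"
      using cmt_mult_right[OF assms(2) gc(1) hc(1)] A.inv_op_closed2[OF gc(1)] gc hc A.m_closed by metis
    then show "g \<otimes> h \<in> centralizer_mod G A x" using gc hc by (simp add: centralizer_mod_def)
  qed
qed

section \<open>Subgroups containing all commutators and all \<open>p\<close>-th powers\<close>

text \<open>The breadth of \<open>x\<close> is the logarithm of the index of its centralizer.\<close>
definition breadth_le :: "nat \<Rightarrow> nat \<Rightarrow> ('a, 'b) monoid_scheme \<Rightarrow> 'a \<Rightarrow> bool" where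
  "breadth_le p k G x \<longleftrightarrow> card (carrier G) \<le> p ^ k * card (centralizer G x)"

text \<open>Subgroups that contain the Frattini subgroup correspond to the subspaces of a vector space over the
  field with \<open>p\<close> elements; this is what makes counting arguments with hyperplanes work.\<close>
definition over_frattini :: "nat \<Rightarrow> ('a, 'b) monoid_scheme \<Rightarrow> 'a set \<Rightarrow> bool" where
  "over_frattini p G E \<longleftrightarrow> subgroup E G \<and> (\<forall>x\<in>carrier G. \<forall>y\<in>carrier G. cmt G x y \<in> E) \<and>
     (\<forall>x\<in>carrier G. x [^]\<^bsub>G\<^esub> p \<in> E)"

definition hyperplane :: "nat \<Rightarrow> ('a, 'b) monoid_scheme \<Rightarrow> 'a set \<Rightarrow> bool" where
  "hyperplane p G H \<longleftrightarrow> over_frattini p G H \<and> p * card H = card (carrier G)"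

text \<open>For normal \<open>E\<close>, this is the subgroup generated by \<open>E\<close> and \<open>x\<close>.\<close>
definition adjoin :: "('a, 'b) monoid_scheme \<Rightarrow> 'a set \<Rightarrow> 'a \<Rightarrow> 'a set" where
  "adjoin G E x = {e \<otimes>\<^bsub>G\<^esub> x [^]\<^bsub>G\<^esub> i | e i. e \<in> E \<and> i \<in> (UNIV :: nat set)}"

context group begin

text \<open>In a finite group, the inverse of an element is one of its powers.\<close>
lemma finite_closed_subgroup:
  assumes fin: "finite (carrier G)" and H: "H \<subseteq> carrier G" "H \<noteq> {}"
    and cl: "\<And>x y. x \<in> H \<Longrightarrow> y \<in> H \<Longrightarrow> x \<otimes> y \<in> H"
  shows "subgroup H G"
proof -
  have pw: "x [^] Suc n \<in> H" if "x \<in> H" for x n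
  proof (induction n)
    case 0 then show ?case using that H by (simp add: subsetD)
  next
    case (Suc n)
    then show ?case using cl[OF Suc that] by (simp only: nat_pow_Suc)
  qed
  have pos: "0 < order G" using fin order_gt_0_iff_finite by blast
  show ?thesis
  proof (rule subgroupI)
    show "H \<subseteq> carrier G" "H \<noteq> {}" by fact+
    fix x assume x: "x \<in> H"
    then have xc: "x \<in> carrier G" using H by blast
    obtain m where m: "order G = Suc m" using pos by (metis not0_implies_Suc less_numeral_extra(3))
    have one: "x [^] Suc m = \<one>" using pow_order_eq_1[OF xc] m by simp
    have "x [^] m \<otimes> x = \<one>" using one by simp
    then have "inv x = x [^] m" using inv_equality xc by simp
    also have "\<dots> = x [^] m \<otimes> x [^] Suc m" using one xc by simp
    also have "\<dots> = x [^] Suc (m + m)" using nat_pow_mult[OF xc, of m "Suc m"] by (simp only: add_Suc_right)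
    finally show "inv x \<in> H" using pw[OF x] by simp
  qed (use cl in auto)
qed

lemma normal_if_cmt_mem:
  assumes E: "subgroup E G" and c: "\<And>x y. x \<in> carrier G \<Longrightarrow> y \<in> carrier G \<Longrightarrow> cmt G x y \<in> E"
  shows "E \<lhd> G"
  unfolding normal_inv_iff
proof (intro conjI ballI)
  fix x h assume h: "x \<in> carrier G" "h \<in> E"
  have hc: "h \<in> carrier G" by (rule subgroup.mem_carrier[OF E h(2)])
  have e: "x \<otimes> h \<otimes> inv x = cmt G x h \<otimes> h" using h hc by (simp add: group_word)
  show "x \<otimes> h \<otimes> inv x \<in> E"
    by (subst e) (rule subgroup.m_closed[OF E c[OF h(1) hc] h(2)])
qed (rule E)

lemma over_frattini_normal: "over_frattini p G E \<Longrightarrow> E \<lhd> G"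
  using normal_if_cmt_mem unfolding over_frattini_def by blast

lemma subset_adjoin: "E \<subseteq> carrier G \<Longrightarrow> E \<subseteq> adjoin G E x"
  unfolding adjoin_def
proof
  fix e assume "E \<subseteq> carrier G" "e \<in> E"
  then have "e = e \<otimes> x [^] (0::nat) \<and> e \<in> E \<and> (0::nat) \<in> UNIV" by (simp add: subset_iff)
  then show "e \<in> {e \<otimes> x [^] i | e i. e \<in> E \<and> i \<in> (UNIV :: nat set)}" by blast
qed

lemma mem_adjoin: "subgroup E G \<Longrightarrow> x \<in> carrier G \<Longrightarrow> x \<in> adjoin G E x"
  unfolding adjoin_def by (auto intro!: exI[of _ "1::nat"] exI[of _ \<one>] simp: subgroup.one_closed)

lemma subgroup_adjoin:
  assumes fin: "finite (carrier G)" and E: "E \<lhd> G" and x: "x \<in> carrier G"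
  shows "subgroup (adjoin G E x) G"
proof (rule finite_closed_subgroup[OF fin])
  interpret E: normal E G by fact
  show "adjoin G E x \<subseteq> carrier G" using x E.subset by (auto simp: adjoin_def)
  show "adjoin G E x \<noteq> {}" using mem_adjoin[OF E.is_subgroup x] by blast
  fix u v assume "u \<in> adjoin G E x" "v \<in> adjoin G E x"
  then obtain e i f j where uv: "u = e \<otimes> x [^] (i::nat)" "v = f \<otimes> x [^] (j::nat)" "e \<in> E" "f \<in> E"
    unfolding adjoin_def by blast
  let ?f = "x [^] i \<otimes> f \<otimes> inv (x [^] i)"
  have c: "e \<in> carrier G" "f \<in> carrier G" using uv E.subset by auto
  have "u \<otimes> v = (e \<otimes> ?f) \<otimes> (x [^] i \<otimes> x [^] j)" using uv c x by (simp add: group_word)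
  also have "\<dots> = (e \<otimes> ?f) \<otimes> x [^] (i + j)" using x by (simp add: nat_pow_mult)
  finally show "u \<otimes> v \<in> adjoin G E x"
    unfolding adjoin_def using uv E.inv_op_closed2[of "x [^] i" f] x by blast
qed

text \<open>The value of \<open>[a, g]\<close> depends on the coset of \<open>g\<close> modulo the centralizer of \<open>a\<close> only.\<close>
lemma card_cmt_image:
  assumes fin: "finite (carrier G)" and a: "a \<in> carrier G"
  shows "card ((\<lambda>g. cmt G a g) ` carrier G) * card (centralizer G a) \<le> card (carrier G)"
proof -
  let ?f = "\<lambda>g. cmt G a g"
  have "card (centralizer G a) \<le> card {h \<in> carrier G. ?f h = y}" if y: "y \<in> ?f ` carrier G" for y
  proof -
    obtain g where g: "g \<in> carrier G" "y = ?f g" using y by blast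
    have sub: "(\<lambda>c. g \<otimes> c) ` centralizer G a \<subseteq> {h \<in> carrier G. ?f h = y}"
    proof (rule image_subsetI)
      fix c assume "c \<in> centralizer G a"
      then have c: "c \<in> carrier G" "?f c = \<one>" using centralizer_iff_cmt[OF a] by auto
      have "?f (g \<otimes> c) = ?f g \<otimes> (g \<otimes> ?f c \<otimes> inv g)" by (rule cmt_mult_right[OF a g(1) c(1)])
      also have "\<dots> = ?f g \<otimes> (g \<otimes> \<one> \<otimes> inv g)" by (simp only: c(2))
      also have "\<dots> = ?f g" using a g by simp
      finally show "g \<otimes> c \<in> {h \<in> carrier G. ?f h = y}" using g c by simp
    qed
    have inj: "inj_on (\<lambda>c. g \<otimes> c) (centralizer G a)"
      by (rule inj_onI) (use g in \<open>auto simp: centralizer_def\<close>)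
    show ?thesis using card_inj_on_le[OF inj sub] fin by simp
  qed
  then have "(\<Sum>y\<in>?f ` carrier G. card (centralizer G a)) \<le> (\<Sum>y\<in>?f ` carrier G. card {h \<in> carrier G. ?f h = y})"
    by (rule sum_mono)
  also have "\<dots> = card (carrier G)"
    using sum.image_gen[of "carrier G" "\<lambda>_. 1::nat" ?f] fin by (simp only: card_eq_sum)
  finally show ?thesis by simp
qed

end

locale p_grp = group G for G :: "('a, 'b) monoid_scheme" (structure) +
  fixes p :: nat
  assumes prime_p: "Factorial_Ring.prime p" and order_pow: "\<exists>n. card (carrier G) = p ^ n"
begin

lemma p_gt_1: "1 < p" using prime_p prime_gt_1_nat by blast

lemma fin: "finite (carrier G)"
  using order_pow p_gt_1 by (metis card.infinite less_nat_zero_code power_not_zero)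

lemma card_power:
  assumes "subgroup H G" obtains n where "card H = p ^ n"
proof -
  have "card H dvd card (carrier G)" using lagrange[OF assms] unfolding order_def by (metis dvd_triv_right)
  then show ?thesis using order_pow prime_p that by (metis divides_primepow_nat)
qed

lemma p_mult_card_le:
  assumes "subgroup A G" "subgroup B G" "card A < card B"
  shows "p * card A \<le> card B"
proof -
  obtain m n where "card A = p ^ m" "card B = p ^ n" using card_power assms by metis
  moreover from this have "Suc m \<le> n"
    using assms(3) p_gt_1 by (metis Suc_leI power_strict_increasing_iff)
  ultimately show ?thesis using p_gt_1 by (metis power_Suc power_increasing less_imp_le_nat)
qed

lemma p_mult_card_le_psubset:
  assumes "subgroup A G" "subgroup B G" "A \<subset> B"
  shows "p * card A \<le> card B"
  using assms p_mult_card_le finite_sub[OF fin] psubset_card_mono by metis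

lemma over_frattini_adjoin:
  assumes E: "over_frattini p G E" and x: "x \<in> carrier G" "x \<notin> E"
  shows "over_frattini p G (adjoin G E x)" "card (adjoin G E x) = p * card E"
proof -
  have sE: "subgroup E G" using E over_frattini_def by blast
  have sub: "subgroup (adjoin G E x) G"
    using subgroup_adjoin[OF fin over_frattini_normal[OF E] x(1)] .
  have le: "E \<subseteq> adjoin G E x" using subset_adjoin subgroup.subset[OF sE] by blast
  show "over_frattini p G (adjoin G E x)" using E sub le unfolding over_frattini_def by blast
  have "E \<subset> adjoin G E x" using le mem_adjoin[OF sE x(1)] x(2) by blast
  then have ge: "p * card E \<le> card (adjoin G E x)" using p_mult_card_le_psubset sE sub by blast
  have "adjoin G E x \<subseteq> (\<lambda>(e, i). e \<otimes> x [^] i) ` (E \<times> {..<p})"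
  proof
    fix u assume "u \<in> adjoin G E x"
    then obtain e i where u: "u = e \<otimes> x [^] (i::nat)" "e \<in> E" unfolding adjoin_def by blast
    have ec: "e \<in> carrier G" using subgroup.mem_carrier[OF sE u(2)] .
    have "x [^] p \<in> E" using E x unfolding over_frattini_def by blast
    then have "(x [^] p) [^] m \<in> E" for m :: nat
      by (induction m) (use sE in \<open>auto simp: subgroup.one_closed subgroup.m_closed\<close>)
    then have q: "(x [^] p) [^] (i div p) \<in> E" .
    have "x [^] i = x [^] (p * (i div p) + i mod p)" by simp
    also have "\<dots> = (x [^] p) [^] (i div p) \<otimes> x [^] (i mod p)"
      using x by (simp only: nat_pow_mult[symmetric] nat_pow_pow)
    finally have "u = (e \<otimes> (x [^] p) [^] (i div p)) \<otimes> x [^] (i mod p)" using u ec x by (simp add: m_assoc)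
    moreover have "e \<otimes> (x [^] p) [^] (i div p) \<in> E" using u q sE by (simp add: subgroup.m_closed)
    moreover have "i mod p < p" using p_gt_1 by simp
    ultimately show "u \<in> (\<lambda>(e, i). e \<otimes> x [^] i) ` (E \<times> {..<p})" by force
  qed
  then have "card (adjoin G E x) \<le> card (E \<times> {..<p})"
    using finite_sub[OF fin sE] by (meson finite_SigmaI finite_lessThan surj_card_le)
  then show "card (adjoin G E x) = p * card E" using ge by (simp add: card_cartesian_product mult.commute)
qed

lemma hyperplane_subgroup: "hyperplane p G H \<Longrightarrow> subgroup H G"
  by (simp add: hyperplane_def over_frattini_def)

lemma hyperplane_normal: "hyperplane p G H \<Longrightarrow> H \<lhd> G"
  using over_frattini_normal hyperplane_def by blast

lemma exists_hyperplane:
  assumes "over_frattini p G E" "card E < card (carrier G)"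
  shows "\<exists>M. hyperplane p G M \<and> E \<subseteq> M"
  using assms
proof (induction "card (carrier G) - card E" arbitrary: E rule: less_induct)
  case less
  have sE: "subgroup E G" using less.prems over_frattini_def by blast
  have cE: "E \<subseteq> carrier G" using sE subgroup.subset by blast
  show ?case
  proof (cases "p * card E = card (carrier G)")
    case True then show ?thesis using less.prems hyperplane_def by blast
  next
    case False
    have "p * card E \<le> card (carrier G)"
      using p_mult_card_le[OF sE subgroup_self less.prems(2)] .
    with False have lt: "p * card E < card (carrier G)" by simp
    obtain x where x: "x \<in> carrier G" "x \<notin> E" using less.prems(2) cE by (metis less_irrefl subsetI subset_antisym)
    note adj = over_frattini_adjoin[OF less.prems(1) x]
    have "card E < card (adjoin G E x)" using adj(2) p_gt_1 card_sub_pos[OF fin sE] by simp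
    then have "\<exists>M. hyperplane p G M \<and> adjoin G E x \<subseteq> M"
      using less.hyps[OF _ adj(1)] adj(2) lt less.prems(2) by (metis diff_less_mono2)
    then show ?thesis using subset_adjoin[OF cE] by blast
  qed
qed

text \<open>Each further element raises the dimension by at most one.\<close>
lemma exists_hyperplane_with:
  assumes "over_frattini p G E" "p ^ Suc (length xs) * card E \<le> card (carrier G)" "set xs \<subseteq> carrier G"
  shows "\<exists>M. hyperplane p G M \<and> E \<subseteq> M \<and> set xs \<subseteq> M"
  using assms
proof (induction xs arbitrary: E)
  case Nil
  then have "subgroup E G" using over_frattini_def by blast
  then have "0 < card E" using card_sub_pos[OF fin] by blast
  then have "card E < p * card E" using p_gt_1 by simp
  then have "card E < card (carrier G)" using Nil(2) by (simp only: list.size power_Suc power_0 mult_1_right)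
  then show ?case using exists_hyperplane[OF Nil(1)] by auto
next
  case (Cons x xs)
  have sE: "subgroup E G" using Cons.prems over_frattini_def by blast
  show ?case
  proof (cases "x \<in> E")
    case True
    have "p ^ Suc (length xs) * card E \<le> p ^ Suc (length (x # xs)) * card E"
      using p_gt_1 by (intro mult_right_mono power_increasing) auto
    then have "\<exists>M. hyperplane p G M \<and> E \<subseteq> M \<and> set xs \<subseteq> M"
      using Cons.IH[OF Cons.prems(1) le_trans[OF _ Cons.prems(2)]] Cons.prems(3) by simp
    then show ?thesis using True by auto
  next
    case False
    have x: "x \<in> carrier G" using Cons.prems by simp
    note adj = over_frattini_adjoin[OF Cons.prems(1) x False]
    obtain M where "hyperplane p G M" "adjoin G E x \<subseteq> M" "set xs \<subseteq> M"
      using Cons.IH[OF adj(1)] adj(2) Cons.prems by (auto simp: mult.assoc mult.left_commute)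
    then show ?thesis using subset_adjoin[of E x] mem_adjoin[OF sE x] subgroup.subset[OF sE] by auto
  qed
qed

text \<open>A maximal proper subgroup that contains the commutators also contains the \<open>p\<close>-th powers: otherwise
  \<open>x\<close> would be congruent modulo this subgroup to a power of \<open>x [^] p\<close>, hence, by iteration, to a power
  of \<open>x [^] p ^ s\<close> for every \<open>s\<close>, that is, to \<open>\<one>\<close>.\<close>
lemma exists_hyperplane_over_derived:
  assumes H: "subgroup H G" "\<And>x y. x \<in> carrier G \<Longrightarrow> y \<in> carrier G \<Longrightarrow> cmt G x y \<in> H" "H \<noteq> carrier G"
  shows "\<exists>M. hyperplane p G M \<and> H \<subseteq> M"
proof -
  let ?S = "{M. subgroup M G \<and> H \<subseteq> M \<and> M \<noteq> carrier G}"
  have "finite ?S" by (rule finite_subset[of _ "Pow (carrier G)"]) (auto simp: fin dest: subgroup.subset)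
  moreover have "H \<in> ?S" using H by simp
  ultimately obtain M where M: "M \<in> ?S" and mx: "\<And>N. N \<in> ?S \<Longrightarrow> M \<subseteq> N \<Longrightarrow> M = N"
    using finite_has_maximal2 by (metis (no_types, lifting) subset_refl)
  have sM: "subgroup M G" and HM: "H \<subseteq> M" and Mne: "M \<noteq> carrier G" using M by auto
  have cM: "cmt G x y \<in> M" if "x \<in> carrier G" "y \<in> carrier G" for x y using H(2) HM that by blast
  have nM: "M \<lhd> G" using normal_if_cmt_mem[OF sM cM] .
  interpret M: normal M G by fact
  interpret Q: group "G Mod M" by (rule M.factorgroup_is_group)
  have pw: "x [^] p \<in> M" if x: "x \<in> carrier G" for x
  proof (rule ccontr)
    assume np: "x [^] p \<notin> M"
    let ?K = "adjoin G M (x [^] p)"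
    have "subgroup ?K G" using subgroup_adjoin[OF fin nM] x by simp
    moreover have "M \<subseteq> ?K" using subset_adjoin M.subset by blast
    moreover have "x [^] p \<in> ?K" using mem_adjoin[OF sM] x by simp
    ultimately have "?K = carrier G" using mx[of ?K] HM np by blast
    then obtain h i where hi: "h \<in> M" "x = h \<otimes> (x [^] p) [^] (i::nat)" using x unfolding adjoin_def by blast
    let ?X = "M #> x"
    have X: "?X \<in> carrier (G Mod M)" using x by (auto simp: FactGroup_def RCOSETS_def)
    have pwX: "?X [^]\<^bsub>G Mod M\<^esub> n = M #> (x [^] n)" for n :: nat
      using M.FactGroup_pow[OF x] by simp
    have "?X = M #> (x [^] (p * i))"
    proof -
      have "M #> x = M #> (h \<otimes> x [^] (p * i))" using hi x by (simp add: nat_pow_pow)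
      also have "\<dots> = M #> h #> x [^] (p * i)" using hi x M.subset by (simp add: coset_mult_assoc)
      also have "M #> h = M" using hi sM by (simp add: coset_join2)
      finally show ?thesis .
    qed
    then have e: "?X [^]\<^bsub>G Mod M\<^esub> (p * i) = ?X" using pwX by simp
    have "?X [^]\<^bsub>G Mod M\<^esub> ((p * i) ^ s) = ?X" for s
    proof (induction s)
      case 0 then show ?case using pwX[of 1] x by simp
    next
      case (Suc s)
      have "?X [^]\<^bsub>G Mod M\<^esub> ((p * i) ^ Suc s) = (?X [^]\<^bsub>G Mod M\<^esub> (p * i)) [^]\<^bsub>G Mod M\<^esub> ((p * i) ^ s)"
        using X by (simp add: Q.nat_pow_pow)
      then show ?case using e Suc by simp
    qed
    then have e2: "M #> (x [^] ((p * i) ^ s)) = M #> x" for s using pwX by simp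
    obtain s where s: "card (carrier G) = p ^ s" using order_pow by blast
    have "x [^] ((p * i) ^ s) = (x [^] (p ^ s)) [^] (i ^ s)" using x by (simp add: nat_pow_pow power_mult_distrib)
    also have "x [^] (p ^ s) = \<one>" using pow_order_eq_1[OF x] s by (simp add: order_def)
    finally have "M #> x = M" using e2[of s] M.subset by simp
    then have "x \<in> M" using rcos_self[OF x sM] by simp
    then have "x [^] p \<in> M" by (induction p) (auto simp: M.one_closed M.m_closed)
    then show False using np by blast
  qed
  have "over_frattini p G M" using sM cM pw unfolding over_frattini_def by blast
  moreover have "card M < card (carrier G)" using M.subset Mne fin by (simp add: psubset_card_mono psubset_eq)
  ultimately obtain M' where "hyperplane p G M'" "M \<subseteq> M'" using exists_hyperplane by blast
  then show ?thesis using HM by blast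
qed

end

section \<open>Quotients of \<open>p\<close>-groups\<close>

context p_grp begin

lemma p_grp_subgroup: "subgroup R G \<Longrightarrow> p_grp (G\<lparr>carrier := R\<rparr>) p"
  using subgroup_imp_group prime_p card_power[of R] unfolding p_grp_def p_grp_axioms_def by auto

text \<open>The conjugacy classes in a normal subgroup \<open>M\<close> have \<open>p\<close>-power size, so that the number of central
  elements of \<open>M\<close> is divisible by \<open>p\<close>.\<close>
lemma normal_meets_center:
  assumes M: "M \<lhd> G" "M \<noteq> {\<one>}"
  shows "\<exists>z\<in>M. z \<noteq> \<one> \<and> z [^] p = \<one> \<and> (\<forall>g\<in>carrier G. g \<otimes> z = z \<otimes> g)"
proof -
  interpret M: normal M G by fact
  interpret act: group_action G "carrier G" "\<lambda>g. \<lambda>h\<in>carrier G. g \<otimes> h \<otimes> inv g"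
    by (rule action_by_conjugation)
  let ?act = "\<lambda>g. \<lambda>h\<in>carrier G. g \<otimes> h \<otimes> inv g"
  let ?O = "\<lambda>x. orbit G ?act x"
  have orb: "?O x = {g \<otimes> x \<otimes> inv g | g. g \<in> carrier G}" if "x \<in> carrier G" for x
    using that by (auto simp: orbit_def)
  have "\<exists>z\<in>M. z \<noteq> \<one> \<and> (\<forall>g\<in>carrier G. g \<otimes> z = z \<otimes> g)"
  proof (rule ccontr)
    assume no: "\<not> ?thesis"
    have dvd: "p dvd card (?O x)" if x: "x \<in> M" "x \<noteq> \<one>" for x
    proof -
      have xc: "x \<in> carrier G" using x by simp
      have "card (?O x) * card (stabilizer G ?act x) = order G" by (rule act.orbit_stabilizer_theorem[OF xc])
      then have "card (?O x) dvd card (carrier G)" unfolding order_def by (rule dvdI[OF sym])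
      moreover obtain n where "card (carrier G) = p ^ n" using order_pow by blast
      ultimately obtain i where i: "card (?O x) = p ^ i" using divides_primepow_nat[OF prime_p, of "card (?O x)" n] by auto
      have "i \<noteq> 0"
      proof
        assume "i = 0"
        then obtain y where y: "?O x = {y}" using i by (auto simp: card_1_singleton_iff)
        have "\<one> \<otimes> x \<otimes> inv \<one> \<in> ?O x" using orb[OF xc] by blast
        then have "y = x" using y xc by simp
        then have "g \<otimes> x \<otimes> inv g = x" if "g \<in> carrier G" for g using that y orb[OF xc] by blast
        then have "g \<otimes> x = x \<otimes> g" if "g \<in> carrier G" for g
          using that xc by (metis inv_solve_right' m_closed)
        then show False using no x by blast
      qed
      then show ?thesis using i by simp
    qed
    let ?C = "?O ` (M - {\<one>})"
    have un: "\<Union>?C = M - {\<one>}"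
    proof
      show "\<Union>?C \<subseteq> M - {\<one>}"
      proof
        fix y assume "y \<in> \<Union>?C"
        then obtain x where x: "x \<in> M" "x \<noteq> \<one>" and y: "y \<in> ?O x" by blast
        obtain g where g: "g \<in> carrier G" "y = g \<otimes> x \<otimes> inv g" using y orb x by auto
        have "x = inv g \<otimes> y \<otimes> g" using g x by (simp add: group_word)
        then have "y \<noteq> \<one>" using x g by auto
        then show "y \<in> M - {\<one>}" using g x M.inv_op_closed2 by simp
      qed
      show "M - {\<one>} \<subseteq> \<Union>?C"
      proof
        fix x assume x: "x \<in> M - {\<one>}"
        then have xc: "x \<in> carrier G" by simp
        have "\<one> \<otimes> x \<otimes> inv \<one> \<in> ?O x" unfolding orb[OF xc] by blast
        then show "x \<in> \<Union>?C" using x xc by auto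
      qed
    qed
    have finM: "finite M" using finite_sub[OF fin M.is_subgroup] .
    have "p dvd card (\<Union>?C)"
    proof (rule dvd_partition)
      show "finite (\<Union>?C)" using un finM by simp
      show "\<forall>c\<in>?C. p dvd card c" using dvd by blast
      show "\<forall>c1\<in>?C. \<forall>c2\<in>?C. c1 \<noteq> c2 \<longrightarrow> c1 \<inter> c2 = {}"
      proof (intro ballI impI)
        fix c1 c2 assume c: "c1 \<in> ?C" "c2 \<in> ?C" "c1 \<noteq> c2"
        have "c1 \<in> orbits G (carrier G) ?act" "c2 \<in> orbits G (carrier G) ?act"
          using c M.subset by (auto simp: orbits_def)
        then show "c1 \<inter> c2 = {}" using act.disjoint_union[of c1 c2] c(3) by simp
      qed
    qed
    then have "p dvd card M - 1" using un finM M.one_closed by (simp add: card_Diff_singleton)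
    moreover have pM: "p dvd card M"
    proof -
      obtain n where n: "card M = p ^ n" using card_power[OF M.is_subgroup] .
      have "n \<noteq> 0"
      proof
        assume "n = 0"
        then have "card M = 1" using n by simp
        then obtain c where "M = {c}" by (rule card_1_singletonE)
        then show False using M.one_closed M(2) by simp
      qed
      then show ?thesis using n by simp
    qed
    moreover have "0 < card M" using card_sub_pos[OF fin M.is_subgroup] .
    ultimately have e: "card M - (card M - 1) = 1" and "p dvd card M - 1" by simp_all
    have "p dvd card M - (card M - 1)" by (rule dvd_diff_nat[OF pM]) fact
    then have "p dvd 1" by (simp only: e)
    then show False using p_gt_1 by simp
  qed
  then obtain z where z: "z \<in> M" "z \<noteq> \<one>" and zc: "\<And>g. g \<in> carrier G \<Longrightarrow> g \<otimes> z = z \<otimes> g" by blast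
  have zG: "z \<in> carrier G" using z by simp
  obtain n where n: "card (carrier G) = p ^ n" using order_pow by blast
  have "z [^] (p ^ n) = \<one>" using pow_order_eq_1[OF zG] n by (simp add: order_def)
  then obtain j where j: "z [^] (p ^ j) = \<one>" "\<And>i. i < j \<Longrightarrow> z [^] (p ^ i) \<noteq> \<one>"
    using ex_least_nat_le[of "\<lambda>j. z [^] (p ^ j) = \<one>"] by (metis (no_types, lifting) exists_least_iff)
  have "j \<noteq> 0" using j(1) z zG by (metis nat_pow_eone power_0)
  then obtain i where i: "j = Suc i" by (metis not0_implies_Suc)
  let ?y = "z [^] (p ^ i)"
  have "z [^] m \<in> M" for m :: nat by (induction m) (use z(1) in \<open>auto simp: M.one_closed M.m_closed\<close>)
  then have "?y \<in> M" .
  moreover have "?y \<noteq> \<one>" using j i by simp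
  moreover have "?y [^] p = \<one>" using j(1) i zG by (simp add: nat_pow_pow mult.commute)
  moreover have "g \<otimes> ?y = ?y \<otimes> g" if "g \<in> carrier G" for g
  proof -
    have "g \<otimes> z [^] m = z [^] m \<otimes> g" for m :: nat
    proof (induction m)
      case (Suc m)
      have "g \<otimes> z [^] Suc m = (g \<otimes> z [^] m) \<otimes> z" using that zG by (simp add: m_assoc)
      also have "\<dots> = z [^] m \<otimes> (g \<otimes> z)" using Suc that zG by (simp add: m_assoc)
      also have "\<dots> = z [^] m \<otimes> (z \<otimes> g)" by (simp only: zc[OF that])
      finally show ?case using that zG by (simp add: m_assoc)
    qed (use that in simp)
    then show ?thesis .
  qed
  ultimately show ?thesis by blast
qed

end

text \<open>A quotient group, realised on representatives of the cosets: groups and their quotients then live on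
  the same type, as an induction on the group order needs.\<close>
lemma (in group) exists_quotient:
  assumes "A \<lhd> G"
  shows "\<exists>(Q :: 'a monoid) \<pi>. group Q \<and> \<pi> \<in> hom G Q \<and> \<pi> ` carrier G = carrier Q \<and>
    (\<forall>x\<in>carrier G. \<pi> x = \<one>\<^bsub>Q\<^esub> \<longleftrightarrow> x \<in> A)"
proof -
  interpret A: normal A G by fact
  let ?r = "\<lambda>U. SOME g. g \<in> (U :: 'a set)"
  let ?Q = "flatten (G Mod A) ?r"
  let ?\<pi> = "\<lambda>x. ?r (A #> x)"
  have Q: "group ?Q" by (rule A.flatten_set_group_mod)
  have iso: "?r \<in> hom (G Mod A) ?Q" "bij_betw ?r (carrier (G Mod A)) (carrier ?Q)"
    using A.flatten_set_group_mod_iso by (auto simp: iso_def)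
  have h: "(\<lambda>x. A #> x) \<in> hom G (G Mod A)" by (rule A.r_coset_hom_Mod)
  have hom: "?\<pi> \<in> hom G ?Q" using Group.hom_compose[OF h iso(1)] by (simp add: comp_def)
  have surj: "?\<pi> ` carrier G = carrier ?Q"
    using iso(2) by (auto simp: bij_betw_def carrier_FactGroup image_comp comp_def)
  have ker: "?\<pi> x = \<one>\<^bsub>?Q\<^esub> \<longleftrightarrow> x \<in> A" if x: "x \<in> carrier G" for x
  proof -
    have "\<one>\<^bsub>?Q\<^esub> = ?r A" by (simp add: flatten_def)
    moreover have "A #> x \<in> carrier (G Mod A)" "A \<in> carrier (G Mod A)"
      using x A.subgroup_in_rcosets[OF is_group] by (auto simp: FactGroup_def RCOSETS_def)
    ultimately have "?\<pi> x = \<one>\<^bsub>?Q\<^esub> \<longleftrightarrow> A #> x = A" using iso(2) by (auto simp: bij_betw_def inj_on_def)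
    also have "\<dots> \<longleftrightarrow> x \<in> A" using x A.is_subgroup coset_join2 rcos_self by blast
    finally show ?thesis .
  qed
  show ?thesis using Q hom surj ker by blast
qed

locale p_quot = P: p_grp G p + Q: group Q
  for G :: "('a, 'b) monoid_scheme" (structure) and p and Q :: "('c, 'd) monoid_scheme" and \<pi> A +
  assumes pi_hom: "\<pi> \<in> hom G Q" and pi_surj: "\<pi> ` carrier G = carrier Q"
    and pi_ker: "x \<in> carrier G \<Longrightarrow> \<pi> x = \<one>\<^bsub>Q\<^esub> \<longleftrightarrow> x \<in> A" and A_normal: "A \<lhd> G"
begin

sublocale A: normal A G by (rule A_normal)
sublocale \<pi>: group_hom G Q \<pi> using P.is_group Q.is_group pi_hom by (simp add: group_hom_def group_hom_axioms_def)

lemma pi_eq_iff: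
  assumes "x \<in> carrier G" "y \<in> carrier G" shows "\<pi> x = \<pi> y \<longleftrightarrow> inv x \<otimes> y \<in> A"
proof -
  have "\<pi> x = \<pi> y \<longleftrightarrow> inv\<^bsub>Q\<^esub> (\<pi> x) \<otimes>\<^bsub>Q\<^esub> \<pi> y = \<one>\<^bsub>Q\<^esub>"
    using assms by (metis Q.inv_equality Q.inv_inv Q.l_inv \<pi>.hom_closed Q.inv_closed)
  also have "\<dots> \<longleftrightarrow> inv x \<otimes> y \<in> A" using assms pi_ker[of "inv x \<otimes> y"] by simp
  finally show ?thesis .
qed

lemma mem_image_iff:
  assumes E: "subgroup E G" "A \<subseteq> E" and x: "x \<in> carrier G"
  shows "\<pi> x \<in> \<pi> ` E \<longleftrightarrow> x \<in> E"
proof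
  assume "\<pi> x \<in> \<pi> ` E"
  then obtain e where e: "e \<in> E" "\<pi> e = \<pi> x" by auto
  have ec: "e \<in> carrier G" by (rule subgroup.mem_carrier[OF E(1) e(1)])
  then have "inv e \<otimes> x \<in> E" using pi_eq_iff[OF ec x] e E by auto
  then have "e \<otimes> (inv e \<otimes> x) \<in> E" by (rule subgroup.m_closed[OF E(1) e(1)])
  then show "x \<in> E" using ec x by (simp add: P.cancel_inv_left)
qed blast

lemma image_subset_imp_subset:
  assumes "subgroup U G" "subgroup V G" "A \<subseteq> V" "\<pi> ` U \<subseteq> \<pi> ` V"
  shows "U \<subseteq> V"
proof
  fix x assume x: "x \<in> U"
  have "\<pi> x \<in> \<pi> ` V" using assms(4) x by blast
  then show "x \<in> V" using mem_image_iff[OF assms(2,3) subgroup.mem_carrier[OF assms(1) x]] by simp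
qed

lemma card_image:
  assumes E: "subgroup E G" "A \<subseteq> E" shows "card (\<pi> ` E) * card A = card E"
proof -
  have cE: "E \<subseteq> carrier G" using E subgroup.subset by blast
  have finE: "finite E" by (rule P.finite_sub[OF P.fin E(1)])
  have fib: "card {x \<in> E. \<pi> x = y} = card A" if "y \<in> \<pi> ` E" for y
  proof -
    obtain e where e: "e \<in> E" "\<pi> e = y" using \<open>y \<in> \<pi> ` E\<close> by auto
    have ec: "e \<in> carrier G" using e cE by blast
    have "{x \<in> E. \<pi> x = y} = (\<lambda>a. e \<otimes> a) ` A"
    proof
      show "{x \<in> E. \<pi> x = y} \<subseteq> (\<lambda>a. e \<otimes> a) ` A"
      proof
        fix x assume x: "x \<in> {x \<in> E. \<pi> x = y}"
        then have xc: "x \<in> carrier G" using cE by blast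
        have "inv e \<otimes> x \<in> A" using x e pi_eq_iff[OF ec xc] by auto
        moreover have "x = e \<otimes> (inv e \<otimes> x)" using ec xc by (simp add: P.cancel_inv_left)
        ultimately show "x \<in> (\<lambda>a. e \<otimes> a) ` A" by blast
      qed
      show "(\<lambda>a. e \<otimes> a) ` A \<subseteq> {x \<in> E. \<pi> x = y}"
      proof (rule image_subsetI)
        fix a assume a: "a \<in> A"
        then have "e \<otimes> a \<in> E" using e E by (auto simp: subgroup.m_closed)
        moreover have "\<pi> (e \<otimes> a) = y" using a e ec pi_ker[of a] \<pi>.hom_closed[OF ec] by simp
        ultimately show "e \<otimes> a \<in> {x \<in> E. \<pi> x = y}" by simp
      qed
    qed
    moreover have "inj_on (\<lambda>a. e \<otimes> a) A" by (rule inj_onI) (use ec in auto)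
    ultimately show ?thesis by (simp add: card_image)
  qed
  have "card E = (\<Sum>y\<in>\<pi> ` E. card {x \<in> E. \<pi> x = y})"
    using sum.image_gen[of E "\<lambda>_. 1::nat" \<pi>] finE by (simp only: card_eq_sum)
  also have "\<dots> = (\<Sum>y\<in>\<pi> ` E. card A)" using fib by (rule sum.cong[OF refl])
  finally show ?thesis by simp
qed

lemma card_Q: "card (carrier Q) * card A = card (carrier G)"
  using card_image[OF P.subgroup_self A.subset] pi_surj by simp

lemma card_A_pos: "0 < card A" by (rule P.card_sub_pos[OF P.fin A.is_subgroup])

sublocale Q: p_grp Q p
proof (unfold_locales)
  show "Factorial_Ring.prime p" by (rule P.prime_p)
  have "card (carrier Q) dvd card (carrier G)" using card_Q by (metis dvd_triv_left)
  moreover obtain n where "card (carrier G) = p ^ n" using P.order_pow by blast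
  ultimately show "\<exists>n. card (carrier Q) = p ^ n"
    using divides_primepow_nat[OF P.prime_p, of "card (carrier Q)" n] by auto
qed

lemma subgroup_image: "subgroup E G \<Longrightarrow> subgroup (\<pi> ` E) Q" by (rule \<pi>.subgroup_img_is_subgroup)

lemma image_cmt: "x \<in> carrier G \<Longrightarrow> y \<in> carrier G \<Longrightarrow> cmt Q (\<pi> x) (\<pi> y) = \<pi> (cmt G x y)" by simp

lemma centralizer_image:
  assumes x: "x \<in> carrier G" shows "centralizer Q (\<pi> x) = \<pi> ` centralizer_mod G A x"
proof
  have m: "\<pi> g \<in> centralizer Q (\<pi> x) \<longleftrightarrow> g \<in> centralizer_mod G A x" if g: "g \<in> carrier G" for g
  proof -
    have "\<pi> g \<in> centralizer Q (\<pi> x) \<longleftrightarrow> cmt Q (\<pi> x) (\<pi> g) = \<one>\<^bsub>Q\<^esub>"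
      using Q.centralizer_iff_cmt[OF \<pi>.hom_closed[OF x]] \<pi>.hom_closed[OF g] by blast
    also have "\<dots> \<longleftrightarrow> \<pi> (cmt G x g) = \<one>\<^bsub>Q\<^esub>" by (simp only: image_cmt[OF x g])
    also have "\<dots> \<longleftrightarrow> cmt G x g \<in> A" by (rule pi_ker) (use x g in simp)
    finally show ?thesis using g unfolding centralizer_mod_def by blast
  qed
  show "\<pi> ` centralizer_mod G A x \<subseteq> centralizer Q (\<pi> x)"
    using m by (auto simp: centralizer_mod_def)
  show "centralizer Q (\<pi> x) \<subseteq> \<pi> ` centralizer_mod G A x"
  proof
    fix y assume y: "y \<in> centralizer Q (\<pi> x)"
    then have "y \<in> carrier Q" by (simp add: centralizer_def)
    then obtain g where "g \<in> carrier G" "y = \<pi> g" using pi_surj by blast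
    then show "y \<in> \<pi> ` centralizer_mod G A x" using m y by blast
  qed
qed

lemma A_subset_centralizer_mod: "x \<in> carrier G \<Longrightarrow> A \<subseteq> centralizer_mod G A x"
proof
  fix a assume x: "x \<in> carrier G" and a: "a \<in> A"
  have "(x \<otimes> a \<otimes> inv x) \<otimes> inv a \<in> A" using A.inv_op_closed2[OF x a] a by (simp add: A.m_closed A.m_inv_closed)
  then show "a \<in> centralizer_mod G A x" using a by (simp add: centralizer_mod_def)
qed

lemma breadth_le_image:
  assumes x: "x \<in> carrier G"
  shows "breadth_le p k Q (\<pi> x) \<longleftrightarrow> card (carrier G) \<le> p ^ k * card (centralizer_mod G A x)"
proof -
  have "card (centralizer Q (\<pi> x)) * card A = card (centralizer_mod G A x)"
    unfolding centralizer_image[OF x]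
    by (rule card_image[OF P.subgroup_centralizer_mod[OF A_normal x] A_subset_centralizer_mod[OF x]])
  then show ?thesis unfolding breadth_le_def card_Q[symmetric] using card_A_pos
    by (metis mult.assoc mult_le_cancel2)
qed

lemma breadth_le_imp_image:
  assumes x: "x \<in> carrier G" and b: "breadth_le p k G x"
  shows "breadth_le p k Q (\<pi> x)"
proof -
  have sub: "centralizer G x \<subseteq> centralizer_mod G A x"
    using P.centralizer_iff_cmt[OF x] A.one_closed unfolding centralizer_mod_def by auto
  have "finite (centralizer_mod G A x)" using P.fin by (simp add: centralizer_mod_def)
  from card_mono[OF this sub] have "p ^ k * card (centralizer G x) \<le> p ^ k * card (centralizer_mod G A x)"
    by (rule mult_le_mono2)
  then show ?thesis unfolding breadth_le_image[OF x] using b unfolding breadth_le_def by (rule order_trans[rotated])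
qed

lemma over_frattini_image:
  assumes "over_frattini p G E" shows "over_frattini p Q (\<pi> ` E)"
  unfolding over_frattini_def
proof (intro conjI ballI)
  have sE: "subgroup E G" using assms unfolding over_frattini_def by (rule conjunct1)
  show "subgroup (\<pi> ` E) Q" by (rule subgroup_image[OF sE])
  fix u assume "u \<in> carrier Q"
  then obtain x where x: "x \<in> carrier G" "u = \<pi> x" using pi_surj by blast
  have "x [^] p \<in> E" using assms x(1) unfolding over_frattini_def by simp
  then show "u [^]\<^bsub>Q\<^esub> p \<in> \<pi> ` E" using x \<pi>.hom_nat_pow[OF x(1), of p] by (metis imageI)
  fix v assume "v \<in> carrier Q"
  then obtain y where y: "y \<in> carrier G" "v = \<pi> y" using pi_surj by blast
  have "cmt G x y \<in> E" using assms x(1) y(1) unfolding over_frattini_def by simp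
  then show "cmt Q u v \<in> \<pi> ` E" using image_cmt[OF x(1) y(1)] x y by (metis imageI)
qed

lemma hyperplane_image:
  assumes "hyperplane p G H" "A \<subseteq> H" shows "hyperplane p Q (\<pi> ` H)"
proof -
  have "subgroup H G" using assms P.hyperplane_subgroup by blast
  then have "card (\<pi> ` H) * card A = card H" using card_image assms(2) by blast
  then have "p * card (\<pi> ` H) * card A = card (carrier Q) * card A"
    using assms(1) card_Q by (simp add: hyperplane_def mult.assoc)
  then show ?thesis using over_frattini_image assms(1) card_A_pos by (auto simp: hyperplane_def)
qed

lemma card_derived_le: "card (derived G (carrier G)) \<le> card A * card (derived Q (carrier Q))"
proof -
  let ?D = "derived G (carrier G)"
  have sD: "subgroup ?D G" by (rule P.derived_is_subgroup) simp
  have "card ?D \<le> (\<Sum>y\<in>\<pi> ` ?D. card A)"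
  proof -
    have finD: "finite ?D" by (rule P.finite_sub[OF P.fin sD])
    have fib: "card {x \<in> ?D. \<pi> x = y} \<le> card A" if y: "y \<in> \<pi> ` ?D" for y
    proof -
      obtain e where e: "e \<in> ?D" "\<pi> e = y" using y by auto
      have ec: "e \<in> carrier G" by (rule subgroup.mem_carrier[OF sD e(1)])
      have im: "(\<lambda>x. inv e \<otimes> x) ` {x \<in> ?D. \<pi> x = y} \<subseteq> A"
      proof (rule image_subsetI)
        fix x assume x: "x \<in> {x \<in> ?D. \<pi> x = y}"
        then have xc: "x \<in> carrier G" using subgroup.mem_carrier[OF sD] by simp
        show "inv e \<otimes> x \<in> A" using x e(2) pi_eq_iff[OF ec xc] by simp
      qed
      have "inj_on (\<lambda>x. inv e \<otimes> x) {x \<in> ?D. \<pi> x = y}"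
        by (rule inj_onI) (use ec subgroup.mem_carrier[OF sD] in auto)
      from card_inj_on_le[OF this im] show ?thesis using P.finite_sub[OF P.fin A.is_subgroup] by blast
    qed
    have "card ?D = (\<Sum>y\<in>\<pi> ` ?D. card {x \<in> ?D. \<pi> x = y})"
      using sum.image_gen[of ?D "\<lambda>_. 1::nat" \<pi>] finD by (simp only: card_eq_sum)
    also have "\<dots> \<le> (\<Sum>y\<in>\<pi> ` ?D. card A)" using fib by (rule sum_mono)
    finally show ?thesis .
  qed
  also have "\<pi> ` ?D = derived Q (carrier Q)" using \<pi>.derived_img[of "carrier G"] pi_surj by simp
  finally show ?thesis by (simp add: mult.commute)
qed

end

lemma (in p_grp) obtain_quotient:
  assumes "A \<lhd> G"
  obtains Q :: "'a monoid" and \<pi> where "p_quot G p Q \<pi> A"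
  using exists_quotient[OF assms] assms p_grp_axioms that
  unfolding p_quot_def p_quot_axioms_def by blast

section \<open>Hyperplanes\<close>

lemma over_frattini_subgroup: "over_frattini p G E \<Longrightarrow> subgroup E G"
  and over_frattini_cmt: "over_frattini p G E \<Longrightarrow> x \<in> carrier G \<Longrightarrow> y \<in> carrier G \<Longrightarrow> cmt G x y \<in> E"
  and over_frattini_pow: "over_frattini p G E \<Longrightarrow> x \<in> carrier G \<Longrightarrow> x [^]\<^bsub>G\<^esub> p \<in> E"
  by (simp_all add: over_frattini_def)

lemma hyperplane_over_frattini: "hyperplane p G H \<Longrightarrow> over_frattini p G H"
  and hyperplane_card: "hyperplane p G H \<Longrightarrow> p * card H = card (carrier G)"
  by (simp_all add: hyperplane_def)

lemma (in group) derived_subset_if_cmt: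
  assumes "subgroup E G" "\<And>x y. x \<in> carrier G \<Longrightarrow> y \<in> carrier G \<Longrightarrow> cmt G x y \<in> E"
  shows "derived G (carrier G) \<subseteq> E"
  unfolding derived_def by (rule generate_subgroup_incl) (use assms in auto)

lemma (in group) cmt_mem_derived:
  "x \<in> H \<Longrightarrow> y \<in> H \<Longrightarrow> cmt G x y \<in> derived G H"
  unfolding derived_def by (rule generate.incl) auto

lemma (in group) derived_subset_over_frattini: "over_frattini p G E \<Longrightarrow> derived G (carrier G) \<subseteq> E"
  using derived_subset_if_cmt over_frattini_subgroup over_frattini_cmt by metis

context p_grp begin

lemma hyperplane_psubset: "hyperplane p G H \<Longrightarrow> card H < card (carrier G)"
  using p_gt_1 card_sub_pos[OF fin hyperplane_subgroup] hyperplane_card[of p G H] by (metis mult_less_cancel2 nat_mult_1)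

lemma subgroup_eq_carrier:
  assumes R: "hyperplane p G R" and S: "subgroup S G" "R \<subseteq> S" "a \<in> S" "a \<notin> R"
  shows "S = carrier G"
proof -
  have "R \<subset> S" using S by blast
  then have "p * card R \<le> card S" using p_mult_card_le_psubset[OF hyperplane_subgroup[OF R] S(1)] by simp
  then have "card (carrier G) \<le> card S" using hyperplane_card[OF R] by simp
  then show ?thesis using card_seteq[OF fin subgroup.subset[OF S(1)]] by simp
qed

text \<open>If \<open>G\<close> is generated by \<open>R\<close> and \<open>a\<close>, then the commutators \<open>[a, y]\<close> with \<open>y \<in> R\<close> and the derived
  subgroup of \<open>R\<close> make up the derived subgroup of \<open>G\<close>: modulo that of \<open>R\<close>, the map \<open>y \<mapsto> [a, y]\<close> on \<open>R\<close>
  is a homomorphism.\<close>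
lemma card_derived_le_hyperplane:
  assumes R: "hyperplane p G R" and a: "a \<in> carrier G" "a \<notin> R" and b: "breadth_le p b G a"
  shows "card (derived G (carrier G)) \<le> p ^ b * card (derived G R)"
proof -
  let ?D = "derived G R"
  define W where "W = (\<lambda>(w, y). w \<otimes> cmt G a y) ` (?D \<times> R)"
  have sR: "subgroup R G" by (rule hyperplane_subgroup[OF R])
  have nR: "R \<lhd> G" by (rule hyperplane_normal[OF R])
  have RG: "R \<subseteq> carrier G" by (rule subgroup.subset[OF sR])
  have nD: "?D \<lhd> G" by (rule derived_is_normal[OF nR])
  interpret D: normal ?D G by (rule nD)
  interpret R: normal R G by (rule nR)
  have cR: "cmt G x y \<in> R" if "x \<in> carrier G" "y \<in> carrier G" for x y
    using over_frattini_cmt[OF hyperplane_over_frattini[OF R]] that .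
  have WI: "w \<otimes> cmt G a y \<in> W" if "w \<in> ?D" "y \<in> R" for w y
    unfolding W_def by (rule image_eqI[of _ _ "(w, y)"]) (use that in auto)
  have WE: "\<exists>w y. w \<in> ?D \<and> y \<in> R \<and> u = w \<otimes> cmt G a y" if "u \<in> W" for u
    using that unfolding W_def by auto
  have W1: "w \<in> W" if "w \<in> ?D" for w using WI[OF that R.one_closed] that a by simp
  have W2: "cmt G a y \<in> W" if "y \<in> R" for y
  proof -
    have "\<one> \<otimes> cmt G a y \<in> W" by (rule WI[OF D.one_closed that])
    then show ?thesis using a that by simp
  qed
  have sW: "subgroup W G"
  proof (rule finite_closed_subgroup[OF fin])
    show "W \<subseteq> carrier G" unfolding W_def using a by auto
    show "W \<noteq> {}" using W1[OF D.one_closed] by blast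
    fix u v assume u: "u \<in> W" and v: "v \<in> W"
    obtain w1 y1 where uv1: "w1 \<in> ?D" "y1 \<in> R" "u = w1 \<otimes> cmt G a y1" using WE[OF u] by blast
    obtain w2 y2 where uv2: "w2 \<in> ?D" "y2 \<in> R" "v = w2 \<otimes> cmt G a y2" using WE[OF v] by blast
    note uv = uv1 uv2
    have c: "w1 \<in> carrier G" "w2 \<in> carrier G" "y1 \<in> carrier G" "y2 \<in> carrier G" using uv by auto
    \<comment> \<open>The commutator \<open>?d\<close> measures by how much \<open>y \<mapsto> [a, y]\<close> fails to be multiplicative.\<close>
    let ?c = "cmt G a y1" and ?d = "cmt G y1 (cmt G a y2)"
    have cc: "?c \<in> carrier G" using a c by simp
    have d: "?d \<in> ?D" by (rule cmt_mem_derived[OF uv(2) cR[OF a(1) c(4)]])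
    then have dc: "?d \<in> carrier G" by simp
    have "u \<otimes> v = (w1 \<otimes> (?c \<otimes> w2 \<otimes> inv ?c) \<otimes> (?c \<otimes> inv ?d \<otimes> inv ?c)) \<otimes> cmt G a (y1 \<otimes> y2)"
      using uv(3,6) c a by (simp add: group_word)
    moreover have "w1 \<otimes> (?c \<otimes> w2 \<otimes> inv ?c) \<otimes> (?c \<otimes> inv ?d \<otimes> inv ?c) \<in> ?D"
      by (rule D.m_closed[OF D.m_closed[OF uv(1) D.inv_op_closed2[OF cc uv(4)]]
            D.inv_op_closed2[OF cc D.m_inv_closed[OF d]]])
    ultimately show "u \<otimes> v \<in> W" using WI[OF _ R.m_closed[OF uv(2,5)]] by simp
  qed
  interpret W: subgroup W G by (rule sW)
  define S where "S = {g \<in> carrier G. \<forall>w\<in>W. g \<otimes> w \<otimes> inv g \<in> W}"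
  have "subgroup S G"
  proof (rule finite_closed_subgroup[OF fin])
    have "\<one> \<in> S"
    unfolding S_def
    proof (intro CollectI conjI ballI one_closed)
      fix w assume w: "w \<in> W"
      have "\<one> \<otimes> w \<otimes> inv \<one> = w" using W.mem_carrier[OF w] by simp
      then show "\<one> \<otimes> w \<otimes> inv \<one> \<in> W" using w by (simp only:)
    qed
    then show "S \<noteq> {}" by blast
    fix g h assume g: "g \<in> S" and h: "h \<in> S"
    have gc: "g \<in> carrier G" "h \<in> carrier G" using g h by (auto simp: S_def)
    have "(g \<otimes> h) \<otimes> w \<otimes> inv (g \<otimes> h) \<in> W" if w: "w \<in> W" for w
    proof -
      have "g \<otimes> (h \<otimes> w \<otimes> inv h) \<otimes> inv g \<in> W" using g h w by (simp add: S_def)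
      moreover have "w \<in> carrier G" by (rule W.mem_carrier[OF w])
      ultimately show ?thesis using gc by (simp add: group_word)
    qed
    then show "g \<otimes> h \<in> S" using gc by (simp add: S_def)
  qed (auto simp: S_def)
  moreover have "R \<subseteq> S"
  proof
    fix r assume r: "r \<in> R"
    have rc: "r \<in> carrier G" using r by simp
    have "r \<otimes> w \<otimes> inv r \<in> W" if w: "w \<in> W" for w
    proof -
      obtain v y where v: "v \<in> ?D" "y \<in> R" "w = v \<otimes> cmt G a y" using WE[OF w] by blast
      have c: "v \<in> carrier G" "y \<in> carrier G" using v by auto
      have "r \<otimes> w \<otimes> inv r = ((r \<otimes> v \<otimes> inv r) \<otimes> cmt G r (cmt G a y)) \<otimes> cmt G a y"
        using v(3) c a rc by (simp add: group_word)
      moreover have "(r \<otimes> v \<otimes> inv r) \<otimes> cmt G r (cmt G a y) \<in> ?D"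
        by (rule D.m_closed[OF D.inv_op_closed2[OF rc v(1)] cmt_mem_derived[OF r cR[OF a(1) c(2)]]])
      ultimately show ?thesis using WI[OF _ v(2)] by simp
    qed
    then show "r \<in> S" using rc by (simp add: S_def)
  qed
  moreover have "a \<in> S"
  proof -
    have "a \<otimes> w \<otimes> inv a \<in> W" if w: "w \<in> W" for w
    proof -
      obtain v y where v: "v \<in> ?D" "y \<in> R" "w = v \<otimes> cmt G a y" using WE[OF w] by blast
      have c: "v \<in> carrier G" "y \<in> carrier G" using v by auto
      have "a \<otimes> w \<otimes> inv a = (a \<otimes> v \<otimes> inv a) \<otimes> cmt G a (a \<otimes> y \<otimes> inv a)"
        using v(3) c a by (simp add: group_word)
      then show ?thesis using WI[OF D.inv_op_closed2[OF a(1) v(1)] R.inv_op_closed2[OF a(1) v(2)]] by simp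
    qed
    then show ?thesis using a by (simp add: S_def)
  qed
  ultimately have "S = carrier G" using subgroup_eq_carrier[OF R _ _ _ a(2)] by blast
  then have "\<forall>g\<in>carrier G. \<forall>w\<in>W. g \<otimes> w \<otimes> inv g \<in> W" unfolding S_def by blast
  then have nW: "W \<lhd> G" using sW normal_inv_iff by blast
  \<comment> \<open>It remains to see that all commutators lie in \<open>W\<close>; it suffices to test this on \<open>R\<close> and \<open>a\<close>, as they
    generate \<open>G\<close>.\<close>
  have full: "centralizer_mod G W x = carrier G" if x: "x \<in> carrier G" and h: "\<And>r. r \<in> R \<Longrightarrow> cmt G x r \<in> W" "cmt G x a \<in> W" for x
    using subgroup_eq_carrier[OF R subgroup_centralizer_mod[OF nW x] _ _ a(2)] h a(1) RG
    by (auto simp: centralizer_mod_def)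
  have sym: "cmt G y x \<in> W" if "cmt G x y \<in> W" "x \<in> carrier G" "y \<in> carrier G" for x y
    using W.m_inv_closed[OF that(1)] inv_cmt[OF that(2,3)] by simp
  have fa: "centralizer_mod G W a = carrier G"
  proof (rule full[OF a(1)])
    fix r assume "r \<in> R" then show "cmt G a r \<in> W" by (rule W2)
  next
    have "cmt G a a = \<one>" using cmt_eq_one_iff[OF a(1) a(1)] by blast
    then show "cmt G a a \<in> W" using W.one_closed by simp
  qed
  have ga: "cmt G g a \<in> W" if "g \<in> carrier G" for g
    using fa that a(1) sym[of a g] unfolding centralizer_mod_def by blast
  have "cmt G g h \<in> W" if g: "g \<in> carrier G" and h: "h \<in> carrier G" for g h
  proof -
    have fr: "centralizer_mod G W r = carrier G" if r: "r \<in> R" for r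
    proof (rule full)
      show "r \<in> carrier G" using r by simp
      fix s assume "s \<in> R" then show "cmt G r s \<in> W" using W1[OF cmt_mem_derived[OF r]] by blast
    next
      show "cmt G r a \<in> W" using ga r by simp
    qed
    have "centralizer_mod G W g = carrier G"
    proof (rule full[OF g])
      fix r assume r: "r \<in> R"
      have "cmt G r g \<in> W" using fr[OF r] g unfolding centralizer_mod_def by blast
      then show "cmt G g r \<in> W" by (rule sym) (use g r in auto)
    qed (rule ga[OF g])
    then show ?thesis using h unfolding centralizer_mod_def by blast
  qed
  then have "derived G (carrier G) \<subseteq> W" by (rule derived_subset_if_cmt[OF sW])
  moreover have "W \<subseteq> (\<lambda>(w, t). w \<otimes> t) ` (?D \<times> (\<lambda>g. cmt G a g) ` carrier G)" (is "_ \<subseteq> ?m ` ?X")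
  proof
    fix u assume "u \<in> W"
    then obtain w y where u: "w \<in> ?D" "y \<in> R" "u = w \<otimes> cmt G a y" using WE by blast
    then show "u \<in> ?m ` ?X" by (intro image_eqI[of _ _ "(w, cmt G a y)"]) auto
  qed
  moreover have "finite ?X" using fin finite_sub[OF fin D.is_subgroup] by simp
  ultimately have "card (derived G (carrier G)) \<le> card ?X" by (meson order_trans surj_card_le)
  also have "\<dots> = card ?D * card ((\<lambda>g. cmt G a g) ` carrier G)" by (rule card_cartesian_product)
  also have "\<dots> \<le> card ?D * p ^ b"
  proof -
    have "card ((\<lambda>g. cmt G a g) ` carrier G) * card (centralizer G a) \<le> p ^ b * card (centralizer G a)"
      using card_cmt_image[OF fin a(1)] b unfolding breadth_le_def by (rule order_trans)
    moreover have "0 < card (centralizer G a)" by (rule card_sub_pos[OF fin subgroup_centralizer[OF a(1)]])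
    ultimately show ?thesis by simp
  qed
  finally show ?thesis by (simp add: mult.commute)
qed


lemma card_inter_hyperplane:
  assumes R: "hyperplane p G R" and E: "subgroup E G" "\<not> E \<subseteq> R"
  shows "p * card (E \<inter> R) = card E"
proof (rule antisym)
  have sR: "subgroup R G" by (rule hyperplane_subgroup[OF R])
  have "subgroup (E \<inter> R) G" by (rule subgroups_Inter_pair[OF E(1) sR])
  then show "p * card (E \<inter> R) \<le> card E" by (rule p_mult_card_le_psubset[OF _ E(1)]) (use E(2) in blast)
  have "card E * card R \<le> p * card R * card (E \<inter> R)"
    using card_mult_le_card_inter[OF fin E(1) sR] hyperplane_card[OF R] by simp
  then have "card E * card R \<le> (p * card (E \<inter> R)) * card R" by (simp add: ac_simps)
  then show "card E \<le> p * card (E \<inter> R)" using card_sub_pos[OF fin sR] by simp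
qed

text \<open>A subgroup not contained in \<open>H\<close> has the fraction \<open>(p - 1) / p\<close> of its elements outside \<open>H\<close>, as has
  \<open>G\<close> itself. Subgroups that cover the complement of \<open>H\<close> therefore have total order at least that of
  \<open>G\<close>. This saves one subgroup in comparison with counting all elements, which matters for \<open>p = 3\<close>.\<close>
lemma exists_off_hyperplane:
  assumes H: "hyperplane p G H" and Cs: "\<And>C. C \<in> set Cs \<Longrightarrow> subgroup C G"
    and lt: "sum_list (map card Cs) < card (carrier G)"
  shows "\<exists>a\<in>carrier G. a \<notin> H \<and> (\<forall>C\<in>set Cs. a \<notin> C)"
proof (rule ccontr)
  assume no: "\<not> ?thesis"
  have sH: "subgroup H G" by (rule hyperplane_subgroup[OF H])
  have finH: "finite H" by (rule finite_sub[OF fin sH])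
  have one: "p * card (C - H) \<le> (p - 1) * card C" if C: "subgroup C G" for C
  proof (cases "C \<subseteq> H")
    case True
    then have "C - H = {}" by blast
    then show ?thesis by (simp only: card.empty mult_0_right)
  next
    case False
    have "card (C - H) = card C - card (C \<inter> H)"
      using card_Diff_subset_Int[of C H] finH by simp
    then show ?thesis using card_inter_hyperplane[OF H C False] by (simp add: diff_mult_distrib diff_mult_distrib2)
  qed
  have all: "p * card (\<Union>C\<in>set Cs. C - H) \<le> (p - 1) * sum_list (map card Cs)"
    using Cs
  proof (induction Cs)
    case (Cons C Cs)
    have "card (\<Union>C\<in>set (C # Cs). C - H) \<le> card (C - H) + card (\<Union>C\<in>set Cs. C - H)"
      using card_Un_le[of "C - H" "\<Union>C\<in>set Cs. C - H"] by simp
    then have "p * card (\<Union>C\<in>set (C # Cs). C - H) \<le> p * card (C - H) + p * card (\<Union>C\<in>set Cs. C - H)"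
      by (metis add_mult_distrib2 mult_le_mono2)
    also have "\<dots> \<le> (p - 1) * card C + (p - 1) * sum_list (map card Cs)"
      by (rule add_mono) (use one Cons in auto)
    finally show ?case by (simp add: add_mult_distrib2)
  qed simp
  have "carrier G - H \<subseteq> (\<Union>C\<in>set Cs. C - H)" using no by blast
  moreover have "finite (\<Union>C\<in>set Cs. C - H)" using Cs finite_sub[OF fin] by auto
  ultimately have "card (carrier G - H) \<le> card (\<Union>C\<in>set Cs. C - H)" by (simp add: card_mono)
  then have "p * card (carrier G - H) \<le> (p - 1) * sum_list (map card Cs)"
    using all by (meson mult_le_mono2 order_trans)
  moreover have "card (carrier G - H) = card (carrier G) - card H"
    using card_Diff_subset[OF finH subgroup.subset[OF sH]] .
  then have "p * card (carrier G - H) = (p - 1) * card (carrier G)"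
    using hyperplane_card[OF H] by (simp add: diff_mult_distrib diff_mult_distrib2)
  ultimately have "(p - 1) * card (carrier G) \<le> (p - 1) * sum_list (map card Cs)" by simp
  then show False using lt p_gt_1 by simp
qed

lemma over_frattini_inter: "over_frattini p G E \<Longrightarrow> over_frattini p G F \<Longrightarrow> over_frattini p G (E \<inter> F)"
  unfolding over_frattini_def using subgroups_Inter_pair[of E F] by simp

lemma hyperplane_not_subset:
  assumes "hyperplane p G H" "hyperplane p G M" "H \<noteq> M" shows "\<not> H \<subseteq> M"
proof
  assume "H \<subseteq> M"
  moreover have "card H = card M" using assms(1,2) p_gt_1 by (metis hyperplane_card mult_left_cancel not_one_less_zero)
  ultimately show False using card_subset_eq[OF finite_sub[OF fin hyperplane_subgroup[OF assms(2)]]] assms(3) by blast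
qed

lemma hyperplane_inter_eq:
  assumes "hyperplane p G U" "hyperplane p G V" "U \<noteq> V" "J \<subseteq> U" "J \<subseteq> V" "p * (p * card J) = card (carrier G)"
  shows "U \<inter> V = J"
proof -
  have sU: "subgroup U G" by (rule hyperplane_subgroup[OF assms(1)])
  have "p * card (U \<inter> V) = card U"
    using card_inter_hyperplane[OF assms(2) sU hyperplane_not_subset[OF assms(1-3)]] .
  then have "p * (p * card (U \<inter> V)) = p * (p * card J)" using assms(6) hyperplane_card[OF assms(1)] by simp
  then have "card J = card (U \<inter> V)" using p_gt_1 by simp
  moreover have "finite (U \<inter> V)" using finite_sub[OF fin sU] by simp
  ultimately show ?thesis using card_subset_eq[of "U \<inter> V" J] assms(4,5) by blast
qed

text \<open>The hyperplanes through the intersection of two hyperplanes form a pencil with \<open>p + 1 \<ge> 4\<close> members,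
  any two of which have this same intersection.\<close>
lemma obtain_pencil:
  assumes p3: "2 < p" and H: "hyperplane p G H" and M: "hyperplane p G M" and ne: "H \<noteq> M"
  obtains R S where "hyperplane p G R" "hyperplane p G S" "R \<noteq> H" "R \<noteq> M" "S \<noteq> H" "S \<noteq> M" "R \<noteq> S"
    "R \<inter> H = H \<inter> M" "R \<inter> M = H \<inter> M" "S \<inter> H = H \<inter> M" "S \<inter> M = H \<inter> M" "R \<inter> S = H \<inter> M"
proof -
  let ?J = "H \<inter> M"
  have fJ: "over_frattini p G ?J"
    by (rule over_frattini_inter[OF hyperplane_over_frattini[OF H] hyperplane_over_frattini[OF M]])
  have cJ: "p * (p * card ?J) = card (carrier G)"
    using card_inter_hyperplane[OF M hyperplane_subgroup[OF H] hyperplane_not_subset[OF H M ne]] hyperplane_card[OF H]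
    by simp
  have sJ: "subgroup ?J G" by (rule over_frattini_subgroup[OF fJ])
  have JG: "?J \<subseteq> carrier G" by (rule subgroup.subset[OF sJ])
  have new: "hyperplane p G (adjoin G ?J w) \<and> ?J \<subseteq> adjoin G ?J w \<and> w \<in> adjoin G ?J w"
    if w: "w \<in> carrier G" "w \<notin> H" for w
  proof -
    have wJ: "w \<notin> ?J" using w by blast
    have "hyperplane p G (adjoin G ?J w)"
      using over_frattini_adjoin[OF fJ w(1) wJ] cJ by (simp add: hyperplane_def)
    then show ?thesis using subset_adjoin[OF JG] mem_adjoin[OF sJ w(1)] by blast
  qed
  have "sum_list (map card [M]) < card (carrier G)" using hyperplane_psubset[OF M] by simp
  then obtain w where w: "w \<in> carrier G" "w \<notin> H" "w \<notin> M"
    using exists_off_hyperplane[OF H, of "[M]"] hyperplane_subgroup[OF M] by auto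
  define R where "R = adjoin G ?J w"
  have R: "hyperplane p G R" "?J \<subseteq> R" "w \<in> R" using new[OF w(1,2)] unfolding R_def by auto
  have "p * sum_list (map card [M, R]) = 2 * card (carrier G)"
    using hyperplane_card[OF M] hyperplane_card[OF R(1)] by (simp add: add_mult_distrib2)
  also have "\<dots> < p * card (carrier G)" using p3 card_sub_pos[OF fin subgroup_self] by simp
  finally have "sum_list (map card [M, R]) < card (carrier G)" by simp
  then obtain v where v: "v \<in> carrier G" "v \<notin> H" "v \<notin> M" "v \<notin> R"
    using exists_off_hyperplane[OF H, of "[M, R]"] hyperplane_subgroup[OF M] hyperplane_subgroup[OF R(1)] by auto
  define S where "S = adjoin G ?J v"
  have S: "hyperplane p G S" "?J \<subseteq> S" "v \<in> S" using new[OF v(1,2)] unfolding S_def by auto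
  have ne: "R \<noteq> H" "R \<noteq> M" "S \<noteq> H" "S \<noteq> M" "R \<noteq> S" using w v R(3) S(3) by auto
  show ?thesis
    by (rule that[OF R(1) S(1) ne]; rule hyperplane_inter_eq) (use R S H M ne cJ in auto)
qed

lemma over_frattini_restrict:
  assumes E: "over_frattini p G E" and R: "subgroup R G"
  shows "over_frattini p (G\<lparr>carrier := R\<rparr>) (E \<inter> R)"
proof -
  have RG: "R \<subseteq> carrier G" by (rule subgroup.subset[OF R])
  have "subgroup (E \<inter> R) (G\<lparr>carrier := R\<rparr>)"
    by (rule subgroup_incl[OF subgroups_Inter_pair[OF over_frattini_subgroup[OF E] R] R]) simp
  moreover have "cmt G x y \<in> R" if "x \<in> R" "y \<in> R" for x y
    using that R by (simp add: subgroup.m_closed subgroup.m_inv_closed)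
  moreover have "x [^] p \<in> R" if "x \<in> R" for x
    using monoid.nat_pow_closed[OF group.is_monoid[OF subgroup_imp_group[OF R]], of x p] that
    by (simp flip: nat_pow_consistent)
  ultimately show ?thesis
    using over_frattini_cmt[OF E] over_frattini_pow[OF E] RG m_inv_consistent[OF R]
    unfolding over_frattini_def by (auto simp: subset_iff simp flip: nat_pow_consistent)
qed

lemma hyperplane_restrict:
  assumes H: "hyperplane p G H" and R: "hyperplane p G R" and ne: "H \<noteq> R"
  shows "hyperplane p (G\<lparr>carrier := R\<rparr>) (H \<inter> R)"
proof -
  have sR: "subgroup R G" by (rule hyperplane_subgroup[OF R])
  have "p * card (H \<inter> R) = card R"
    using card_inter_hyperplane[OF R hyperplane_subgroup[OF H] hyperplane_not_subset[OF H R ne]]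
      hyperplane_card[OF H] hyperplane_card[OF R] p_gt_1 by (metis mult_left_cancel not_one_less_zero)
  then show ?thesis using over_frattini_restrict[OF hyperplane_over_frattini[OF H] sR] by (simp add: hyperplane_def)
qed

lemma centralizer_restrict:
  "subgroup R G \<Longrightarrow> x \<in> R \<Longrightarrow> centralizer (G\<lparr>carrier := R\<rparr>) x = centralizer G x \<inter> R"
  using subgroup.subset[of R G] by (auto simp: centralizer_def)

end

section \<open>Elements of the second centre\<close>

definition centre :: "('a, 'b) monoid_scheme \<Rightarrow> 'a set" where
  "centre G = {z \<in> carrier G. \<forall>g\<in>carrier G. g \<otimes>\<^bsub>G\<^esub> z = z \<otimes>\<^bsub>G\<^esub> g}"

context group begin

lemma centreD: "z \<in> centre G \<Longrightarrow> g \<in> carrier G \<Longrightarrow> g \<otimes> z = z \<otimes> g"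
  and centre_carrier: "z \<in> centre G \<Longrightarrow> z \<in> carrier G"
  by (auto simp: centre_def)

lemma conj_centre: "z \<in> centre G \<Longrightarrow> g \<in> carrier G \<Longrightarrow> g \<otimes> z \<otimes> inv g = z"
  using centreD[of z g] centre_carrier[of z] by (simp add: m_assoc)

lemma right_inverse_eq: "a \<otimes> b = \<one> \<Longrightarrow> a \<in> carrier G \<Longrightarrow> b \<in> carrier G \<Longrightarrow> b = inv a"
  using inv_cancel_left[of a b] by simp

lemma subgroup_centre: "subgroup (centre G) G"
proof (rule subgroupI)
  show "centre G \<subseteq> carrier G" by (auto simp: centre_def)
  have "\<one> \<in> centre G" by (simp add: centre_def)
  then show "centre G \<noteq> {}" by blast
  fix a assume a: "a \<in> centre G"
  have ac: "a \<in> carrier G" by (rule centre_carrier[OF a])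
  have "g \<otimes> inv a = inv a \<otimes> g" if g: "g \<in> carrier G" for g
  proof -
    have "inv (inv g) \<otimes> inv a = inv (a \<otimes> inv g)" using g ac by (simp add: inv_mult_group)
    also have "a \<otimes> inv g = inv g \<otimes> a" using centreD[OF a] g by simp
    also have "inv (inv g \<otimes> a) = inv a \<otimes> g" using g ac by (simp add: inv_mult_group)
    finally show ?thesis using g by simp
  qed
  then show "inv a \<in> centre G" using ac by (simp add: centre_def)
  fix b assume b: "b \<in> centre G"
  have bc: "b \<in> carrier G" by (rule centre_carrier[OF b])
  have "g \<otimes> (a \<otimes> b) = (a \<otimes> b) \<otimes> g" if g: "g \<in> carrier G" for g
  proof -
    have "g \<otimes> (a \<otimes> b) = (g \<otimes> a) \<otimes> b" using g ac bc by (simp add: m_assoc)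
    also have "\<dots> = a \<otimes> (g \<otimes> b)" using centreD[OF a g] g ac bc by (simp add: m_assoc)
    also have "\<dots> = (a \<otimes> b) \<otimes> g" using centreD[OF b g] g ac bc by (simp add: m_assoc)
    finally show ?thesis .
  qed
  then show "a \<otimes> b \<in> centre G" using ac bc by (simp add: centre_def)
qed

lemma normal_if_subset_centre:
  assumes "subgroup A G" "A \<subseteq> centre G" shows "A \<lhd> G"
  unfolding normal_inv_iff using assms conj_centre by auto

lemma normal_centre: "centre G \<lhd> G"
  using normal_if_subset_centre[OF subgroup_centre] by blast

lemma mem_centre_iff_centralizer: "z \<in> carrier G \<Longrightarrow> z \<in> centre G \<longleftrightarrow> centralizer G z = carrier G"
  unfolding centre_def centralizer_def by fastforce

end

text \<open>An element whose commutators are central: then \<open>g \<mapsto> [z, g]\<close> is a homomorphism with kernel the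
  centralizer of \<open>z\<close>, whose image is the central subgroup by which one factors.\<close>
locale second_central = p_grp +
  fixes z assumes z: "z \<in> carrier G" and cmt_central: "g \<in> carrier G \<Longrightarrow> cmt G z g \<in> centre G"
begin

definition "cmt_range = (\<lambda>g. cmt G z g) ` carrier G"

lemma cmt_hom:
  assumes "g \<in> carrier G" "h \<in> carrier G" shows "cmt G z (g \<otimes> h) = cmt G z g \<otimes> cmt G z h"
  using cmt_mult_right[OF z assms] conj_centre[OF cmt_central[OF assms(2)] assms(1)] by simp

lemma cmt_mem_range: "g \<in> carrier G \<Longrightarrow> cmt G z g \<in> cmt_range"
  by (auto simp: cmt_range_def)

lemma cmt_range_subset_centre: "cmt_range \<subseteq> centre G"
  using cmt_central by (auto simp: cmt_range_def)

lemma subgroup_cmt_range: "subgroup cmt_range G"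
proof (rule finite_closed_subgroup[OF fin])
  show "cmt_range \<subseteq> carrier G" using z by (auto simp: cmt_range_def)
  show "cmt_range \<noteq> {}" using cmt_mem_range[OF one_closed] by blast
  fix u v assume "u \<in> cmt_range" "v \<in> cmt_range"
  then obtain g h where gh: "g \<in> carrier G" "u = cmt G z g" "h \<in> carrier G" "v = cmt G z h"
    by (auto simp: cmt_range_def)
  then have "u \<otimes> v = cmt G z (g \<otimes> h)" using cmt_hom by simp
  then show "u \<otimes> v \<in> cmt_range" using cmt_mem_range[of "g \<otimes> h"] gh by simp
qed

lemma normal_cmt_range: "cmt_range \<lhd> G"
  by (rule normal_if_subset_centre[OF subgroup_cmt_range cmt_range_subset_centre])

lemma subgroup_F: "subgroup (centralizer G z) G" by (rule subgroup_centralizer[OF z])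

lemma cmt_inv_hom: "g \<in> carrier G \<Longrightarrow> cmt G z (inv g) = inv (cmt G z g)"
proof -
  assume g: "g \<in> carrier G"
  have "cmt G z g \<otimes> cmt G z (inv g) = cmt G z (g \<otimes> inv g)" by (rule cmt_hom[symmetric]) (use g in auto)
  also have "\<dots> = \<one>" using g z by simp
  finally show ?thesis by (rule right_inverse_eq) (use g z in auto)
qed

lemma cmt_mem_centralizer:
  assumes x: "x \<in> carrier G" and y: "y \<in> carrier G" shows "cmt G x y \<in> centralizer G z"
proof -
  let ?f = "\<lambda>g. cmt G z g"
  have c: "?f x \<in> carrier G" "?f y \<in> carrier G" using x y z by auto
  have "?f (cmt G x y) = ?f x \<otimes> ?f y \<otimes> ?f (inv x) \<otimes> ?f (inv y)"
    by (subst cmt_hom | use x y in simp)+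
  also have "\<dots> = ?f x \<otimes> ?f y \<otimes> inv (?f x) \<otimes> inv (?f y)" by (simp only: cmt_inv_hom[OF x] cmt_inv_hom[OF y])
  also have "\<dots> = \<one>" using cmt_eq_one_iff[OF c] centreD[OF cmt_central[OF y] c(1)] by blast
  finally show ?thesis using centralizer_iff_cmt[OF z] x y by simp
qed

lemma cmt_pow: "g \<in> carrier G \<Longrightarrow> cmt G z (g [^] (n::nat)) = cmt G z g [^] n"
proof (induction n)
  case 0 then show ?case using z by simp
next
  case (Suc n) then show ?case using cmt_hom[of "g [^] n" g] by (simp only: nat_pow_Suc nat_pow_closed)
qed

lemma cmt_pow_left:
  assumes g: "g \<in> carrier G" shows "cmt G (z [^] (n::nat)) g = cmt G z g [^] n"
proof (induction n)
  case 0 then show ?case using g by simp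
next
  case (Suc n)
  let ?c = "cmt G z g"
  have cc: "?c \<in> carrier G" using z g by simp
  have "cmt G (z [^] Suc n) g = (z [^] n \<otimes> ?c \<otimes> inv (z [^] n)) \<otimes> cmt G (z [^] n) g"
    using cmt_mult_left[of "z [^] n" z g] z g by (simp only: nat_pow_Suc nat_pow_closed)
  also have "z [^] n \<otimes> ?c \<otimes> inv (z [^] n) = ?c" by (rule conj_centre[OF cmt_central[OF g]]) (use z in simp)
  also have "?c \<otimes> cmt G (z [^] n) g = ?c \<otimes> ?c [^] n" by (simp only: Suc)
  also have "\<dots> = ?c [^] Suc n" using nat_pow_comm[OF cc, of 1 n] cc by simp
  finally show ?case .
qed

lemma over_frattini_centralizer:
  assumes "z [^] p \<in> centre G" shows "over_frattini p G (centralizer G z)"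
  unfolding over_frattini_def
proof (intro conjI ballI subgroup_F cmt_mem_centralizer)
  fix x assume x: "x \<in> carrier G"
  have "cmt G z (x [^] p) = cmt G (z [^] p) x" using cmt_pow[OF x] cmt_pow_left[OF x] by simp
  also have "\<dots> = \<one>" using cmt_eq_one_iff[OF centre_carrier[OF assms] x] centreD[OF assms x] by simp
  finally show "x [^] p \<in> centralizer G z" using centralizer_iff_cmt[OF z] x by simp
qed

lemma card_range: "card cmt_range * card (centralizer G z) = card (carrier G)"
proof (rule antisym)
  show "card cmt_range * card (centralizer G z) \<le> card (carrier G)"
    unfolding cmt_range_def by (rule card_cmt_image[OF fin z])
  let ?f = "\<lambda>g. cmt G z g"
  have "card {h \<in> carrier G. ?f h = y} \<le> card (centralizer G z)" if y: "y \<in> ?f ` carrier G" for y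
  proof -
    obtain g where g: "g \<in> carrier G" "y = ?f g" using y by blast
    have sub: "(\<lambda>h. inv g \<otimes> h) ` {h \<in> carrier G. ?f h = y} \<subseteq> centralizer G z"
    proof (rule image_subsetI)
      fix h assume "h \<in> {h \<in> carrier G. ?f h = y}"
      then have h: "h \<in> carrier G" "?f h = ?f g" using g by auto
      have "?f (inv g \<otimes> h) = inv (?f g) \<otimes> ?f g"
        using cmt_hom[of "inv g" h] cmt_inv_hom[OF g(1)] h g(1) by (simp only: inv_closed)
      also have "\<dots> = \<one>" using z g by simp
      finally show "inv g \<otimes> h \<in> centralizer G z" using centralizer_iff_cmt[OF z] g h by simp
    qed
    have inj: "inj_on (\<lambda>h. inv g \<otimes> h) {h \<in> carrier G. ?f h = y}" by (rule inj_onI) (use g in auto)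
    show ?thesis using card_inj_on_le[OF inj sub finite_sub[OF fin subgroup_F]] .
  qed
  then have "(\<Sum>y\<in>?f ` carrier G. card {h \<in> carrier G. ?f h = y}) \<le> (\<Sum>y\<in>?f ` carrier G. card (centralizer G z))"
    by (rule sum_mono)
  moreover have "card (carrier G) = (\<Sum>y\<in>?f ` carrier G. card {h \<in> carrier G. ?f h = y})"
    using sum.image_gen[of "carrier G" "\<lambda>_. 1::nat" ?f] fin by (simp only: card_eq_sum)
  ultimately show "card (carrier G) \<le> card cmt_range * card (centralizer G z)" by (simp add: cmt_range_def)
qed

lemma centralizer_subset_mod: "x \<in> carrier G \<Longrightarrow> centralizer G x \<subseteq> centralizer_mod G cmt_range x"
  using centralizer_iff_cmt subgroup.one_closed[OF subgroup_cmt_range] unfolding centralizer_mod_def by auto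

lemma centralizer_mult_subset_mod:
  assumes x: "x \<in> carrier G"
  shows "centralizer G (x \<otimes> z) \<subseteq> centralizer_mod G cmt_range x"
proof
  have xz: "x \<otimes> z \<in> carrier G" using x z by simp
  fix g assume "g \<in> centralizer G (x \<otimes> z)"
  then have g: "g \<in> carrier G" "cmt G (x \<otimes> z) g = \<one>" using centralizer_iff_cmt[OF xz] by auto
  have "cmt G (x \<otimes> z) g = cmt G z g \<otimes> cmt G x g"
    using cmt_mult_left[OF x z g(1)] conj_centre[OF cmt_central[OF g(1)] x] by simp
  then have "cmt G z g \<otimes> cmt G x g = \<one>" using g(2) by simp
  then have "cmt G x g = inv (cmt G z g)" by (rule right_inverse_eq) (use g(1) x z in auto)
  then have "cmt G x g \<in> cmt_range"
    using subgroup.m_inv_closed[OF subgroup_cmt_range cmt_mem_range[OF g(1)]] by simp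
  then show "g \<in> centralizer_mod G cmt_range x" using g(1) unfolding centralizer_mod_def by blast
qed

lemma centralizer_inter_subset:
  assumes x: "x \<in> carrier G"
  shows "centralizer G x \<inter> centralizer G (x \<otimes> z) \<subseteq> centralizer G z"
proof
  fix g assume "g \<in> centralizer G x \<inter> centralizer G (x \<otimes> z)"
  then have g: "g \<in> carrier G" "g \<otimes> x = x \<otimes> g" "g \<otimes> (x \<otimes> z) = (x \<otimes> z) \<otimes> g"
    by (auto simp: centralizer_def)
  have "x \<otimes> (g \<otimes> z) = (x \<otimes> g) \<otimes> z" using g(1) x z by (simp add: m_assoc)
  also have "\<dots> = (g \<otimes> x) \<otimes> z" by (simp only: g(2))
  also have "\<dots> = g \<otimes> (x \<otimes> z)" using g(1) x z by (simp add: m_assoc)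
  also have "\<dots> = x \<otimes> (z \<otimes> g)" unfolding g(3) using g(1) x z by (simp add: m_assoc)
  finally show "g \<in> centralizer G z" using g(1) x z by (simp add: centralizer_def)
qed

lemma z_mem_centralizer_mod:
  assumes x: "x \<in> carrier G" shows "z \<in> centralizer_mod G cmt_range x"
proof -
  have "inv (cmt G z x) \<in> cmt_range" by (rule subgroup.m_inv_closed[OF subgroup_cmt_range cmt_mem_range[OF x]])
  then show ?thesis using inv_cmt[OF z x] z unfolding centralizer_mod_def by simp
qed

text \<open>Modulo the commutators with \<open>z\<close>, the element \<open>z\<close> centralizes everything. So if \<open>x\<close> does not commute
  with \<open>z\<close>, its centralizer becomes larger in the quotient.\<close>
lemma breadth_drop:
  assumes x: "x \<in> carrier G" "x \<notin> centralizer G z" and b: "breadth_le p k G x"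
  shows "0 < k" "card (carrier G) \<le> p ^ (k - 1) * card (centralizer_mod G cmt_range x)"
proof -
  let ?C = "centralizer G x" and ?D = "centralizer_mod G cmt_range x"
  have sC: "subgroup ?C G" by (rule subgroup_centralizer[OF x(1)])
  have zC: "z \<notin> ?C" using x z unfolding centralizer_def by auto
  show k: "0 < k"
  proof (rule ccontr)
    assume "\<not> 0 < k"
    then have "card (carrier G) \<le> card ?C" using b by (simp add: breadth_le_def)
    then have "?C = carrier G" using card_seteq[OF fin subgroup.subset[OF sC]] by simp
    then show False using zC z by simp
  qed
  have "?C \<subset> ?D" using centralizer_subset_mod[OF x(1)] z_mem_centralizer_mod[OF x(1)] zC by blast
  then have "p * card ?C \<le> card ?D"
    by (rule p_mult_card_le_psubset[OF sC subgroup_centralizer_mod[OF normal_cmt_range x(1)]])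
  then have "p ^ (k - 1) * (p * card ?C) \<le> p ^ (k - 1) * card ?D" by (rule mult_le_mono2)
  moreover have "p ^ (k - 1) * (p * card ?C) = p ^ k * card ?C" using k by (cases k) simp_all
  ultimately show "card (carrier G) \<le> p ^ (k - 1) * card ?D" using b unfolding breadth_le_def by linarith
qed

text \<open>Two elements \<open>x\<close> and \<open>xz\<close> of small breadth: their centralizers meet only in the centralizer of
  \<open>z\<close>, so both are far from filling the centralizer of \<open>x\<close> modulo the commutators with \<open>z\<close>.\<close>
lemma breadth_drop_two:
  assumes x: "x \<in> carrier G" "x \<notin> centralizer G z"
    and b: "breadth_le p k G x" "breadth_le p k G (x \<otimes> z)"
  shows "p * card cmt_range * card (carrier G) \<le> p ^ (2 * k) * card (centralizer_mod G cmt_range x)"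
proof -
  let ?C = "centralizer G x" and ?C' = "centralizer G (x \<otimes> z)" and ?D = "centralizer_mod G cmt_range x"
  let ?F = "centralizer G z"
  have xz: "x \<otimes> z \<in> carrier G" using x z by simp
  have sC: "subgroup ?C G" and sC': "subgroup ?C' G" by (rule subgroup_centralizer; use x z in simp)+
  have sD: "subgroup ?D G" by (rule subgroup_centralizer_mod[OF normal_cmt_range x(1)])
  have CD: "?C \<subseteq> ?D" by (rule centralizer_subset_mod[OF x(1)])
  have C'D: "?C' \<subseteq> ?D" by (rule centralizer_mult_subset_mod[OF x(1)])
  have sub: "?C \<inter> ?C' \<subseteq> ?F" by (rule centralizer_inter_subset[OF x(1)])
  have zF: "z \<in> ?F" using z by (simp add: centralizer_def)
  have zC: "z \<notin> ?C" using x z unfolding centralizer_def by auto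
  have "?C \<inter> ?C' \<subset> ?F" using sub zF zC by blast
  then have i1: "p * card (?C \<inter> ?C') \<le> card ?F"
    by (rule p_mult_card_le_psubset[OF subgroups_Inter_pair[OF sC sC'] subgroup_F])
  interpret GD: group "G\<lparr>carrier := ?D\<rparr>" by (rule subgroup_imp_group[OF sD])
  have i2: "card ?C * card ?C' \<le> card ?D * card (?C \<inter> ?C')"
    using GD.card_mult_le_card_inter[OF _ subgroup_incl[OF sC sD CD] subgroup_incl[OF sC' sD C'D]]
      finite_sub[OF fin sD] by simp
  let ?n = "card (carrier G)"
  have "?n * ?n \<le> (p ^ k * card ?C) * (p ^ k * card ?C')"
    using b unfolding breadth_le_def by (rule mult_le_mono)
  also have "\<dots> = p ^ (2 * k) * (card ?C * card ?C')" unfolding mult_2 power_add by (simp only: ac_simps)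
  also have "\<dots> \<le> p ^ (2 * k) * (card ?D * card (?C \<inter> ?C'))" using i2 by simp
  finally have "(p * card cmt_range) * (?n * ?n) \<le> (p * card cmt_range) * (p ^ (2 * k) * (card ?D * card (?C \<inter> ?C')))"
    by (rule mult_le_mono2)
  also have "\<dots> = (p ^ (2 * k) * card ?D * card cmt_range) * (p * card (?C \<inter> ?C'))" by (simp add: ac_simps)
  also have "\<dots> \<le> (p ^ (2 * k) * card ?D * card cmt_range) * card ?F" by (rule mult_le_mono2[OF i1])
  also have "\<dots> = (p ^ (2 * k) * card ?D) * ?n" by (simp flip: card_range add: ac_simps)
  finally have "?n * (p * card cmt_range * ?n) \<le> ?n * (p ^ (2 * k) * card ?D)" by (simp add: ac_simps)
  then show ?thesis using card_sub_pos[OF fin subgroup_self] by simp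
qed

lemma breadth_drop_large:
  assumes x: "x \<in> carrier G" "x \<notin> centralizer G z"
    and b: "breadth_le p k G x" "breadth_le p k G (x \<otimes> z)" and r: "card cmt_range = p ^ r"
  shows "Suc r \<le> 2 * k" "card (carrier G) \<le> p ^ (2 * k - Suc r) * card (centralizer_mod G cmt_range x)"
proof -
  let ?D = "centralizer_mod G cmt_range x"
  have two: "p ^ Suc r * card (carrier G) \<le> p ^ (2 * k) * card ?D" using breadth_drop_two[OF x b] r by simp
  also have "\<dots> \<le> p ^ (2 * k) * card (carrier G)"
    by (intro mult_le_mono2 card_mono[OF fin] subgroup.subset[OF subgroup_centralizer_mod[OF normal_cmt_range x(1)]])
  finally have "p ^ Suc r \<le> p ^ (2 * k)" using card_sub_pos[OF fin subgroup_self] by simp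
  then show r2k: "Suc r \<le> 2 * k" using p_gt_1 by (rule power_le_imp_le_exp[rotated])
  have pk: "p ^ (2 * k) = p ^ Suc r * p ^ (2 * k - Suc r)"
    using r2k by (simp only: power_add[symmetric] le_add_diff_inverse)
  have "p ^ Suc r * card (carrier G) \<le> p ^ Suc r * (p ^ (2 * k - Suc r) * card ?D)"
    using two unfolding pk by (simp only: mult.assoc)
  then show "card (carrier G) \<le> p ^ (2 * k - Suc r) * card ?D" using p_gt_1 by simp
qed

text \<open>For \<open>x\<close> in the centralizer \<open>F\<close> of \<open>z\<close>, the breadth may stay the same in the quotient of \<open>G\<close>, but it
  drops in the quotient of \<open>F\<close>. Otherwise the centralizers of \<open>x\<close> and of \<open>xz\<close> would be the same
  subgroup, not contained in \<open>F\<close>; yet what commutes with \<open>x\<close> and \<open>xz\<close> commutes with \<open>z\<close>.\<close>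
lemma breadth_drop_inside:
  assumes F: "hyperplane p G (centralizer G z)" and x: "x \<in> centralizer G z"
    and b: "breadth_le p k G x" "breadth_le p k G (x \<otimes> z)" and k: "0 < k"
  shows "card (centralizer G z) \<le> p ^ (k - 1) * card (centralizer_mod G cmt_range x \<inter> centralizer G z)"
proof -
  let ?D = "centralizer_mod G cmt_range x" and ?F = "centralizer G z"
  have xc: "x \<in> carrier G" by (rule subgroup.mem_carrier[OF subgroup_F x])
  have xz: "x \<otimes> z \<in> carrier G" using xc z by simp
  have sD: "subgroup ?D G" by (rule subgroup_centralizer_mod[OF normal_cmt_range xc])
  have pk: "p ^ k = p * p ^ (k - 1)" using k by (cases k) simp_all
  have le: "card (carrier G) \<le> p ^ k * card ?D"
    using b(1) card_mono[OF finite_sub[OF fin sD] centralizer_subset_mod[OF xc]] unfolding breadth_le_def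
    by (meson mult_le_mono2 order_trans)
  show ?thesis
  proof (cases "?D \<subseteq> ?F")
    case True
    then have e: "?D \<inter> ?F = ?D" by blast
    have "p * card ?F \<le> p * (p ^ (k - 1) * card ?D)" using le pk hyperplane_card[OF F] by simp
    then show ?thesis unfolding e using p_gt_1 by simp
  next
    case False
    have "card (carrier G) \<le> p ^ (k - 1) * card ?D"
    proof (rule ccontr)
      assume n: "\<not> ?thesis"
      have eq: "C = ?D" if C: "subgroup C G" "C \<subseteq> ?D" "card (carrier G) \<le> p ^ k * card C" for C
      proof (rule ccontr)
        assume "C \<noteq> ?D"
        then have "p * card C \<le> card ?D" using p_mult_card_le_psubset[OF C(1) sD] C(2) by blast
        then have "p ^ (k - 1) * (p * card C) \<le> p ^ (k - 1) * card ?D" by (rule mult_le_mono2)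
        moreover have "p ^ (k - 1) * (p * card C) = p ^ k * card C" using pk by simp
        ultimately show False using C(3) n by linarith
      qed
      have sub: "centralizer G (x \<otimes> z) \<subseteq> ?D" by (rule centralizer_mult_subset_mod[OF xc])
      have e1: "centralizer G x = ?D"
        by (rule eq[OF subgroup_centralizer[OF xc] centralizer_subset_mod[OF xc]]) (use b in \<open>simp add: breadth_le_def\<close>)
      have e2: "centralizer G (x \<otimes> z) = ?D"
        by (rule eq[OF subgroup_centralizer[OF xz] sub]) (use b in \<open>simp add: breadth_le_def\<close>)
      have "?D \<subseteq> ?F" using centralizer_inter_subset[OF xc] e1 e2 by blast
      then show False using False by blast
    qed
    then have "p * card ?F \<le> p ^ (k - 1) * (p * card (?D \<inter> ?F))"
      using card_inter_hyperplane[OF F sD False] hyperplane_card[OF F] by simp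
    then have "p * card ?F \<le> p * (p ^ (k - 1) * card (?D \<inter> ?F))" by (simp add: ac_simps)
    then show ?thesis using p_gt_1 by simp
  qed
qed

end

text \<open>A normal subgroup that is not central reaches into the second centre, already with an element
  whose \<open>p\<close>-th power is central.\<close>
lemma (in p_grp) exists_second_central:
  assumes N: "N \<lhd> G" "\<not> N \<subseteq> centre G"
  shows "\<exists>z\<in>N. z \<notin> centre G \<and> z [^] p \<in> centre G \<and> second_central G p z"
proof -
  obtain Q :: "'a monoid" and \<pi> where pq: "p_quot G p Q \<pi> (centre G)" using obtain_quotient[OF normal_centre] .
  interpret p_quot G p Q \<pi> "centre G" by (rule pq)
  interpret N: normal N G by (rule N)
  have nN: "\<pi> ` N \<lhd> Q" by (rule N.surj_hom_normal_subgroup[OF \<pi>.group_hom_axioms pi_surj])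
  have "\<pi> ` N \<noteq> {\<one>\<^bsub>Q\<^esub>}"
  proof
    assume "\<pi> ` N = {\<one>\<^bsub>Q\<^esub>}"
    then have "N \<subseteq> centre G" using pi_ker N.subset by blast
    then show False using N(2) by blast
  qed
  then obtain y where y: "y \<in> \<pi> ` N" "y \<noteq> \<one>\<^bsub>Q\<^esub>" "y [^]\<^bsub>Q\<^esub> p = \<one>\<^bsub>Q\<^esub>"
    "\<And>g. g \<in> carrier Q \<Longrightarrow> g \<otimes>\<^bsub>Q\<^esub> y = y \<otimes>\<^bsub>Q\<^esub> g"
    using Q.normal_meets_center[OF nN] by blast
  then obtain z where z: "z \<in> N" "y = \<pi> z" by blast
  have zc: "z \<in> carrier G" using z by simp
  have "\<pi> (z [^] p) = \<one>\<^bsub>Q\<^esub>" using y(3) z \<pi>.hom_nat_pow[OF zc, of p] by simp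
  then have zp: "z [^] p \<in> centre G" using pi_ker zc by simp
  have "cmt G z g \<in> centre G" if g: "g \<in> carrier G" for g
  proof -
    have "cmt Q (\<pi> z) (\<pi> g) = \<one>\<^bsub>Q\<^esub>"
      using Q.cmt_eq_one_iff[OF \<pi>.hom_closed[OF zc] \<pi>.hom_closed[OF g]] y(4)[OF \<pi>.hom_closed[OF g]] z by simp
    then have "\<pi> (cmt G z g) = \<one>\<^bsub>Q\<^esub>" by (simp only: image_cmt[OF zc g])
    moreover have "cmt G z g \<in> carrier G" using zc g by simp
    ultimately show ?thesis using pi_ker by blast
  qed
  then have "second_central G p z" using zc by unfold_locales
  moreover have "z \<notin> centre G" using y(2) z pi_ker[OF zc] by simp
  ultimately show ?thesis using z zp by blast
qed

section \<open>Groups covered by two hyperplanes and holes\<close>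

fun triangular :: "nat \<Rightarrow> nat" where
  "triangular 0 = 0"
| "triangular (Suc k) = Suc k + triangular k"

text \<open>The condition on the exponents \<open>n\<close> of the holes: the hole with number \<open>j\<close> has index at least
  \<open>p ^ max 2 j\<close>, where numbering begins with \<open>i\<close>.\<close>
fun spread :: "nat \<Rightarrow> nat list \<Rightarrow> bool" where
  "spread i [] = True"
| "spread i (n # ns) = (max 2 i \<le> n \<and> spread (Suc i) ns)"

text \<open>The price of the holes in the exponent of the bound: the hole with number \<open>j\<close> costs the amount by which
  \<open>n\<close> falls short of \<open>k + j\<close>. The price stays the same if \<open>n\<close> and \<open>k\<close>, or \<open>n\<close> and \<open>j\<close>, both decrease by
  one. This is why a hole may lose one dimension whenever \<open>k\<close> decreases or an earlier hole disappears.\<close>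
fun excess :: "nat \<Rightarrow> nat \<Rightarrow> nat list \<Rightarrow> nat" where
  "excess k i [] = 0"
| "excess k i (n # ns) = (k + i - n) + excess k (Suc i) ns"

lemma excess_shift: "excess k (Suc i) ns = excess (Suc k) i ns"
  by (induction ns arbitrary: i) auto

lemma excess_mono: "k \<le> k' \<Longrightarrow> i \<le> i' \<Longrightarrow> excess k i ns \<le> excess k' i' ns"
  by (induction ns arbitrary: i i') (auto intro!: add_mono diff_le_mono)

lemma excess_append: "excess k i (ms @ ns) = excess k i ms + excess k (i + length ms) ns"
  by (induction ms arbitrary: i) auto

lemma excess_pred:
  "(\<And>n. n \<in> set ns \<Longrightarrow> 0 < n) \<Longrightarrow> excess k i (map (\<lambda>n. n - 1) ns) = excess (Suc k) i ns"
proof (induction ns arbitrary: i)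
  case (Cons n ns)
  have "0 < n" using Cons.prems by simp
  then have "k + i - (n - 1) = Suc k + i - n" by linarith
  then show ?case using Cons by simp
qed simp

lemma spread_mono: "spread j ns \<Longrightarrow> i \<le> j \<Longrightarrow> spread i ns"
proof (induction ns arbitrary: i j)
  case (Cons n ns)
  have "spread (Suc i) ns" using Cons.IH[of "Suc j" "Suc i"] Cons.prems by simp
  then show ?case using Cons.prems by simp
qed simp

lemma spread_append: "spread i (ms @ ns) \<longleftrightarrow> spread i ms \<and> spread (i + length ms) ns"
  by (induction ms arbitrary: i) auto

lemma spread_ge_2: "spread i ns \<Longrightarrow> n \<in> set ns \<Longrightarrow> 2 \<le> n"
  by (induction ns arbitrary: i) auto

lemma spread_pred: "spread (Suc i) ns \<Longrightarrow> 2 \<le> i \<Longrightarrow> spread i (map (\<lambda>n. n - 1) ns)"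
proof (induction ns arbitrary: i)
  case (Cons n ns)
  have "spread (Suc i) (map (\<lambda>n. n - 1) ns)" using Cons.IH[of "Suc i"] Cons.prems by simp
  moreover have "max 2 (Suc i) \<le> n" using Cons.prems(1) by (simp only: spread.simps)
  then have "max 2 i \<le> n - 1" using Cons.prems(2) by linarith
  ultimately show ?case by simp
qed simp

lemma spread_tail: "spread 2 ns \<Longrightarrow> spread 2 (map (\<lambda>n. n - 1) (tl ns))"
proof -
  assume "spread 2 ns"
  then have "spread (Suc 2) (tl ns)" by (cases ns) simp_all
  then show ?thesis by (rule spread_pred) simp
qed

lemma excess_tail:
  assumes k: "0 < k" and sp: "spread 2 ns"
  shows "excess (k - 1) i (map (\<lambda>n. n - 1) (tl ns)) = excess k i (tl ns)"
proof -
  have "spread (Suc 2) (tl ns)" using sp by (cases ns) simp_all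
  then have "excess (k - 1) i (map (\<lambda>n. n - 1) (tl ns)) = excess (Suc (k - 1)) i (tl ns)"
    using spread_ge_2 by (intro excess_pred) fastforce
  then show ?thesis using k by simp
qed

lemma triangular_mono: "j \<le> k \<Longrightarrow> triangular j + (k - j) \<le> triangular k"
  by (induction k) (auto simp: le_Suc_eq)

definition hole :: "nat \<Rightarrow> ('a, 'b) monoid_scheme \<Rightarrow> 'a set \<Rightarrow> nat \<Rightarrow> bool" where
  "hole p G E n \<longleftrightarrow> over_frattini p G E \<and> p ^ n * card E \<le> card (carrier G)"

text \<open>Nothing is known on two hyperplanes and on a list of smaller subgroups, the holes, each of which comes
  with a lower bound \<open>p ^ n\<close> for its index. What matters is that they leave enough room for other elements.\<close>
definition covered ::
  "nat \<Rightarrow> nat \<Rightarrow> ('a, 'b) monoid_scheme \<Rightarrow> 'a set \<Rightarrow> 'a set \<Rightarrow> ('a set \<times> nat) list \<Rightarrow> bool" where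
  "covered p k G H K hs \<longleftrightarrow> hyperplane p G H \<and> hyperplane p G K \<and>
     (\<forall>(E, n)\<in>set hs. hole p G E n) \<and> spread 1 (map snd hs) \<and>
     (\<forall>x\<in>carrier G. x \<notin> H \<longrightarrow> x \<notin> K \<longrightarrow> (\<forall>(E, n)\<in>set hs. x \<notin> E) \<longrightarrow> breadth_le p k G x)"

context p_grp begin

lemma card_restrict_le:
  assumes D: "subgroup D G" and R: "subgroup R G" and le: "card (carrier G) \<le> m * card D"
  shows "card R \<le> m * card (D \<inter> R)"
proof -
  have "card D * card R \<le> card (carrier G) * card (D \<inter> R)" by (rule card_mult_le_card_inter[OF fin D R])
  also have "\<dots> \<le> m * card D * card (D \<inter> R)" using le by (rule mult_le_mono1)
  finally have "card D * card R \<le> card D * (m * card (D \<inter> R))" by (simp add: ac_simps)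
  then show ?thesis using card_sub_pos[OF fin D] by simp
qed

text \<open>A geometric series: \<open>1 / p ^ (i + 1) + 1 / p ^ (i + 2) + \<dots> = 1 / (p ^ i * (p - 1))\<close>.\<close>
lemma sum_holes:
  assumes "\<forall>(E, n)\<in>set hs. hole p G E n" "spread (Suc i) (map snd hs)"
  shows "p ^ i * (p - 1) * sum_list (map (card \<circ> fst) hs) \<le> card (carrier G)"
  using assms
proof (induction hs arbitrary: i)
  case (Cons h hs)
  obtain E n where h: "h = (E, n)" by fastforce
  let ?c = "card (carrier G)" and ?s = "sum_list (map (card \<circ> fst) hs)"
  have "max 2 (Suc i) \<le> n" using Cons.prems(2) h by (simp only: list.map snd_conv spread.simps)
  then have n: "Suc i \<le> n" by simp
  have "p ^ Suc i * card E \<le> p ^ n * card E" using n p_gt_1 by (intro mult_right_mono power_increasing) auto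
  also have "\<dots> \<le> ?c" using Cons.prems(1) h by (simp add: hole_def)
  finally have E: "(p - 1) * (p ^ Suc i * card E) \<le> (p - 1) * ?c" by (rule mult_le_mono2)
  have S: "p ^ Suc i * (p - 1) * ?s \<le> ?c" using Cons.IH[of "Suc i"] Cons.prems by (simp add: comp_def)
  have "p * (p ^ i * (p - 1) * (card E + ?s)) = (p - 1) * (p ^ Suc i * card E) + p ^ Suc i * (p - 1) * ?s"
    by (simp add: algebra_simps)
  also have "\<dots> \<le> (p - 1) * ?c + ?c" by (rule add_mono[OF E S])
  also have "\<dots> = p * ?c" using p_gt_1 by (cases p) simp_all
  finally show ?case using p_gt_1 h by (simp add: comp_def)
qed simp

lemma p_mult_card_le_proper: "subgroup U G \<Longrightarrow> U \<noteq> carrier G \<Longrightarrow> p * card U \<le> card (carrier G)"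
  using p_mult_card_le_psubset[OF _ subgroup_self] subgroup.subset by blast

text \<open>The holes together take up at most the fraction \<open>1/9 + 1/9 + 1/27 + \<dots> = 5/18\<close> of the group, and
  \<open>5/18 + 1/3 + 1/3 < 1\<close>.\<close>
lemma exists_off_holes:
  assumes p3: "2 < p" and holes: "\<forall>(E, n)\<in>set hs. hole p G E n" "spread 1 (map snd hs)"
    and B: "hyperplane p G B" and U: "subgroup U G" "U \<noteq> carrier G" and V: "subgroup V G" "V \<noteq> carrier G"
  shows "\<exists>a\<in>carrier G. a \<notin> B \<and> a \<notin> U \<and> a \<notin> V \<and> (\<forall>(E, n)\<in>set hs. a \<notin> E)"
proof -
  let ?c = "card (carrier G)" and ?s = "sum_list (map (card \<circ> fst) hs)"
  have three: "3 * card W \<le> ?c" if "subgroup W G" "W \<noteq> carrier G" for W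
  proof -
    have "3 * card W \<le> p * card W" using p3 by (intro mult_le_mono1) simp
    then show ?thesis using p_mult_card_le_proper[OF that] by linarith
  qed
  have s: "18 * ?s \<le> 5 * ?c"
  proof (cases hs)
    case (Cons h hs')
    obtain E n where h: "h = (E, n)" by fastforce
    have n: "2 \<le> n" using holes(2) Cons h by simp
    have "(3::nat) ^ 2 \<le> p ^ 2" using p3 by (intro power_mono) auto
    also have "\<dots> \<le> p ^ n" using n p3 by (intro power_increasing) auto
    finally have "9 * card E \<le> p ^ n * card E" by (intro mult_le_mono1) simp
    moreover have "p ^ n * card E \<le> ?c" using holes(1) Cons h by (simp add: hole_def)
    ultimately have E: "9 * card E \<le> ?c" by linarith
    have "p ^ 1 * (p - 1) * sum_list (map (card \<circ> fst) hs') \<le> ?c"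
      by (rule sum_holes) (use holes Cons in auto)
    moreover have "3 * 2 \<le> p ^ 1 * (p - 1)" using p3 by (intro mult_mono) auto
    then have "3 * 2 * sum_list (map (card \<circ> fst) hs') \<le> p ^ 1 * (p - 1) * sum_list (map (card \<circ> fst) hs')"
      by (rule mult_le_mono1)
    ultimately have "6 * sum_list (map (card \<circ> fst) hs') \<le> ?c" by linarith
    then show ?thesis using E Cons h by simp
  qed simp
  have c0: "0 < ?c" by (rule card_sub_pos[OF fin subgroup_self])
  have "\<exists>a\<in>carrier G. a \<notin> B \<and> (\<forall>C\<in>set (U # V # map fst hs). a \<notin> C)"
  proof (rule exists_off_hyperplane[OF B])
    show "subgroup C G" if "C \<in> set (U # V # map fst hs)" for C
    proof -
      have "subgroup (fst h) G" if h: "h \<in> set hs" for h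
        using bspec[OF holes(1) h] over_frattini_subgroup by (auto simp: hole_def split: prod.splits)
      then show ?thesis using that U(1) V(1) by auto
    qed
    show "sum_list (map card (U # V # map fst hs)) < ?c"
      using three[OF U] three[OF V] s c0 by (simp add: comp_def)
  qed
  then show ?thesis by fastforce
qed

end

context p_quot begin

lemma image_inter:
  assumes E: "subgroup E G" and R: "subgroup R G" "A \<subseteq> R"
  shows "\<pi> ` E \<inter> \<pi> ` R = \<pi> ` (E \<inter> R)"
proof
  show "\<pi> ` E \<inter> \<pi> ` R \<subseteq> \<pi> ` (E \<inter> R)"
  proof
    fix y assume "y \<in> \<pi> ` E \<inter> \<pi> ` R"
    then obtain x where x: "x \<in> E" "y = \<pi> x" "\<pi> x \<in> \<pi> ` R" by auto
    then have "x \<in> R" using mem_image_iff[OF R subgroup.mem_carrier[OF E x(1)]] by simp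
    then show "y \<in> \<pi> ` (E \<inter> R)" using x(1,2) by simp
  qed
qed auto

lemma hole_image:
  assumes "hole p G E n" "A \<subseteq> E" shows "hole p Q (\<pi> ` E) n"
proof -
  have E: "over_frattini p G E" using assms by (simp add: hole_def)
  have "(p ^ n * card (\<pi> ` E)) * card A = p ^ n * card E"
    using card_image[OF over_frattini_subgroup[OF E] assms(2)] by simp
  also have "\<dots> \<le> card (carrier Q) * card A" using assms(1) card_Q by (simp add: hole_def)
  finally show ?thesis using over_frattini_image[OF E] card_A_pos by (simp add: hole_def)
qed

end

text \<open>The hypothesis of the induction, at a group that may carry \<open>N\<close> holes. Since a new hole is paid for by
  a smaller group, the induction is on the sum of the order and the number of holes.\<close>
locale inductive_bound = p_grp G p for G :: "'a monoid" (structure) and p +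
  fixes N :: nat
  assumes p3: "2 < p"
    and IH: "\<And>(G' :: 'a monoid) k' H' K' hs'. p_grp G' p \<Longrightarrow> covered p k' G' H' K' hs' \<Longrightarrow>
      card (carrier G') + length hs' < card (carrier G) + N \<Longrightarrow>
      card (derived G' (carrier G')) \<le> p ^ (triangular k' + excess k' 1 (map snd hs'))"
begin

text \<open>The first reduction: factor out \<open>A\<close> and apply the induction hypothesis.\<close>
lemma quotient_bound:
  assumes A: "A \<lhd> G" "1 < card A" and len: "length hs' \<le> Suc N"
    and H': "hyperplane p G H'" "A \<subseteq> H'" and K': "hyperplane p G K'" "A \<subseteq> K'"
    and hs': "\<And>E n. (E, n) \<in> set hs' \<Longrightarrow> hole p G E n \<and> A \<subseteq> E" "spread 1 (map snd hs')"
    and b: "\<And>x. x \<in> carrier G \<Longrightarrow> x \<notin> H' \<Longrightarrow> x \<notin> K' \<Longrightarrow> (\<And>E n. (E, n) \<in> set hs' \<Longrightarrow> x \<notin> E) \<Longrightarrow>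
      card (carrier G) \<le> p ^ j * card (centralizer_mod G A x)"
  shows "card (derived G (carrier G)) \<le> card A * p ^ (triangular j + excess j 1 (map snd hs'))"
proof -
  obtain Q :: "'a monoid" and \<pi> where pq: "p_quot G p Q \<pi> A" using obtain_quotient[OF A(1)] .
  interpret p_quot G p Q \<pi> A by (rule pq)
  let ?hs = "map (\<lambda>(E, n). (\<pi> ` E, n)) hs'"
  have snd: "map snd ?hs = map snd hs'" by (induction hs') auto
  have "covered p j Q (\<pi> ` H') (\<pi> ` K') ?hs"
    unfolding covered_def snd
  proof (intro conjI hyperplane_image H' K' hs'(2) ballI impI)
    show "case h of (E, n) \<Rightarrow> hole p Q E n" if h: "h \<in> set ?hs" for h
      using h hs'(1) hole_image by auto
    fix y assume y: "y \<in> carrier Q" "y \<notin> \<pi> ` H'" "y \<notin> \<pi> ` K'" "\<forall>(E, n)\<in>set ?hs. y \<notin> E"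
    obtain x where x: "x \<in> carrier G" "y = \<pi> x" using y(1) pi_surj by blast
    have "card (carrier G) \<le> p ^ j * card (centralizer_mod G A x)"
    proof (rule b[OF x(1)])
      show "x \<notin> H'" "x \<notin> K'" using y x by auto
      show "x \<notin> E" if "(E, n) \<in> set hs'" for E n using y(4) x that by fastforce
    qed
    then show "breadth_le p j Q y" using breadth_le_image[OF x(1)] x by simp
  qed
  moreover have "card (carrier Q) + length ?hs < card (carrier G) + N"
  proof -
    have "p * card {\<one>} \<le> card A"
      by (rule p_mult_card_le[OF triv_subgroup A.is_subgroup]) (use A(2) in simp)
    then have "3 \<le> card A" using p3 by simp
    then have "card (carrier Q) * 3 \<le> card (carrier G)" using card_Q by (metis mult_le_mono2)
    moreover have "0 < card (carrier Q)" by (rule Q.card_sub_pos[OF Q.fin Q.subgroup_self])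
    ultimately show ?thesis using len by simp
  qed
  ultimately have "card (derived Q (carrier Q)) \<le> p ^ (triangular j + excess j 1 (map snd ?hs))"
    using IH[OF Q.p_grp_axioms] by blast
  then have "card A * card (derived Q (carrier Q)) \<le> card A * p ^ (triangular j + excess j 1 (map snd hs'))"
    unfolding snd by (rule mult_le_mono2)
  then show ?thesis using card_derived_le by (rule order_trans[rotated])
qed

text \<open>Both reductions together: factor out \<open>A\<close>, pass to the hyperplane \<open>R\<close> at the expense of the breadth of
  \<open>a\<close>, and apply the induction hypothesis to \<open>R\<close> modulo \<open>A\<close>.\<close>
lemma section_bound:
  assumes A: "A \<lhd> G" and len: "length hs' \<le> N"
    and R: "hyperplane p G R" "A \<subseteq> R"
    and H': "hyperplane p G H'" "A \<subseteq> H'" "H' \<noteq> R" and K': "hyperplane p G K'" "A \<subseteq> K'" "K' \<noteq> R"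
    and hs': "\<And>E n. (E, n) \<in> set hs' \<Longrightarrow> over_frattini p G E \<and> A \<subseteq> E \<and> p ^ n * card (E \<inter> R) \<le> card R"
      "spread 1 (map snd hs')"
    and b: "\<And>x. x \<in> R \<Longrightarrow> x \<notin> H' \<Longrightarrow> x \<notin> K' \<Longrightarrow> (\<And>E n. (E, n) \<in> set hs' \<Longrightarrow> x \<notin> E) \<Longrightarrow>
      card R \<le> p ^ j * card (centralizer_mod G A x \<inter> R)"
    and a: "a \<in> carrier G" "a \<notin> R" "card (carrier G) \<le> p ^ m * card (centralizer_mod G A a)"
  shows "card (derived G (carrier G)) \<le> card A * (p ^ m * p ^ (triangular j + excess j 1 (map snd hs')))"
proof -
  obtain Q :: "'a monoid" and \<pi> where pq: "p_quot G p Q \<pi> A" using obtain_quotient[OF A(1)] .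
  interpret p_quot G p Q \<pi> A by (rule pq)
  have sR: "subgroup R G" by (rule hyperplane_subgroup[OF R(1)])
  have RG: "R \<subseteq> carrier G" by (rule subgroup.subset[OF sR])
  let ?R = "\<pi> ` R"
  have hR: "hyperplane p Q ?R" by (rule hyperplane_image[OF R])
  have sQR: "subgroup ?R Q" by (rule subgroup_image[OF sR])
  interpret S: p_grp "Q\<lparr>carrier := ?R\<rparr>" p by (rule Q.p_grp_subgroup[OF sQR])
  let ?S = "Q\<lparr>carrier := ?R\<rparr>" and ?hs = "map (\<lambda>(E, n). (\<pi> ` E \<inter> ?R, n)) hs'"
  have snd: "map snd ?hs = map snd hs'" by (induction hs') auto
  have ne: "\<pi> ` U \<noteq> ?R" if "hyperplane p G U" "A \<subseteq> U" "U \<noteq> R" for U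
    using image_subset_imp_subset[OF hyperplane_subgroup[OF that(1)] sR R(2)] hyperplane_not_subset[OF that(1) R(1) that(3)]
    by blast
  have cS: "covered p j ?S (\<pi> ` H' \<inter> ?R) (\<pi> ` K' \<inter> ?R) ?hs"
    unfolding covered_def snd
  proof (intro conjI Q.hyperplane_restrict[OF hyperplane_image hR ne] H' K' hs'(2) ballI impI)
    show "case h of (E, n) \<Rightarrow> hole p ?S E n" if h: "h \<in> set ?hs" for h
    proof -
      obtain E n where E: "(E, n) \<in> set hs'" "h = (\<pi> ` E \<inter> ?R, n)" using h by auto
      have f: "over_frattini p G E" "A \<subseteq> E" "p ^ n * card (E \<inter> R) \<le> card R" using hs'(1)[OF E(1)] by auto
      have sE: "subgroup E G" by (rule over_frattini_subgroup[OF f(1)])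
      have "\<pi> ` E \<inter> ?R = \<pi> ` (E \<inter> R)" by (rule image_inter[OF sE sR R(2)])
      then have "card (\<pi> ` E \<inter> ?R) * card A = card (E \<inter> R)"
        using card_image[OF subgroups_Inter_pair[OF sE sR]] f(2) R(2) by simp
      then have "(p ^ n * card (\<pi> ` E \<inter> ?R)) * card A \<le> card ?R * card A"
        using f(3) card_image[OF sR R(2)] by (simp add: mult.assoc)
      then have "p ^ n * card (\<pi> ` E \<inter> ?R) \<le> card ?R" using card_A_pos by simp
      moreover have "over_frattini p ?S (\<pi> ` E \<inter> ?R)"
        by (rule Q.over_frattini_restrict[OF over_frattini_image[OF f(1)] sQR])
      ultimately show ?thesis using E(2) by (simp add: hole_def)
    qed
    fix y assume y: "y \<in> carrier ?S" "y \<notin> \<pi> ` H' \<inter> ?R" "y \<notin> \<pi> ` K' \<inter> ?R" "\<forall>(E, n)\<in>set ?hs. y \<notin> E"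
    obtain x where x: "x \<in> R" "y = \<pi> x" using y(1) by auto
    have xc: "x \<in> carrier G" using x RG by blast
    let ?D = "centralizer_mod G A x"
    have sD: "subgroup ?D G" by (rule subgroup_centralizer_mod[OF A xc])
    have b': "card R \<le> p ^ j * card (?D \<inter> R)"
    proof (rule b[OF x(1)])
      show "x \<notin> H'" "x \<notin> K'" using y x by auto
      show "x \<notin> E" if "(E, n) \<in> set hs'" for E n using y(1,4) x that by fastforce
    qed
    have yR: "y \<in> ?R" using y(1) by simp
    have "centralizer ?S y = centralizer Q y \<inter> ?R" by (rule Q.centralizer_restrict[OF sQR yR])
    also have "\<dots> = \<pi> ` ?D \<inter> ?R" using centralizer_image[OF xc] x(2) by simp
    also have "\<dots> = \<pi> ` (?D \<inter> R)" by (rule image_inter[OF sD sR R(2)])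
    finally have "card (centralizer ?S y) * card A = card (?D \<inter> R)"
      using card_image[OF subgroups_Inter_pair[OF sD sR]] A_subset_centralizer_mod[OF xc] R(2) by simp
    then have "card ?R * card A \<le> (p ^ j * card (centralizer ?S y)) * card A"
      using b' card_image[OF sR R(2)] by (simp add: mult.assoc)
    then show "breadth_le p j ?S y" using card_A_pos by (simp add: breadth_le_def)
  qed
  have lt: "card (carrier ?S) + length ?hs < card (carrier G) + N"
  proof -
    have "card ?R \<le> card R" by (rule card_image_le[OF finite_sub[OF fin sR]])
    then show ?thesis using hyperplane_psubset[OF R(1)] len by simp
  qed
  have "derived ?S (carrier ?S) = derived Q ?R" using Q.derived_consistent[OF _ sQR] by simp
  then have dR: "card (derived Q ?R) \<le> p ^ (triangular j + excess j 1 (map snd hs'))"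
    using IH[OF S.p_grp_axioms cS lt] unfolding snd by (simp only:)
  have "\<pi> a \<notin> ?R" using mem_image_iff[OF sR R(2) a(1)] a(2) by blast
  then have "card (derived Q (carrier Q)) \<le> p ^ m * card (derived Q ?R)"
    by (intro Q.card_derived_le_hyperplane[OF hR]) (use a breadth_le_image[OF a(1)] in auto)
  also have "\<dots> \<le> p ^ m * p ^ (triangular j + excess j 1 (map snd hs'))" using dR by (rule mult_le_mono2)
  finally have "card A * card (derived Q (carrier Q)) \<le> card A * (p ^ m * p ^ (triangular j + excess j 1 (map snd hs')))"
    by (rule mult_le_mono2)
  then show ?thesis using card_derived_le by (rule order_trans[rotated])
qed

end

locale covered_step = inductive_bound G p "length hs"
  for G :: "'a monoid" (structure) and p and k :: nat and H K :: "'a set" and hs :: "('a set \<times> nat) list" +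
  assumes cov: "covered p k G H K hs"
begin

abbreviation "ns \<equiv> map snd hs"

lemma H: "hyperplane p G H" and K: "hyperplane p G K"
  and holes: "\<forall>(E, n)\<in>set hs. hole p G E n" and spr: "spread 1 ns"
  and good: "x \<in> carrier G \<Longrightarrow> x \<notin> H \<Longrightarrow> x \<notin> K \<Longrightarrow> \<forall>(E, n)\<in>set hs. x \<notin> E \<Longrightarrow> breadth_le p k G x"
  using cov by (auto simp: covered_def)

end

section \<open>Holes of small index\<close>

lemma not_spread_Suc:
  "spread i ns \<Longrightarrow> \<not> spread (Suc i) ns \<Longrightarrow> \<exists>us n vs. ns = us @ n # vs \<and> n = i + length us \<and> 2 \<le> n"
proof (induction ns arbitrary: i)
  case (Cons n ns)
  have sp: "max 2 i \<le> n" "spread (Suc i) ns" using Cons.prems(1) by (simp_all only: spread.simps)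
  show ?case
  proof (cases "max 2 (Suc i) \<le> n")
    case True
    then have "\<not> spread (Suc (Suc i)) ns" using Cons.prems(2) by (simp only: spread.simps) simp
    then obtain us m vs where "ns = us @ m # vs" "m = Suc i + length us" "2 \<le> m"
      using Cons.IH[OF sp(2)] by blast
    then have "n # ns = (n # us) @ m # vs \<and> m = i + length (n # us) \<and> 2 \<le> m" by simp
    then show ?thesis by blast
  next
    case False
    then have "n # ns = [] @ n # ns \<and> n = i + length [] \<and> 2 \<le> n" using sp(1) by auto
    then show ?thesis by blast
  qed
qed simp

context p_grp begin

lemma hole_inter:
  assumes h: "hole p G E n" and R: "hyperplane p G R"
  shows "0 < n \<Longrightarrow> p ^ (n - 1) * card (E \<inter> R) \<le> card R"
    and "\<not> E \<subseteq> R \<Longrightarrow> p ^ n * card (E \<inter> R) \<le> card R"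
proof -
  have sE: "subgroup E G" using h by (auto simp: hole_def dest: over_frattini_subgroup)
  have le: "p ^ n * card E \<le> p * card R" using h hyperplane_card[OF R] by (simp add: hole_def)
  show "p ^ (n - 1) * card (E \<inter> R) \<le> card R" if n: "0 < n"
  proof -
    have "card (E \<inter> R) \<le> card E" by (rule card_mono[OF finite_sub[OF fin sE]]) simp
    then have "p ^ n * card (E \<inter> R) \<le> p ^ n * card E" by (rule mult_le_mono2)
    also note le
    finally have "p ^ n * card (E \<inter> R) \<le> p * card R" .
    moreover have "p ^ n = p * p ^ (n - 1)" using n by (cases n) simp_all
    ultimately show ?thesis using p_gt_1 by simp
  qed
  show "p ^ n * card (E \<inter> R) \<le> card R" if "\<not> E \<subseteq> R"
  proof -
    have "p * (p ^ n * card (E \<inter> R)) = p ^ n * (p * card (E \<inter> R))" by (simp add: ac_simps)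
    also have "\<dots> = p ^ n * card E" using card_inter_hyperplane[OF R sE that] by (simp only:)
    also note le
    finally show ?thesis using p_gt_1 by simp
  qed
qed

lemma hyperplane_ne_carrier: "hyperplane p G R \<Longrightarrow> R \<noteq> carrier G"
  using hyperplane_psubset by blast

lemma centralizer_mod_triv: "x \<in> carrier G \<Longrightarrow> centralizer_mod G {\<one>} x = centralizer G x"
  using centralizer_iff_cmt[of x] by (auto simp: centralizer_mod_def)

end

context covered_step begin

abbreviation "dexp \<equiv> triangular k + excess k 1 ns"

lemma card_le_dexp: "c \<le> p ^ m \<Longrightarrow> m \<le> dexp \<Longrightarrow> c \<le> p ^ dexp"
  using order_trans[OF _ power_increasing[of m dexp p]] p_gt_1 by (simp only: One_nat_def Suc_leI)

text \<open>When a hole is forgotten, the later ones move up by one place, which does not raise their price.\<close>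
lemma drop_hole:
  assumes E: "(E, n) \<in> set hs" "E \<subseteq> H \<or> E \<subseteq> K"
  shows "card (derived G (carrier G)) \<le> p ^ dexp"
proof -
  obtain us vs where hs: "hs = us @ (E, n) # vs" using split_list[OF E(1)] by blast
  have sp: "spread 1 (map snd us)" "spread (Suc (Suc (length us))) (map snd vs)"
    using spr unfolding hs by (auto simp: spread_append)
  have "spread (Suc (length us)) (map snd vs)" by (rule spread_mono[OF sp(2)]) simp
  then have "spread 1 (map snd (us @ vs))" using sp(1) by (simp add: spread_append)
  moreover have "breadth_le p k G x" if x: "x \<in> carrier G" "x \<notin> H" "x \<notin> K" "\<forall>(E, n)\<in>set (us @ vs). x \<notin> E" for x
    by (rule good[OF x(1-3)]) (use x E hs in auto)
  ultimately have cov': "covered p k G H K (us @ vs)"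
    unfolding covered_def using H K holes hs by (auto simp: Ball_def)
  then have "card (derived G (carrier G)) \<le> p ^ (triangular k + excess k 1 (map snd (us @ vs)))"
    by (rule IH[OF p_grp_axioms]) (simp add: hs)
  moreover have "excess k 1 (map snd (us @ vs)) \<le> excess k 1 ns"
    unfolding hs using excess_mono[of k k "Suc (length us)" "Suc (Suc (length us))" "map snd vs"]
    by (simp add: excess_append)
  ultimately show ?thesis using card_le_dexp by simp
qed

text \<open>If the \<open>j\<close>-th hole has an index of only \<open>p ^ j\<close>, it is traded for a factor of \<open>p ^ k\<close>: one passes to a
  hyperplane that meets this hole within \<open>H\<close> but contains none of the earlier holes. In the list of the
  remaining ones, the later holes move up by one place, which makes up for the dimension that they lose.\<close>
lemma remove_hole:
  assumes nosub: "\<And>E n. (E, n) \<in> set hs \<Longrightarrow> \<not> E \<subseteq> H" and nsp: "\<not> spread 2 ns"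
  shows "card (derived G (carrier G)) \<le> p ^ dexp"
proof -
  obtain ms j ls where ns: "ns = ms @ j # ls" "j = 1 + length ms" "2 \<le> j"
    using not_spread_Suc[OF spr] nsp by (auto simp: numeral_2_eq_2)
  obtain us h vs where hs: "hs = us @ h # vs" "map snd us = ms" "snd h = j" "map snd vs = ls"
    using ns(1) by (auto simp: map_eq_append_conv map_eq_Cons_conv)
  obtain E where h: "h = (E, j)" using hs(3) by (cases h) auto
  have hE: "hole p G E j" using holes hs(1) h by auto
  \<comment> \<open>Elements that keep the earlier holes out of \<open>T\<close>: there are \<open>j - 1\<close> of them, so that one hyperplane
    \<open>M\<close> contains them all and \<open>E\<close> as well. As \<open>j \<ge> 2\<close>, it is different from \<open>H\<close>.\<close>
  let ?e = "\<lambda>h. SOME e. e \<in> fst h - H"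
  have e: "?e u \<in> fst u - H" if "u \<in> set us" for u
  proof (rule someI_ex)
    have "\<not> fst u \<subseteq> H" using nosub[of "fst u" "snd u"] that hs(1) by simp
    then show "\<exists>e. e \<in> fst u - H" by blast
  qed
  have sub: "over_frattini p G (fst u)" if "u \<in> set hs" for u
    using holes that by (auto simp: hole_def)
  have len: "length (map ?e us) = length ms" using hs(2) by auto
  have "\<exists>M. hyperplane p G M \<and> E \<subseteq> M \<and> set (map ?e us) \<subseteq> M"
  proof (rule exists_hyperplane_with)
    show "over_frattini p G E" using hE by (simp add: hole_def)
    show "p ^ Suc (length (map ?e us)) * card E \<le> card (carrier G)"
      unfolding len using hE ns(2) by (simp add: hole_def)
    show "set (map ?e us) \<subseteq> carrier G"
    proof
      fix y assume "y \<in> set (map ?e us)"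
      then obtain u where u: "u \<in> set us" "y = ?e u" by auto
      have y: "y \<in> fst u" using e[OF u(1)] u(2) by blast
      show "y \<in> carrier G"
        by (rule subgroup.mem_carrier[OF over_frattini_subgroup[OF sub] y]) (use u hs(1) in simp)
    qed
  qed
  then obtain M where M: "hyperplane p G M" "E \<subseteq> M" "\<And>u. u \<in> set us \<Longrightarrow> ?e u \<in> M" by auto
  have MH: "H \<noteq> M"
  proof -
    have "us \<noteq> []" using ns(2,3) hs(2) by auto
    then obtain u where "u \<in> set us" by (meson ex_in_conv set_empty)
    then show ?thesis using e M(3) by blast
  qed
  obtain R S where RS: "hyperplane p G R" "hyperplane p G S" "R \<noteq> H" "S \<noteq> H" "R \<noteq> S"
    "R \<inter> M = H \<inter> M" "S \<inter> M = H \<inter> M" using obtain_pencil[OF p3 H M(1) MH] by metis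
  obtain T where T: "hyperplane p G T" "T \<noteq> H" "T \<inter> M = H \<inter> M" "T \<noteq> K"
    using RS by (cases "R = K") auto
  have sT: "subgroup T G" by (rule hyperplane_subgroup[OF T(1)])
  let ?vs = "map (\<lambda>(E, n). (E, n - 1)) vs"
  have sndv: "map snd ?vs = map (\<lambda>n. n - 1) ls" using hs(4) by (induction vs arbitrary: ls) auto
  have splitsp: "spread 1 ms" "spread (Suc j) ls" using spr ns(1,2) by (auto simp: spread_append)
  obtain a where a: "a \<in> carrier G" "a \<notin> H" "a \<notin> K" "a \<notin> T" "\<forall>(E, n)\<in>set hs. a \<notin> E"
    using exists_off_holes[OF p3 holes spr H hyperplane_subgroup[OF K] hyperplane_ne_carrier[OF K]
        sT hyperplane_ne_carrier[OF T(1)]] by blast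
  have "card (derived G (carrier G)) \<le> card {\<one>} * (p ^ k * p ^ (triangular k + excess k 1 (map snd (us @ ?vs))))"
  proof (rule section_bound[OF one_is_normal _ T(1) _ H])
    show "length (us @ ?vs) \<le> length hs" using hs(1) by simp
    have one: "{\<one>} \<subseteq> U" if "subgroup U G" for U using subgroup.one_closed[OF that] by simp
    show "{\<one>} \<subseteq> T" "{\<one>} \<subseteq> H" "{\<one>} \<subseteq> K" using sT hyperplane_subgroup[OF H] hyperplane_subgroup[OF K] one by auto
    show "H \<noteq> T" "hyperplane p G K" "K \<noteq> T" using T K by auto
    show "spread 1 (map snd (us @ ?vs))"
      using splitsp ns spread_pred[OF splitsp(2) ns(3)] hs(2) sndv by (simp add: spread_append)
    show "over_frattini p G E' \<and> {\<one>} \<subseteq> E' \<and> p ^ n * card (E' \<inter> T) \<le> card T"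
      if E': "(E', n) \<in> set (us @ ?vs)" for E' n
    proof -
      consider "(E', n) \<in> set us" | m where "(E', m) \<in> set vs" "n = m - 1" using E' by auto
      then show ?thesis
      proof cases
        case 1
        then have h: "hole p G E' n" using holes hs(1) by auto
        have "?e (E', n) \<in> E' - H" "?e (E', n) \<in> M" using e[OF 1] M(3)[OF 1] by auto
        then have "\<not> E' \<subseteq> T" using T(3) by blast
        then show ?thesis using h hole_inter(2)[OF h T(1)] one by (auto simp: hole_def dest: over_frattini_subgroup)
      next
        case 2
        then have h: "hole p G E' m" using holes hs(1) by auto
        have "m \<in> set ns" using 2 hs(1) by force
        then have "0 < m" using spread_ge_2[OF spr] by fastforce
        then show ?thesis using h 2 hole_inter(1)[OF h T(1)] one by (auto simp: hole_def dest: over_frattini_subgroup)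
      qed
    qed
    fix x assume x: "x \<in> T" "x \<notin> H" "x \<notin> K" "\<And>E n. (E, n) \<in> set (us @ ?vs) \<Longrightarrow> x \<notin> E"
    have xc: "x \<in> carrier G" by (rule subgroup.mem_carrier[OF sT x(1)])
    have "x \<notin> E" using x(1,2) T(3) M(2) by blast
    moreover have "x \<notin> E'" if "(E', n) \<in> set us" for E' n using x(4)[of E' n] that by simp
    moreover have "x \<notin> E'" if "(E', n) \<in> set vs" for E' n using x(4)[of E' "n - 1"] that by force
    ultimately have "breadth_le p k G x" using hs(1) h by (intro good[OF xc x(2,3)]) auto
    then show "card T \<le> p ^ k * card (centralizer_mod G {\<one>} x \<inter> T)"
      unfolding centralizer_mod_triv[OF xc] breadth_le_def
      by (rule card_restrict_le[OF subgroup_centralizer[OF xc] sT])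
  next
    show "a \<in> carrier G" "a \<notin> T" using a by auto
    show "card (carrier G) \<le> p ^ k * card (centralizer_mod G {\<one>} a)"
      using good[OF a(1-3,5)] unfolding centralizer_mod_triv[OF a(1)] breadth_le_def .
  qed
  then have main: "card (derived G (carrier G)) \<le> p ^ (k + (triangular k + excess k 1 (map snd (us @ ?vs))))"
    by (simp only: card.insert card.empty power_add) simp
  have "k + excess k 1 (map snd (us @ ?vs)) = excess k 1 ns"
  proof -
    have "excess k j (map (\<lambda>n. n - 1) ls) = excess k (Suc j) ls"
      unfolding excess_shift by (rule excess_pred) (use spread_ge_2[OF splitsp(2)] in fastforce)
    then show ?thesis using hs(2) sndv ns by (simp add: excess_append)
  qed
  then have "k + (triangular k + excess k 1 (map snd (us @ ?vs))) \<le> dexp" by linarith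
  then show ?thesis by (rule card_le_dexp[OF main])
qed

end

section \<open>Groups of class two\<close>

context second_central begin

lemma pow_mem_centralizer: "z [^] (t::nat) \<in> centralizer G z"
proof -
  have "z \<in> centralizer G z" using z by (simp add: centralizer_def)
  then show ?thesis by (rule subgroup_nat_pow[OF subgroup_F])
qed

lemma centralizer_mod_mult_pow:
  assumes x: "x \<in> carrier G"
  shows "centralizer_mod G cmt_range (x \<otimes> z [^] (t::nat)) = centralizer_mod G cmt_range x"
proof -
  have "cmt G (x \<otimes> z [^] t) g \<in> cmt_range \<longleftrightarrow> cmt G x g \<in> cmt_range" if g: "g \<in> carrier G" for g
  proof -
    let ?u = "cmt G (z [^] t) g" and ?c = "cmt G x g"
    have u: "?u = cmt G z (g [^] t)" using cmt_pow_left[OF g] cmt_pow[OF g] by simp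
    have uA: "?u \<in> cmt_range" unfolding u by (rule cmt_mem_range) (use g in simp)
    have uZ: "?u \<in> centre G" using uA cmt_range_subset_centre by blast
    have uc: "?u \<in> carrier G" and cc: "?c \<in> carrier G" using g x z by auto
    have e: "cmt G (x \<otimes> z [^] t) g = ?u \<otimes> ?c"
      using cmt_mult_left[OF x _ g, of "z [^] t"] conj_centre[OF uZ x] z by simp
    show ?thesis
    proof
      assume "cmt G (x \<otimes> z [^] t) g \<in> cmt_range"
      then have "inv ?u \<otimes> (?u \<otimes> ?c) \<in> cmt_range"
        unfolding e using subgroup.m_closed[OF subgroup_cmt_range subgroup.m_inv_closed[OF subgroup_cmt_range uA]] by blast
      then show "?c \<in> cmt_range" using inv_cancel_left[OF uc cc] by (simp only:)
    next
      assume "?c \<in> cmt_range"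
      then show "cmt G (x \<otimes> z [^] t) g \<in> cmt_range"
        unfolding e by (rule subgroup.m_closed[OF subgroup_cmt_range uA])
    qed
  qed
  then show ?thesis unfolding centralizer_mod_def by blast
qed

lemma cmt_range_subset: "over_frattini p G E \<Longrightarrow> cmt_range \<subseteq> E"
  unfolding cmt_range_def using over_frattini_cmt z by auto

lemma card_range_gt_1: "z \<notin> centre G \<Longrightarrow> 1 < card cmt_range"
proof (rule ccontr)
  assume n: "z \<notin> centre G" and "\<not> 1 < card cmt_range"
  then have "card (carrier G) \<le> card (centralizer G z)"
    using card_range by (metis mult_le_mono1 nat_mult_1 not_less)
  then have "centralizer G z = carrier G" using card_seteq[OF fin subgroup.subset[OF subgroup_F]] by simp
  then show False using mem_centre_iff_centralizer[OF z] n by simp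
qed

lemma centralizer_ne_carrier: "z \<notin> centre G \<Longrightarrow> centralizer G z \<noteq> carrier G"
  using mem_centre_iff_centralizer[OF z] by blast

end

context p_grp begin

text \<open>As \<open>p\<close> is odd, a coset of \<open>\<langle>z\<rangle>\<close> has at most one of its elements \<open>x\<close>, \<open>xz\<close>, \<open>xz\<^sup>2\<close> in a
  hyperplane not containing \<open>z\<close>; hence one of the three avoids two such hyperplanes.\<close>
lemma translate_at_most_one:
  assumes p3: "2 < p" and H: "hyperplane p G H" and z: "z \<in> carrier G" "z \<notin> H" and x: "x \<in> carrier G"
    and ij: "i < j" "j \<le> 2" "x \<otimes> z [^] i \<in> H" "x \<otimes> z [^] (j::nat) \<in> H"
  shows False
proof -
  have sH: "subgroup H G" by (rule hyperplane_subgroup[OF H])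
  have "x \<otimes> z [^] j = (x \<otimes> z [^] i) \<otimes> z [^] (j - i)"
    using x z ij(1) by (simp add: m_assoc nat_pow_mult)
  then have "z [^] (j - i) = inv (x \<otimes> z [^] i) \<otimes> (x \<otimes> z [^] j)" using x z by (simp add: inv_cancel_left)
  then have d: "z [^] (j - i) \<in> H"
    using ij(3,4) by (simp only: subgroup.m_closed[OF sH subgroup.m_inv_closed[OF sH]])
  have "j - i = 1 \<or> j - i = 2" using ij(1,2) by linarith
  then show False
  proof
    assume "j - i = 1"
    then show False using d z by simp
  next
    assume "j - i = 2"
    then have z2: "z [^] (2::nat) \<in> H" using d by simp
    have pw: "(z [^] (2::nat)) [^] (m::nat) \<in> H" for m by (rule subgroup_nat_pow[OF sH z2])
    have "odd p" using prime_p p3 by (simp add: prime_odd_nat)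
    then obtain m where m: "p = 2 * m + 1" by (rule oddE)
    have "z [^] p = (z [^] (2::nat)) [^] m \<otimes> z" using z m by (simp add: nat_pow_pow)
    then have "z = inv ((z [^] (2::nat)) [^] m) \<otimes> z [^] p" using z by (simp add: inv_cancel_left)
    moreover have "inv ((z [^] (2::nat)) [^] m) \<otimes> z [^] p \<in> H"
      by (rule subgroup.m_closed[OF sH subgroup.m_inv_closed[OF sH pw] over_frattini_pow[OF hyperplane_over_frattini[OF H] z(1)]])
    ultimately show False using z by simp
  qed
qed

lemma exists_translate_off:
  assumes p3: "2 < p" and H: "hyperplane p G H" and K: "hyperplane p G K"
    and z: "z \<in> carrier G" "z \<notin> H" "z \<notin> K" and x: "x \<in> carrier G"
  shows "\<exists>t::nat. x \<otimes> z [^] t \<notin> H \<and> x \<otimes> z [^] t \<notin> K"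
proof (rule ccontr)
  assume "\<not> ?thesis"
  then have a: "x \<otimes> z [^] t \<in> H \<or> x \<otimes> z [^] t \<in> K" for t :: nat by blast
  note h = translate_at_most_one[OF p3 H z(1,2) x] and k = translate_at_most_one[OF p3 K z(1,3) x]
  show False
    using a[of 0] a[of 1] a[of 2] h[of 0 1] h[of 0 2] h[of 1 2] k[of 0 1] k[of 0 2] k[of 1 2] by auto
qed

lemma adjoin_hole:
  assumes h: "hole p G E n" and z: "z \<in> carrier G" "z \<notin> E" and n: "0 < n"
  shows "hole p G (adjoin G E z) (n - 1)"
proof -
  have f: "over_frattini p G E" using h by (simp add: hole_def)
  have "p ^ (n - 1) * card (adjoin G E z) = p ^ (n - 1) * p * card E"
    unfolding over_frattini_adjoin(2)[OF f z] by (rule mult.assoc[symmetric])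
  also have "p ^ (n - 1) * p = p ^ n" by (rule power_minus_mult[OF n])
  finally have "p ^ (n - 1) * card (adjoin G E z) \<le> card (carrier G)" using h by (simp only: hole_def)
  then show ?thesis using over_frattini_adjoin(1)[OF f z] by (simp only: hole_def)
qed

lemma mult_mem_adjoin:
  assumes f: "over_frattini p G E" and z: "z \<in> carrier G" and x: "x \<in> carrier G" and xz: "x \<otimes> z [^] (t::nat) \<in> E"
  shows "x \<in> adjoin G E z"
proof -
  have sA: "subgroup (adjoin G E z) G" by (rule subgroup_adjoin[OF fin over_frattini_normal[OF f] z])
  have zA: "z \<in> adjoin G E z" by (rule mem_adjoin[OF over_frattini_subgroup[OF f] z])
  have pw: "z [^] t \<in> adjoin G E z" by (rule subgroup_nat_pow[OF sA zA])
  have "x \<otimes> z [^] t \<in> adjoin G E z"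
    by (rule subsetD[OF subset_adjoin[OF subgroup.subset[OF over_frattini_subgroup[OF f]]] xz])
  then have "(x \<otimes> z [^] t) \<otimes> inv (z [^] t) \<in> adjoin G E z"
    by (rule subgroup.m_closed[OF sA _ subgroup.m_inv_closed[OF sA pw]])
  then show ?thesis using x z by (simp add: m_assoc)
qed

lemma hole_psubset:
  assumes "hole p G E n" "0 < n" shows "card E < card (carrier G)"
proof -
  have "0 < card E" using assms(1) card_sub_pos[OF fin] by (simp add: hole_def over_frattini_def)
  then have "1 * card E < p ^ n * card E" using p_gt_1 assms(2) by (intro mult_strict_right_mono one_less_power) auto
  moreover have "p ^ n * card E \<le> card (carrier G)" using assms(1) by (simp add: hole_def)
  ultimately show ?thesis by linarith
qed

end

context covered_step begin

lemma hole_mem: "(E, n) \<in> set hs \<Longrightarrow> hole p G E n"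
  and hole_frattini: "(E, n) \<in> set hs \<Longrightarrow> over_frattini p G E"
  using holes by (auto simp: hole_def)

lemma exists_good:
  assumes "subgroup U G" "U \<noteq> carrier G"
  shows "\<exists>a\<in>carrier G. a \<notin> H \<and> a \<notin> K \<and> a \<notin> U \<and> (\<forall>(E, n)\<in>set hs. a \<notin> E)"
  using exists_off_holes[OF p3 holes spr H hyperplane_subgroup[OF K] hyperplane_ne_carrier[OF K] assms] .

text \<open>If all commutators are central, one factors out the commutators of a good element \<open>z\<close>, which are
  at most \<open>p ^ k\<close> in number. The breadth of \<open>x\<close> modulo these depends on the coset of \<open>x\<close> modulo \<open>z\<close> only,
  and this coset has a good element unless it meets a hole.\<close>
lemma class_two:
  assumes cl: "derived G (carrier G) \<subseteq> centre G" and nab: "centre G \<noteq> carrier G" and sp: "spread 2 ns"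
  shows "card (derived G (carrier G)) \<le> p ^ dexp"
proof -
  obtain z where z: "z \<in> carrier G" "z \<notin> H" "z \<notin> K" "z \<notin> centre G" "\<forall>(E, n)\<in>set hs. z \<notin> E"
    using exists_good[OF subgroup_centre nab] by blast
  interpret z: second_central G p z
    using z(1) cl cmt_mem_derived[OF z(1)] by unfold_locales auto
  let ?A = z.cmt_range and ?F = "centralizer G z"
  have bz: "breadth_le p k G z" by (rule good[OF z(1-3,5)])
  obtain x0 where x0: "x0 \<in> carrier G" "x0 \<notin> H" "x0 \<notin> K" "x0 \<notin> ?F" "\<forall>(E, n)\<in>set hs. x0 \<notin> E"
    using exists_good[OF z.subgroup_F z.centralizer_ne_carrier[OF z(4)]] by blast
  have k: "0 < k" by (rule z.breadth_drop(1)[OF x0(1,4) good[OF x0(1-3,5)]])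
  have cA: "card ?A \<le> p ^ k"
  proof -
    have "card ?A * card ?F \<le> p ^ k * card ?F" using z.card_range bz by (simp add: breadth_le_def)
    then show ?thesis using card_sub_pos[OF fin z.subgroup_F] by simp
  qed
  \<comment> \<open>In the quotient, the roles of \<open>H\<close> and \<open>K\<close> are taken by \<open>F\<close> and by a hyperplane \<open>L\<close> above the first
    hole and \<open>z\<close>; the other holes are enlarged by \<open>z\<close>.\<close>
  obtain F where F: "hyperplane p G F" "?F \<subseteq> F"
    using exists_hyperplane_over_derived[OF z.subgroup_F z.cmt_mem_centralizer z.centralizer_ne_carrier[OF z(4)]] by blast
  have zE: "z \<notin> E" and nE: "2 \<le> n" if "(E, n) \<in> set hs" for E n
    using z(5) that spread_ge_2[OF spr, of n] by force+
  let ?hs = "map (\<lambda>(E, n). (adjoin G E z, n - 1)) (tl hs)"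
  have snd: "map snd ?hs = map (\<lambda>n. n - 1) (tl ns)" by (simp add: map_tl comp_def case_prod_beta)
  have adj: "hole p G (adjoin G E z) (n - 1)" if "(E, n) \<in> set hs" for E n
    by (rule adjoin_hole[OF hole_mem[OF that] z(1) zE[OF that]]) (use nE[OF that] in simp)
  have "\<exists>L. hyperplane p G L \<and> (\<forall>E n ts. hs = (E, n) # ts \<longrightarrow> adjoin G E z \<subseteq> L)"
  proof (cases hs)
    case Nil then show ?thesis using F by blast
  next
    case (Cons h ts)
    obtain E n where h: "h = (E, n)" by fastforce
    have m: "(E, n) \<in> set hs" using Cons h by simp
    have "\<exists>L. hyperplane p G L \<and> adjoin G E z \<subseteq> L"
      using exists_hyperplane[of "adjoin G E z"] hole_psubset[OF adj[OF m]] adj[OF m] nE[OF m]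
      by (simp add: hole_def)
    then show ?thesis using Cons h by auto
  qed
  then obtain L where L: "hyperplane p G L" "\<And>E n ts. hs = (E, n) # ts \<Longrightarrow> adjoin G E z \<subseteq> L" by blast
  have "card (derived G (carrier G)) \<le> card ?A * p ^ (triangular (k - 1) + excess (k - 1) 1 (map snd ?hs))"
  proof (rule quotient_bound[OF z.normal_cmt_range z.card_range_gt_1[OF z(4)] _ F(1) _ L(1)])
    show "length ?hs \<le> Suc (length hs)" by simp
    show "?A \<subseteq> F" "?A \<subseteq> L" using z.cmt_range_subset hyperplane_over_frattini F(1) L(1) by auto
    show "hole p G E n \<and> ?A \<subseteq> E" if E: "(E, n) \<in> set ?hs" for E n
    proof -
      obtain E' m where E': "(E', m) \<in> set (tl hs)" "E = adjoin G E' z" "n = m - 1" using E by auto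
      have "(E', m) \<in> set hs" using E'(1) by (cases hs) auto
      then have "hole p G E n" using adj E' by simp
      then show ?thesis using z.cmt_range_subset by (simp add: hole_def)
    qed
    show "spread 1 (map snd ?hs)"
      unfolding snd by (rule spread_mono[OF spread_tail[OF sp]]) simp
    fix x assume x: "x \<in> carrier G" "x \<notin> F" "x \<notin> L" "\<And>E n. (E, n) \<in> set ?hs \<Longrightarrow> x \<notin> E"
    obtain t :: nat where t: "x \<otimes> z [^] t \<notin> H" "x \<otimes> z [^] t \<notin> K"
      using exists_translate_off[OF p3 H K z(1-3) x(1)] by blast
    let ?y = "x \<otimes> z [^] t"
    have y: "?y \<in> carrier G" using x z by simp
    have "?y \<notin> E" if E: "(E, n) \<in> set hs" for E n
    proof
      assume yE: "?y \<in> E"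
      have xa: "x \<in> adjoin G E z" by (rule mult_mem_adjoin[OF hole_frattini[OF E] z(1) x(1) yE])
      show False
      proof (cases "(E, n) \<in> set (tl hs)")
        case True
        then have "(adjoin G E z, n - 1) \<in> set ?hs" by force
        then show False using x(4) xa by blast
      next
        case False
        then have "hs = (E, n) # tl hs" using E by (cases hs) auto
        then show False using L(2) xa x(3) by blast
      qed
    qed
    then have bry: "breadth_le p k G ?y" by (intro good[OF y t]) auto
    have "?y \<notin> ?F"
    proof
      assume "?y \<in> ?F"
      then have "?y \<otimes> inv (z [^] t) \<in> ?F"
        by (rule subgroup.m_closed[OF z.subgroup_F _ subgroup.m_inv_closed[OF z.subgroup_F z.pow_mem_centralizer]])
      then show False using x(1,2) z(1) F(2) by (simp add: m_assoc subset_iff)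
    qed
    from z.breadth_drop(2)[OF y this bry]
    show "card (carrier G) \<le> p ^ (k - 1) * card (centralizer_mod G ?A x)"
      using z.centralizer_mod_mult_pow[OF x(1)] by simp
  qed
  also have "\<dots> \<le> p ^ k * p ^ (triangular (k - 1) + excess (k - 1) 1 (map snd ?hs))"
    using cA by (rule mult_le_mono1)
  also have "\<dots> = p ^ (k + (triangular (k - 1) + excess (k - 1) 1 (map snd ?hs)))" by (simp add: power_add)
  finally have main: "card (derived G (carrier G)) \<le> p ^ (k + (triangular (k - 1) + excess (k - 1) 1 (map snd ?hs)))" .
  have "excess (k - 1) 1 (map snd ?hs) \<le> excess k 1 ns"
    unfolding snd using excess_tail[OF k sp, of 1] excess_mono[of k k 1 2 "tl ns"] by (cases ns) (simp_all add: numeral_2_eq_2)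
  moreover have "triangular k = k + triangular (k - 1)" using k by (cases k) simp_all
  ultimately show ?thesis using card_le_dexp[OF main] by simp
qed

end

section \<open>Groups of larger class\<close>

locale inductive_second = inductive_bound G p N + second_central G p z
  for G :: "'a monoid" (structure) and p N z
begin

abbreviation "A \<equiv> cmt_range"
abbreviation "F \<equiv> centralizer G z"

lemma A_hyper: "hyperplane p G U \<Longrightarrow> A \<subseteq> U"
  using cmt_range_subset hyperplane_over_frattini by blast

text \<open>If the centralizer \<open>F\<close> of \<open>z\<close> is a hyperplane outside the pencil of \<open>H\<close> and \<open>K\<close>, one passes to a
  further hyperplane \<open>T\<close> of the pencil of \<open>H\<close> and \<open>F\<close>: inside \<open>T\<close>, the exceptional set \<open>F\<close> is covered by
  \<open>H\<close>. Of the two hyperplanes available for \<open>T\<close>, one does not contain the first hole, which therefore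
  keeps its index, and the other one provides the element \<open>a\<close> of small breadth.\<close>
lemma off_pencil_bound:
  assumes H: "hyperplane p G H" and K: "hyperplane p G K" and F: "hyperplane p G F"
    and holes: "\<forall>(E, n)\<in>set hs. hole p G E n" and sp2: "spread 2 (map snd hs)"
    and nosub: "\<And>E n. (E, n) \<in> set hs \<Longrightarrow> \<not> E \<subseteq> H" and len: "length hs \<le> N"
    and ne: "H \<noteq> K" "F \<noteq> H" and J: "\<not> H \<inter> K \<subseteq> F"
    and drop: "\<And>x. x \<in> carrier G \<Longrightarrow> x \<notin> H \<Longrightarrow> x \<notin> K \<Longrightarrow> x \<notin> F \<Longrightarrow> (\<And>E n. (E, n) \<in> set hs \<Longrightarrow> x \<notin> E) \<Longrightarrow>
      card (carrier G) \<le> p ^ j * card (centralizer_mod G A x)"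
  shows "card (derived G (carrier G)) \<le>
    p ^ (1 + (j + (triangular j + excess j 1 (map snd (take 1 hs @ map (\<lambda>(E, n). (E, n - 1)) (tl hs))))))"
proof -
  have cA: "card A = p"
  proof -
    have "card A * card F = p * card F" using card_range hyperplane_card[OF F] by simp
    then show ?thesis using card_sub_pos[OF fin subgroup_F] by simp
  qed
  have spr: "spread 1 (map snd hs)" by (rule spread_mono[OF sp2]) simp
  have hole_mem: "hole p G E n" and hole_frattini: "over_frattini p G E" if "(E, n) \<in> set hs" for E n
    using holes that by (auto simp: hole_def)
  obtain R S where RS: "hyperplane p G R" "hyperplane p G S" "R \<noteq> H" "R \<noteq> F" "S \<noteq> H" "S \<noteq> F" "R \<noteq> S"
    "R \<inter> H = H \<inter> F" "R \<inter> F = H \<inter> F" "S \<inter> H = H \<inter> F" "S \<inter> F = H \<inter> F" "R \<inter> S = H \<inter> F"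
    by (rule obtain_pencil[OF p3 H F not_sym[OF ne(2)]])
  obtain T T' where T: "hyperplane p G T" "hyperplane p G T'" "T \<noteq> H" "T' \<noteq> H"
    "T \<inter> H = H \<inter> F" "T \<inter> F = H \<inter> F" "T' \<inter> H = H \<inter> F" "T' \<inter> F = H \<inter> F" "T \<inter> T' = H \<inter> F"
    and TE: "\<And>E n ts. hs = (E, n) # ts \<Longrightarrow> \<not> E \<subseteq> T"
  proof (cases "\<exists>E n ts. hs = (E, n) # ts \<and> E \<subseteq> R")
    case False
    then have "\<not> E \<subseteq> R" if "hs = (E, n) # ts" for E n ts using that by blast
    then show ?thesis by (rule that[OF RS(1,2,3,5,8-12)])
  next
    case True
    then obtain E n ts where E: "hs = (E, n) # ts" "E \<subseteq> R" by blast
    have SR: "S \<inter> R = H \<inter> F" using RS(12) by (simp only: Int_commute)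
    have "\<not> E \<subseteq> H" by (rule nosub[of E n]) (use E in simp)
    then have ES: "\<not> E \<subseteq> S" using E(2) SR by blast
    have "\<not> E' \<subseteq> S" if "hs = (E', n') # ts'" for E' n' ts' using that E(1) ES by simp
    then show ?thesis by (rule that[OF RS(2,1,5,3,10,11,8,9) SR])
  qed
  have KT: "K \<noteq> T" "K \<noteq> T'"
  proof -
    have "H \<inter> K \<noteq> H \<inter> F" using J by blast
    then show "K \<noteq> T" "K \<noteq> T'" using T(5,7) by (auto simp only: Int_commute)
  qed
  have sT: "subgroup T G" and sT': "subgroup T' G" using T(1,2) hyperplane_subgroup by auto
  have "\<exists>a\<in>T'. a \<notin> H \<and> a \<notin> K \<and> (\<forall>(E, n)\<in>set hs. a \<notin> E)"
  proof -
    let ?G' = "G\<lparr>carrier := T'\<rparr>"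
    interpret T': p_grp ?G' p by (rule p_grp_subgroup[OF sT'])
    let ?Cs = "(K \<inter> T') # map (\<lambda>h. fst h \<inter> T') hs"
    have hH: "hyperplane p ?G' (H \<inter> T')" by (rule hyperplane_restrict[OF H T(2)]) (use T(4) in simp)
    have sub: "subgroup C ?G'" if C: "C \<in> set ?Cs" for C
    proof -
      consider "C = K \<inter> T'" | h where "h \<in> set hs" "C = fst h \<inter> T'" using C by auto
      then have "\<exists>E. over_frattini p G E \<and> C = E \<inter> T'"
      proof cases
        case 1 then show ?thesis using hyperplane_over_frattini[OF K] by blast
      next
        case 2 then show ?thesis using hole_frattini[of "fst h" "snd h"] by auto
      qed
      then show ?thesis using over_frattini_restrict[OF _ sT'] over_frattini_subgroup by blast
    qed
    have "p * card (K \<inter> T') = card T'"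
      using hyperplane_card[OF hyperplane_restrict[OF K T(2) KT(2)]] by simp
    moreover have "3 * card (K \<inter> T') \<le> p * card (K \<inter> T')" using p3 by (intro mult_le_mono1) simp
    ultimately have 1: "3 * card (K \<inter> T') \<le> card T'" by simp
    have "p ^ 1 * (p - 1) * sum_list (map (card \<circ> fst) hs) \<le> card (carrier G)"
      by (rule sum_holes[OF holes]) (use sp2 in \<open>simp add: numeral_2_eq_2\<close>)
    then have "p * ((p - 1) * sum_list (map (card \<circ> fst) hs)) \<le> p * card T'"
      using hyperplane_card[OF T(2)] by (simp add: mult.assoc)
    then have "(p - 1) * sum_list (map (card \<circ> fst) hs) \<le> card T'" using p_gt_1 by simp
    moreover have "2 * sum_list (map (card \<circ> fst) hs) \<le> (p - 1) * sum_list (map (card \<circ> fst) hs)"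
      using p3 by (intro mult_le_mono1) simp
    moreover have "sum_list (map (\<lambda>h. card (fst h \<inter> T')) hs) \<le> sum_list (map (card \<circ> fst) hs)"
    proof (rule sum_list_mono)
      fix h assume h: "h \<in> set hs"
      have "subgroup (fst h) G" using hole_frattini[of "fst h" "snd h"] h over_frattini_subgroup by simp
      then show "card (fst h \<inter> T') \<le> (card \<circ> fst) h" using finite_sub[OF fin] by (simp add: card_mono)
    qed
    ultimately have 2: "2 * sum_list (map (\<lambda>h. card (fst h \<inter> T')) hs) \<le> card T'" by linarith
    have "0 < card T'" by (rule card_sub_pos[OF fin sT'])
    then have lt: "sum_list (map card ?Cs) < card (carrier ?G')" using 1 2 by (simp add: comp_def)
    obtain a where a: "a \<in> T'" "a \<notin> H \<inter> T'" "\<forall>C\<in>set ?Cs. a \<notin> C"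
      using T'.exists_off_hyperplane[OF hH sub lt] by auto
    have "\<forall>(E, n)\<in>set hs. a \<notin> E" using a(1,3) by fastforce
    then show ?thesis using a by auto
  qed
  then obtain a where a: "a \<in> T'" "a \<notin> H" "a \<notin> K" "\<forall>(E, n)\<in>set hs. a \<notin> E" by blast
  have ac: "a \<in> carrier G" by (rule subgroup.mem_carrier[OF sT' a(1)])
  have aF: "a \<notin> F" and aT: "a \<notin> T" using a(1,2) T(8,9) by auto
  let ?hs = "take 1 hs @ map (\<lambda>(E, n). (E, n - 1)) (tl hs)"
  have snd: "map snd ?hs = take 1 (map snd hs) @ map (\<lambda>n. n - 1) (tl (map snd hs))"
    by (simp add: map_tl comp_def case_prod_beta take_map)
  have "card (derived G (carrier G)) \<le>
    card A * (p ^ j * p ^ (triangular j + excess j 1 (map snd ?hs)))"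
  proof (rule section_bound[OF normal_cmt_range _ T(1) A_hyper[OF T(1)] H A_hyper[OF H] _ K A_hyper[OF K] KT(1) _ _ _ ac aT])
    show "length ?hs \<le> N" using len by (cases hs) auto
    show "H \<noteq> T" using T(3) by simp
    show "over_frattini p G E \<and> A \<subseteq> E \<and> p ^ n * card (E \<inter> T) \<le> card T" if E: "(E, n) \<in> set ?hs" for E n
    proof -
      consider "hs = (E, n) # tl hs" | m where "(E, m) \<in> set hs" "n = m - 1"
        using E by (cases hs) auto
      then show ?thesis
      proof cases
        case 1
        then have m: "(E, n) \<in> set hs" by (metis list.set_intros(1))
        show ?thesis
          using hole_frattini[OF m] cmt_range_subset[OF hole_frattini[OF m]] hole_inter(2)[OF hole_mem[OF m] T(1) TE[OF 1]]
          by simp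
      next
        case 2
        have "m \<in> set (map snd hs)" using 2(1) by force
        then have "0 < m" using spread_ge_2[OF spr] by fastforce
        then show ?thesis
          using hole_frattini[OF 2(1)] cmt_range_subset[OF hole_frattini[OF 2(1)]] hole_inter(1)[OF hole_mem[OF 2(1)] T(1)] 2(2)
          by simp
      qed
    qed
    show "spread 1 (map snd ?hs)"
      unfolding snd using spread_tail[OF sp2] spr by (cases hs) (simp_all add: numeral_2_eq_2)
    fix x assume x: "x \<in> T" "x \<notin> H" "x \<notin> K" "\<And>E n. (E, n) \<in> set ?hs \<Longrightarrow> x \<notin> E"
    have xc: "x \<in> carrier G" by (rule subgroup.mem_carrier[OF sT x(1)])
    have xF: "x \<notin> F" using x(1,2) T(6) by blast
    have "x \<notin> E" if E: "(E, n) \<in> set hs" for E n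
    proof (cases "(E, n) \<in> set (tl hs)")
      case True
      then have "(E, n - 1) \<in> set ?hs" by force
      then show ?thesis by (rule x(4))
    next
      case False
      then have "hs = (E, n) # tl hs" using E by (cases hs) auto
      then have "(E, n) \<in> set (take 1 hs)" by (cases hs) auto
      then show ?thesis using x(4)[of E n] by simp
    qed
    from drop[OF xc x(2,3) xF this]
    show "card T \<le> p ^ j * card (centralizer_mod G A x \<inter> T)"
      by (rule card_restrict_le[OF subgroup_centralizer_mod[OF normal_cmt_range xc] sT])
  next
    show "card (carrier G) \<le> p ^ j * card (centralizer_mod G A a)"
      by (rule drop[OF ac a(2,3) aF]) (use a(4) in auto)
  qed
  also have "\<dots> = p ^ (1 + (j + (triangular j + excess j 1 (map snd ?hs))))"
    using cA by (simp only: power_add power_one_right)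
  finally show ?thesis .
qed

end

text \<open>The induction step when the commutators are not all central: then a non-central \<open>z\<close> of the second
  centre can be found among the products of commutators, so that \<open>z\<close> lies in all hyperplanes and holes, and
  translation by \<open>z\<close> does not affect which of them contain an element.\<close>
locale noncentral_step = covered_step G p k H K hs + inductive_second G p "length hs" z
  for G :: "'a monoid" (structure) and p k H K hs z +
  assumes z_noncentral: "z \<notin> centre G" and z_derived: "z \<in> derived G (carrier G)"
    and z_pow: "z [^] p \<in> centre G" and sp2: "spread 2 ns"
    and nosub: "(E, n) \<in> set hs \<Longrightarrow> \<not> E \<subseteq> H"
begin

lemma over_frattini_F: "over_frattini p G F"
  by (rule over_frattini_centralizer[OF z_pow])

lemma z_mem: "over_frattini p G E \<Longrightarrow> z \<in> E"
  using derived_subset_over_frattini z_derived by blast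

lemma F_ne: "F \<noteq> carrier G" by (rule centralizer_ne_carrier[OF z_noncentral])

lemma A_gt_1: "1 < card A" by (rule card_range_gt_1[OF z_noncentral])

lemma drop:
  assumes "x \<in> carrier G" "x \<notin> H" "x \<notin> K" "x \<notin> F" "\<And>E n. (E, n) \<in> set hs \<Longrightarrow> x \<notin> E"
  shows "0 < k" "card (carrier G) \<le> p ^ (k - 1) * card (centralizer_mod G A x)"
proof -
  have "breadth_le p k G x" by (rule good) (use assms in auto)
  from breadth_drop[OF assms(1,4) this]
  show "0 < k" "card (carrier G) \<le> p ^ (k - 1) * card (centralizer_mod G A x)" .
qed

lemma good_translate:
  assumes x: "x \<in> carrier G" "x \<notin> H" "x \<notin> K" "\<And>E n. (E, n) \<in> set hs \<Longrightarrow> x \<notin> E"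
  shows "breadth_le p k G x" "breadth_le p k G (x \<otimes> z)"
proof -
  show "breadth_le p k G x" by (rule good) (use x in auto)
  have iff: "x \<otimes> z \<in> E \<longleftrightarrow> x \<in> E" if "over_frattini p G E" for E
    by (rule mult_mem_iff_right[OF over_frattini_subgroup[OF that] z_mem[OF that] x(1)])
  show "breadth_le p k G (x \<otimes> z)"
  proof (rule good)
    show "x \<otimes> z \<in> carrier G" using x z by simp
    show "x \<otimes> z \<notin> H" "x \<otimes> z \<notin> K"
      using iff[OF hyperplane_over_frattini[OF H]] iff[OF hyperplane_over_frattini[OF K]] x by simp_all
    show "\<forall>(E, n)\<in>set hs. x \<otimes> z \<notin> E" using iff[OF hole_frattini] x(4) by fast
  qed
qed

lemma exists_drop: "\<exists>a\<in>carrier G. a \<notin> H \<and> a \<notin> K \<and> a \<notin> F \<and> (\<forall>(E, n)\<in>set hs. a \<notin> E)"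
  by (rule exists_good[OF subgroup_F F_ne])

lemma k_pos: "0 < k"
proof -
  obtain a where a: "a \<in> carrier G" "a \<notin> H" "a \<notin> K" "a \<notin> F" "\<forall>(E, n)\<in>set hs. a \<notin> E" using exists_drop by blast
  show ?thesis by (rule drop(1)[OF a(1-4)]) (use a(5) in auto)
qed

lemma triangular_k: "triangular k = k + triangular (k - 1)"
  using k_pos by (cases k) simp_all

lemma hyperplane_F: "card A = p \<Longrightarrow> hyperplane p G F"
  using over_frattini_F card_range by (simp add: hyperplane_def)

text \<open>If two of the three hyperplanes coincide, the remaining two take over in the quotient.\<close>
lemma coinciding_hyperplanes:
  assumes cA: "card A = p" and eq: "F = H \<or> F = K \<or> H = K"
  shows "card (derived G (carrier G)) \<le> p ^ dexp"
proof -
  note F = hyperplane_F[OF cA]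
  define L where "L = (if H = K then F else K)"
  have L: "hyperplane p G L" and un: "x \<in> F \<or> x \<in> H \<or> x \<in> K \<longleftrightarrow> x \<in> H \<or> x \<in> L" for x
    using F K eq by (auto simp: L_def)
  have "card (derived G (carrier G)) \<le> card A * p ^ (triangular (k - 1) + excess (k - 1) 1 ns)"
  proof (rule quotient_bound[OF normal_cmt_range A_gt_1 _ H A_hyper[OF H] L A_hyper[OF L]])
    show "length hs \<le> Suc (length hs)" by simp
    show "hole p G E n \<and> A \<subseteq> E" if "(E, n) \<in> set hs" for E n
      using hole_mem[OF that] cmt_range_subset[OF hole_frattini[OF that]] by simp
    show "spread 1 ns" by (rule spr)
    show "card (carrier G) \<le> p ^ (k - 1) * card (centralizer_mod G A x)"
      if "x \<in> carrier G" "x \<notin> H" "x \<notin> L" "\<And>E n. (E, n) \<in> set hs \<Longrightarrow> x \<notin> E" for x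
      by (rule drop(2)) (use that un in auto)
  qed
  also have "\<dots> = p ^ (1 + (triangular (k - 1) + excess (k - 1) 1 ns))" using cA by simp
  finally show ?thesis
    by (rule card_le_dexp) (use triangular_k k_pos excess_mono[of "k - 1" k 1 1 ns] in linarith)
qed

text \<open>The centralizer of \<open>z\<close> belongs to the pencil of \<open>H\<close> and \<open>K\<close>. Inside this centralizer, \<open>H\<close> and
  \<open>K\<close> merge into one hyperplane, so that there is room for the first hole in the role of the other one.\<close>
lemma centralizer_in_pencil:
  assumes cA: "card A = p" and ne: "H \<noteq> K" "F \<noteq> H" "F \<noteq> K" and J: "H \<inter> K \<subseteq> F"
  shows "card (derived G (carrier G)) \<le> p ^ dexp"
proof -
  note F = hyperplane_F[OF cA]
  have cJ: "p * (p * card (H \<inter> K)) = card (carrier G)"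
    using card_inter_hyperplane[OF K hyperplane_subgroup[OF H] hyperplane_not_subset[OF H K ne(1)]] hyperplane_card[OF H]
    by simp
  have FK: "F \<inter> K = H \<inter> K" by (rule hyperplane_inter_eq[OF F K ne(3) J _ cJ]) simp
  \<comment> \<open>The second exceptional hyperplane in \<open>F\<close> is cut out by a hyperplane of \<open>G\<close> other than \<open>F\<close>.\<close>
  have "\<exists>L. hyperplane p G L \<and> L \<noteq> F \<and> (\<forall>E n ts. hs = (E, n) # ts \<longrightarrow> E \<inter> F \<subseteq> L)"
  proof (cases hs)
    case Nil then show ?thesis using H ne(2) by blast
  next
    case (Cons h ts)
    obtain E n where h: "h = (E, n)" by fastforce
    have m: "(E, n) \<in> set hs" using Cons h by simp
    have n2: "2 \<le> n" using spr Cons h by simp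
    obtain w where w: "w \<in> carrier G" "w \<notin> F" using F_ne subgroup.subset[OF subgroup_F] by blast
    have fE: "over_frattini p G (E \<inter> F)" by (rule over_frattini_inter[OF hole_frattini[OF m] over_frattini_F])
    have "p ^ 2 * card (E \<inter> F) \<le> p ^ n * card E"
      using n2 p_gt_1 finite_sub[OF fin over_frattini_subgroup[OF hole_frattini[OF m]]]
      by (intro mult_mono power_increasing card_mono) auto
    also have "\<dots> \<le> card (carrier G)" using hole_mem[OF m] by (simp add: hole_def)
    finally have le: "p ^ Suc (length [w]) * card (E \<inter> F) \<le> card (carrier G)" by (simp add: numeral_2_eq_2)
    obtain L where "hyperplane p G L" "E \<inter> F \<subseteq> L" "set [w] \<subseteq> L"
      using exists_hyperplane_with[OF fE le] w(1) by auto
    then show ?thesis using Cons h w(2) by auto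
  qed
  then obtain L where L: "hyperplane p G L" "L \<noteq> F" "\<And>E n ts. hs = (E, n) # ts \<Longrightarrow> E \<inter> F \<subseteq> L" by blast
  let ?hs = "map (\<lambda>(E, n). (E, n - 1)) (tl hs)"
  have snd: "map snd ?hs = map (\<lambda>n. n - 1) (tl ns)" by (simp add: map_tl comp_def case_prod_beta)
  obtain a where a: "a \<in> carrier G" "a \<notin> H" "a \<notin> K" "a \<notin> F" "\<forall>(E, n)\<in>set hs. a \<notin> E" using exists_drop by blast
  have "card (derived G (carrier G)) \<le>
    card A * (p ^ (k - 1) * p ^ (triangular (k - 1) + excess (k - 1) 1 (map snd ?hs)))"
  proof (rule section_bound[OF normal_cmt_range _ F A_hyper[OF F] H A_hyper[OF H] _ L(1) A_hyper[OF L(1)] L(2) _ _ _ a(1,4)])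
    show "length ?hs \<le> length hs" "H \<noteq> F" using ne by auto
    show "over_frattini p G E \<and> A \<subseteq> E \<and> p ^ n * card (E \<inter> F) \<le> card F" if E: "(E, n) \<in> set ?hs" for E n
    proof -
      obtain m where m: "(E, m) \<in> set (tl hs)" "n = m - 1" using E by auto
      have mh: "(E, m) \<in> set hs" using m(1) by (cases hs) auto
      have "m \<in> set ns" using mh by force
      then have "0 < m" using spread_ge_2[OF spr] by fastforce
      then show ?thesis
        using hole_frattini[OF mh] cmt_range_subset[OF hole_frattini[OF mh]] hole_inter(1)[OF hole_mem[OF mh] F] m(2) by simp
    qed
    show "spread 1 (map snd ?hs)" unfolding snd by (rule spread_mono[OF spread_tail[OF sp2]]) simp
    fix x assume x: "x \<in> F" "x \<notin> H" "x \<notin> L" "\<And>E n. (E, n) \<in> set ?hs \<Longrightarrow> x \<notin> E"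
    have xc: "x \<in> carrier G" by (rule subgroup.mem_carrier[OF subgroup_F x(1)])
    have xK: "x \<notin> K" using x(1,2) FK by blast
    have "x \<notin> E" if E: "(E, n) \<in> set hs" for E n
    proof (cases "(E, n) \<in> set (tl hs)")
      case True
      then have "(E, n - 1) \<in> set ?hs" by force
      then show ?thesis by (rule x(4))
    next
      case False
      then have "hs = (E, n) # tl hs" using E by (cases hs) auto
      then show ?thesis using L(3) x(1,3) by blast
    qed
    from good_translate[OF xc x(2) xK this]
    show "card F \<le> p ^ (k - 1) * card (centralizer_mod G A x \<inter> F)"
      by (intro breadth_drop_inside[OF F x(1) _ _ k_pos]) auto
  next
    show "card (carrier G) \<le> p ^ (k - 1) * card (centralizer_mod G A a)"
      by (rule drop(2)[OF a(1-4)]) (use a(5) in auto)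
  qed
  also have "\<dots> = p ^ (1 + ((k - 1) + (triangular (k - 1) + excess (k - 1) 1 (map snd ?hs))))"
    using cA by (simp only: power_add power_one_right)
  finally show ?thesis
  proof (rule card_le_dexp)
    have "excess (k - 1) 1 (map snd ?hs) = excess k 1 (tl ns)" unfolding snd by (rule excess_tail[OF k_pos sp2])
    also have "\<dots> \<le> excess k 1 ns"
      using excess_mono[of k k 1 2 "tl ns"] by (cases ns) (simp_all add: numeral_2_eq_2)
    finally show "1 + ((k - 1) + (triangular (k - 1) + excess (k - 1) 1 (map snd ?hs))) \<le> dexp"
      using triangular_k k_pos by linarith
  qed
qed

lemma centralizer_off_pencil:
  assumes cA: "card A = p" and ne: "H \<noteq> K" "F \<noteq> H" and J: "\<not> H \<inter> K \<subseteq> F"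
  shows "card (derived G (carrier G)) \<le> p ^ dexp"
proof -
  let ?ms = "map snd (take 1 hs @ map (\<lambda>(E, n). (E, n - 1)) (tl hs))"
  have ms: "?ms = take 1 ns @ map (\<lambda>n. n - 1) (tl ns)"
    by (simp add: map_tl comp_def case_prod_beta take_map)
  have "card (derived G (carrier G)) \<le> p ^ (1 + ((k - 1) + (triangular (k - 1) + excess (k - 1) 1 ?ms)))"
    by (rule off_pencil_bound[OF H K hyperplane_F[OF cA] holes sp2 nosub _ ne J]) (use drop(2) in auto)
  then show ?thesis
  proof (rule card_le_dexp)
    have "excess (k - 1) 1 ?ms \<le> excess k 1 ns"
    proof (cases ns)
      case (Cons n ms)
      have "excess (k - 1) 2 (map (\<lambda>n. n - 1) (tl ns)) = excess k 2 (tl ns)" by (rule excess_tail[OF k_pos sp2])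
      then show ?thesis unfolding ms using Cons by (simp add: numeral_2_eq_2)
    qed (simp only: ms, simp)
    then show "1 + ((k - 1) + (triangular (k - 1) + excess (k - 1) 1 ?ms)) \<le> dexp"
      using triangular_k k_pos by linarith
  qed
qed

text \<open>A centralizer of larger index \<open>p ^ r\<close> becomes a new first hole. If \<open>r\<close> even exceeds \<open>k\<close>, the
  bound on the breadth modulo \<open>A\<close> drops to \<open>2 * k - r - 1\<close>, which pays for \<open>A\<close>.\<close>
lemma centralizer_as_hole:
  assumes cA: "card A = p ^ r" and r: "2 \<le> r"
  shows "card (derived G (carrier G)) \<le> p ^ dexp"
proof -
  have hF: "hole p G F r"
    using over_frattini_F card_range cA by (simp add: hole_def)
  have q: "card (derived G (carrier G)) \<le> card A * p ^ (triangular j + excess j 1 (map snd ((F, r) # hs)))"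
    if j: "\<And>x. x \<in> carrier G \<Longrightarrow> x \<notin> H \<Longrightarrow> x \<notin> K \<Longrightarrow> x \<notin> F \<Longrightarrow> (\<And>E n. (E, n) \<in> set hs \<Longrightarrow> x \<notin> E) \<Longrightarrow>
      card (carrier G) \<le> p ^ j * card (centralizer_mod G A x)" for j
  proof (rule quotient_bound[OF normal_cmt_range A_gt_1 _ H A_hyper[OF H] K A_hyper[OF K]])
    show "length ((F, r) # hs) \<le> Suc (length hs)" by simp
    show "hole p G E n \<and> A \<subseteq> E" if "(E, n) \<in> set ((F, r) # hs)" for E n
    proof -
      have "hole p G E n" using that hF hole_mem by auto
      then show ?thesis using cmt_range_subset by (simp add: hole_def)
    qed
    show "spread 1 (map snd ((F, r) # hs))" using r sp2 by (simp add: numeral_2_eq_2)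
    show "card (carrier G) \<le> p ^ j * card (centralizer_mod G A x)"
      if "x \<in> carrier G" "x \<notin> H" "x \<notin> K" "\<And>E n. (E, n) \<in> set ((F, r) # hs) \<Longrightarrow> x \<notin> E" for x
      by (rule j[OF that(1-3)]) (use that(4) in auto)
  qed
  show ?thesis
  proof (cases "r \<le> k")
    case True
    have "card (derived G (carrier G)) \<le> card A * p ^ (triangular (k - 1) + excess (k - 1) 1 (map snd ((F, r) # hs)))"
      by (rule q) (rule drop(2))
    also have "\<dots> = p ^ (r + (triangular (k - 1) + excess (k - 1) 1 (map snd ((F, r) # hs))))"
      using cA by (simp only: power_add)
    finally show ?thesis
    proof (rule card_le_dexp)
      have "excess (k - 1) 1 (map snd ((F, r) # hs)) = (k - r) + excess k 1 ns"
        using excess_shift[of "k - 1" 1 ns] k_pos by simp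
      then show "r + (triangular (k - 1) + excess (k - 1) 1 (map snd ((F, r) # hs))) \<le> dexp"
        using triangular_k True by linarith
    qed
  next
    case False
    note large = breadth_drop_large[OF _ _ good_translate cA]
    obtain a where a: "a \<in> carrier G" "a \<notin> H" "a \<notin> K" "a \<notin> F" "\<forall>(E, n)\<in>set hs. a \<notin> E" using exists_drop by blast
    have r2k: "Suc r \<le> 2 * k" by (rule large(1)[OF a(1,4) a(1-3) _ a(1-3)]) (use a(5) in auto)
    let ?j = "2 * k - Suc r"
    have "card (derived G (carrier G)) \<le> card A * p ^ (triangular ?j + excess ?j 1 (map snd ((F, r) # hs)))"
    proof (rule q)
      fix x assume x: "x \<in> carrier G" "x \<notin> H" "x \<notin> K" "x \<notin> F" "\<And>E n. (E, n) \<in> set hs \<Longrightarrow> x \<notin> E"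
      show "card (carrier G) \<le> p ^ ?j * card (centralizer_mod G A x)"
        by (rule large(2)[OF x(1,4) x(1-3) _ x(1-3)]) (use x(5) in auto)
    qed
    also have "\<dots> = p ^ (r + (triangular ?j + excess ?j 1 (map snd ((F, r) # hs))))"
      using cA by (simp only: power_add)
    finally show ?thesis
    proof (rule card_le_dexp)
      have "excess ?j 1 (map snd ((F, r) # hs)) = excess (Suc ?j) 1 ns"
        using False excess_shift[of ?j 1 ns] by simp
      also have "\<dots> \<le> excess k 1 ns" by (rule excess_mono) (use False r2k in auto)
      finally have 1: "excess ?j 1 (map snd ((F, r) # hs)) \<le> excess k 1 ns" .
      have "?j \<le> k - 1" using False by linarith
      then have "triangular ?j + (k - 1 - ?j) \<le> triangular (k - 1)" by (rule triangular_mono)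
      moreover have "r \<le> k + (k - 1 - ?j)" using False r2k by linarith
      ultimately show "r + (triangular ?j + excess ?j 1 (map snd ((F, r) # hs))) \<le> dexp"
        using 1 triangular_k by linarith
    qed
  qed
qed

lemma noncentral: "card (derived G (carrier G)) \<le> p ^ dexp"
proof -
  obtain r where r: "card A = p ^ r" using card_power[OF subgroup_cmt_range] .
  have "r \<noteq> 0" using A_gt_1 r by (intro notI) simp
  then consider "r = 1" | "2 \<le> r" by linarith
  then show ?thesis
  proof cases
    case 1
    then have cA: "card A = p" using r by simp
    show ?thesis
      using coinciding_hyperplanes[OF cA] centralizer_in_pencil[OF cA] centralizer_off_pencil[OF cA] by blast
  next
    case 2
    then show ?thesis by (rule centralizer_as_hole[OF r])
  qed
qed

end

lemma (in covered_step) step: "card (derived G (carrier G)) \<le> p ^ dexp"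
proof -
  consider E n where "(E, n) \<in> set hs" "E \<subseteq> H"
    | "\<And>E n. (E, n) \<in> set hs \<Longrightarrow> \<not> E \<subseteq> H" "\<not> spread 2 ns"
    | "\<And>E n. (E, n) \<in> set hs \<Longrightarrow> \<not> E \<subseteq> H" "spread 2 ns" "derived G (carrier G) \<subseteq> centre G"
    | "\<And>E n. (E, n) \<in> set hs \<Longrightarrow> \<not> E \<subseteq> H" "spread 2 ns" "\<not> derived G (carrier G) \<subseteq> centre G"
    by blast
  then show ?thesis
  proof cases
    case 1 then show ?thesis using drop_hole by blast
  next
    case 2 then show ?thesis by (rule remove_hole)
  next
    case 3
    show ?thesis
    proof (cases "centre G = carrier G")
      case True
      have "cmt G x y = \<one>" if "x \<in> carrier G" "y \<in> carrier G" for x y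
        using cmt_eq_one_iff[OF that] centreD[of y x] that True by simp
      then have "derived G (carrier G) \<subseteq> {\<one>}" by (intro derived_subset_if_cmt[OF triv_subgroup]) simp
      then have "card (derived G (carrier G)) \<le> card {\<one>}" by (intro card_mono) auto
      then have "card (derived G (carrier G)) \<le> p ^ 0" by simp
      then show ?thesis by (rule card_le_dexp) simp
    next
      case False
      show ?thesis by (rule class_two[OF 3(3) False 3(2)])
    qed
  next
    case 4
    obtain z where z: "z \<in> derived G (carrier G)" "z \<notin> centre G" "z [^] p \<in> centre G" "second_central G p z"
      using exists_second_central[OF derived_self_is_normal 4(3)] by blast
    interpret z: second_central G p z by (rule z(4))
    interpret z: noncentral_step G p k H K hs z by unfold_locales (use z 4(1,2) in auto)
    show ?thesis by (rule z.noncentral)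
  qed
qed

text \<open>Without holes, this bounds the derived subgroup of a group in which all elements outside two maximal
  subgroups have small breadth. The holes are there for the induction only.\<close>
theorem card_derived_le_covered:
  fixes G :: "'a monoid"
  assumes "2 < p" "p_grp G p" "covered p k G H K hs"
  shows "card (derived G (carrier G)) \<le> p ^ (triangular k + excess k 1 (map snd hs))"
  using assms(2,3)
proof (induction "card (carrier G) + length hs" arbitrary: G k H K hs rule: less_induct)
  case less
  interpret p_grp G p by fact
  interpret covered_step G p k H K hs by unfold_locales (use less assms(1) in auto)
  show ?case by (rule step)
qed

section \<open>A subgroup that is central in a hyperplane\<close>

context inductive_bound begin

text \<open>One factors out the commutators with a suitable element \<open>z\<close> of \<open>P \<inter> H \<inter> K\<close> and passes to \<open>F\<close> if \<open>z\<close>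
  centralizes \<open>F\<close>, to \<open>R\<close> otherwise. As \<open>z\<close> lies in \<open>P \<inter> H \<inter> K\<close>, the breadth is bounded for \<open>xz\<close> whenever
  it is for \<open>x\<close>. The bounds apply only outside the intersection of \<open>H\<close> and \<open>K\<close>, common to all four
  hyperplanes; the bound on \<open>F\<close>, which is by one weaker and concerns elements of \<open>P\<close> only, is used inside
  \<open>F\<close> up to factors from \<open>S\<close>, or to pass to \<open>R\<close>.\<close>
lemma pencil_bound:
  assumes H: "hyperplane p G H" and K: "hyperplane p G K" and F: "hyperplane p G F" and R: "hyperplane p G R"
    and ne: "H \<noteq> K" "F \<noteq> H" "F \<noteq> K" "R \<noteq> H" "R \<noteq> K" "R \<noteq> F" and J: "H \<inter> K \<subseteq> F" "H \<inter> K \<subseteq> R"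
    and P: "P \<lhd> G" and dec: "\<And>x. x \<in> carrier G \<Longrightarrow> \<exists>g\<in>S. \<exists>y\<in>P. x = g \<otimes> y"
    and S: "S \<subseteq> H \<inter> K" and comm: "\<And>g f. g \<in> S \<Longrightarrow> f \<in> F \<Longrightarrow> g \<otimes> f = f \<otimes> g"
    and lowR: "\<And>x. x \<in> R \<Longrightarrow> x \<notin> H \<Longrightarrow> breadth_le p j G x"
    and lowF: "\<And>y. y \<in> P \<Longrightarrow> y \<in> F \<Longrightarrow> y \<notin> H \<Longrightarrow> breadth_le p (Suc j) G y"
  shows "card (derived G (carrier G)) \<le> p ^ (j + triangular j)"
proof -
  let ?J = "H \<inter> K"
  have sH: "subgroup H G" and sF: "subgroup F G" and sR: "subgroup R G" and sK: "subgroup K G"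
    using H F R K by (auto intro: hyperplane_subgroup)
  have sP: "subgroup P G" using P by (rule normal_imp_subgroup)
  have cJ: "p * (p * card ?J) = card (carrier G)"
    using card_inter_hyperplane[OF K sH hyperplane_not_subset[OF H K ne(1)]] hyperplane_card[OF H] by simp
  have FH: "F \<inter> H = ?J" by (rule hyperplane_inter_eq[OF F H ne(2) J(1) _ cJ]) simp
  have FK: "F \<inter> K = ?J" by (rule hyperplane_inter_eq[OF F K ne(3) J(1) _ cJ]) simp
  have RH: "R \<inter> H = ?J" by (rule hyperplane_inter_eq[OF R H ne(4) J(2) _ cJ]) simp
  have RF: "R \<inter> F = ?J" by (rule hyperplane_inter_eq[OF R F ne(6) J(2,1) cJ])
  have fJ: "over_frattini p G ?J"
    by (rule over_frattini_inter[OF hyperplane_over_frattini[OF H] hyperplane_over_frattini[OF K]])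
  have sJ: "subgroup ?J G" by (rule over_frattini_subgroup[OF fJ])
  have RnH: "\<not> R \<subseteq> H" and FnH: "\<not> F \<subseteq> H" using hyperplane_not_subset R F H ne by auto
  have split: "\<exists>g\<in>S. \<exists>y\<in>P. x = g \<otimes> y \<and> y \<in> F \<and> y \<notin> H" if x: "x \<in> F" "x \<notin> H" for x
  proof -
    obtain g y where gy: "g \<in> S" "y \<in> P" "x = g \<otimes> y" using dec[OF subgroup.mem_carrier[OF sF x(1)]] by blast
    have yc: "y \<in> carrier G" by (rule subgroup.mem_carrier[OF sP gy(2)])
    have "g \<in> H" "g \<in> F" using gy(1) S J by auto
    then show ?thesis using gy x mult_mem_iff[OF sH _ yc] mult_mem_iff[OF sF _ yc] by blast
  qed
  show ?thesis
  proof (cases "P \<inter> ?J \<subseteq> centre G")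
    case True
    \<comment> \<open>Then \<open>F\<close> is abelian, because \<open>?J\<close> has index \<open>p\<close> in it and is generated by \<open>P \<inter> ?J\<close> and \<open>S\<close>.\<close>
    have FC: "F \<subseteq> centralizer G x" if x: "x \<in> F" "x \<notin> H" for x
    proof -
      obtain g y where gy: "g \<in> S" "y \<in> P" "x = g \<otimes> y" "y \<in> F" "y \<notin> H" using split[OF x] by blast
      have yc: "y \<in> carrier G" by (rule subgroup.mem_carrier[OF sF gy(4)])
      have sC: "subgroup (centralizer G y) G" by (rule subgroup_centralizer[OF yc])
      have "?J \<subseteq> centralizer G y"
      proof
        fix w assume w: "w \<in> ?J"
        have wc: "w \<in> carrier G" by (rule subgroup.mem_carrier[OF sJ w])
        obtain g' y' where w': "g' \<in> S" "y' \<in> P" "w = g' \<otimes> y'" using dec[OF wc] by blast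
        have y'c: "y' \<in> carrier G" by (rule subgroup.mem_carrier[OF sP w'(2)])
        have g'J: "g' \<in> ?J" using w'(1) S by blast
        then have "y' \<in> ?J" using mult_mem_iff[OF sJ _ y'c] w w'(3) by blast
        then have "y' \<in> centre G" using True w'(2) by blast
        then have "y' \<in> centralizer G y" using centreD[of y' y] yc y'c by (simp add: centralizer_def)
        moreover have "g' \<in> centralizer G y"
          using comm[OF w'(1) gy(4)] subgroup.mem_carrier[OF sJ g'J] by (simp add: centralizer_def)
        ultimately show "w \<in> centralizer G y" unfolding w'(3) by (intro subgroup.m_closed[OF sC])
      qed
      moreover have "y \<in> centralizer G y" using yc by (simp add: centralizer_def)
      ultimately have "?J \<subset> centralizer G y \<inter> F" using gy(4,5) J(1) by blast
      then have "p * card ?J \<le> card (centralizer G y \<inter> F)"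
        by (rule p_mult_card_le_psubset[OF sJ subgroups_Inter_pair[OF sC sF]])
      moreover have "p * (p * card ?J) = p * card F" using cJ hyperplane_card[OF F] by simp
      ultimately have "card F \<le> card (centralizer G y \<inter> F)" using p_gt_1 by simp
      then have "centralizer G y \<inter> F = F" using card_seteq[OF finite_sub[OF fin sF], of "centralizer G y \<inter> F"] by simp
      then have Fy: "f \<otimes> y = y \<otimes> f" if "f \<in> F" for f using that by (auto simp: centralizer_def)
      show ?thesis
      proof
        fix f assume f: "f \<in> F"
        have c: "f \<in> carrier G" "g \<in> carrier G" using subgroup.mem_carrier[OF sF f] gy(1) S subgroup.mem_carrier[OF sJ] by auto
        have "f \<otimes> x = (f \<otimes> g) \<otimes> y" using gy(3) c yc by (simp add: m_assoc)
        also have "\<dots> = (g \<otimes> f) \<otimes> y" by (simp only: comm[OF gy(1) f])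
        also have "\<dots> = g \<otimes> (f \<otimes> y)" using c yc by (simp add: m_assoc)
        also have "\<dots> = x \<otimes> f" unfolding Fy[OF f] gy(3) using c yc by (simp add: m_assoc)
        finally show "f \<in> centralizer G x" using c by (simp add: centralizer_def)
      qed
    qed
    obtain w where w: "w \<in> F" "w \<notin> H" using FnH by blast
    have FC': "F \<subseteq> centralizer G x" if x: "x \<in> F" for x
    proof (cases "x \<in> H")
      case True
      have c: "x \<in> carrier G" "w \<in> carrier G" using subgroup.mem_carrier[OF sF] x w by auto
      have "x \<otimes> w \<notin> H" using mult_mem_iff[OF sH True c(2)] w(2) by simp
      then have "F \<subseteq> centralizer G (x \<otimes> w)" by (intro FC subgroup.m_closed[OF sF x w(1)])
      moreover have "F \<subseteq> centralizer G w" by (rule FC[OF w])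
      ultimately show ?thesis
      proof (intro subsetI)
        fix f assume "f \<in> F" and a: "F \<subseteq> centralizer G (x \<otimes> w)" "F \<subseteq> centralizer G w"
        then have f: "f \<in> carrier G" "f \<otimes> (x \<otimes> w) = (x \<otimes> w) \<otimes> f" "f \<otimes> w = w \<otimes> f"
          by (auto simp: centralizer_def)
        have "(f \<otimes> x) \<otimes> w = f \<otimes> (x \<otimes> w)" using c f(1) by (simp add: m_assoc)
        also have "\<dots> = x \<otimes> (w \<otimes> f)" unfolding f(2) using c f(1) by (simp add: m_assoc)
        also have "\<dots> = (x \<otimes> f) \<otimes> w" unfolding f(3)[symmetric] using c f(1) by (simp add: m_assoc)
        finally have "f \<otimes> x = x \<otimes> f" using c f(1) by simp
        then show "f \<in> centralizer G x" using f(1) by (simp add: centralizer_def)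
      qed
    qed (use FC x in blast)
    have "cmt G x y = \<one>" if "x \<in> F" "y \<in> F" for x y
      using FC'[OF that(1)] that centralizer_iff_cmt[of x y] subgroup.mem_carrier[OF sF] by blast
    then have "derived G F \<subseteq> {\<one>}"
      unfolding derived_def by (intro generate_subgroup_incl[OF _ triv_subgroup]) auto
    then have "card (derived G F) \<le> card {\<one>}" by (intro card_mono) auto
    then have d1: "card (derived G F) \<le> 1" by simp
    obtain a where a: "a \<in> R" "a \<notin> H" using RnH by blast
    have aF: "a \<notin> F" using a RF by blast
    have "card (derived G (carrier G)) \<le> p ^ j * card (derived G F)"
      by (rule card_derived_le_hyperplane[OF F subgroup.mem_carrier[OF sR a(1)] aF lowR[OF a]])
    also have "\<dots> \<le> p ^ j * 1" using d1 by (rule mult_le_mono2)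
    also have "\<dots> \<le> p ^ (j + triangular j)" using p_gt_1 by (simp add: power_increasing)
    finally show ?thesis .
  next
    case False
    have nPJ: "P \<inter> ?J \<lhd> G" by (rule normal_subgroup_intersect[OF P over_frattini_normal[OF fJ]])
    obtain z where z: "z \<in> P" "z \<in> ?J" "z \<notin> centre G" "z [^] p \<in> centre G" and sc: "second_central G p z"
      using exists_second_central[OF nPJ False] by blast
    interpret z: second_central G p z by (rule sc)
    let ?A = "z.cmt_range" and ?C = "centralizer G z"
    have zc: "z \<in> carrier G" by (rule z.z)
    have sC: "subgroup ?C G" by (rule z.subgroup_F)
    have Cne: "?C \<noteq> carrier G" by (rule z.centralizer_ne_carrier[OF z(3)])
    have AH: "?A \<subseteq> U" if "hyperplane p G U" for U by (rule z.cmt_range_subset[OF hyperplane_over_frattini[OF that]])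
    have nA: "?A \<lhd> G" by (rule z.normal_cmt_range)
    have zR: "z \<in> R" and zF: "z \<in> F" and zH: "z \<in> H" using z(2) J by auto
    note trans = mult_mem_iff_right
    have R2: "breadth_le p j G x" "breadth_le p j G (x \<otimes> z)" if x: "x \<in> R" "x \<notin> H" for x
    proof -
      have xc: "x \<in> carrier G" by (rule subgroup.mem_carrier[OF sR x(1)])
      show "breadth_le p j G x" by (rule lowR[OF x])
      show "breadth_le p j G (x \<otimes> z)" by (rule lowR) (use trans[OF sR zR xc] trans[OF sH zH xc] x in auto)
    qed
    have F2: "breadth_le p (Suc j) G y" "breadth_le p (Suc j) G (y \<otimes> z)" if y: "y \<in> P" "y \<in> F" "y \<notin> H" for y
    proof -
      have yc: "y \<in> carrier G" by (rule subgroup.mem_carrier[OF sF y(2)])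
      show "breadth_le p (Suc j) G y" by (rule lowF[OF y])
      show "breadth_le p (Suc j) G (y \<otimes> z)"
        by (rule lowF) (use trans[OF sP z(1) yc] trans[OF sF zF yc] trans[OF sH zH yc] y in auto)
    qed
    have cen: "?C = U" if U: "hyperplane p G U" "U \<subseteq> ?C" for U
    proof (rule ccontr)
      assume "?C \<noteq> U"
      then obtain a where "a \<in> ?C" "a \<notin> U" using U(2) by blast
      from subgroup_eq_carrier[OF U(1) sC U(2) this] show False using Cne by simp
    qed
    \<comment> \<open>Otherwise all elements of \<open>R\<close> outside \<open>?J\<close> would be central, hence also their quotient \<open>z\<close>.\<close>
    have j: "0 < j"
    proof (rule ccontr)
      assume "\<not> 0 < j"
      then have ce: "x \<in> centre G" if "x \<in> carrier G" "breadth_le p j G x" for x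
        using that mem_centre_iff_centralizer[OF that(1)] card_seteq[OF fin subgroup.subset[OF subgroup_centralizer[OF that(1)]]]
        by (simp add: breadth_le_def)
      obtain a where a: "a \<in> R" "a \<notin> H" using RnH by blast
      have ac: "a \<in> carrier G" by (rule subgroup.mem_carrier[OF sR a(1)])
      have "a \<in> centre G" "a \<otimes> z \<in> centre G" using ce R2[OF a] ac zc by auto
      then show False using mult_mem_iff[OF subgroup_centre _ zc] z(3) by blast
    qed
    have tri: "triangular j = j + triangular (j - 1)" using j by (cases j) simp_all
    obtain r where r: "card ?A = p ^ r" using card_power[OF z.subgroup_cmt_range] .
    have cA: "card ?A = p" if "hyperplane p G ?C"
    proof -
      have "card ?A * card ?C = p * card ?C" using z.card_range hyperplane_card[OF that] by simp
      then show ?thesis using card_sub_pos[OF fin sC] by simp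
    qed
    have fin_exp: "card (derived G (carrier G)) \<le> p ^ (j + triangular j)"
      if "card (derived G (carrier G)) \<le> p ^ r' * (p ^ m * p ^ (triangular i + excess i 1 (map snd ([] :: ('a set \<times> nat) list))))"
        "r' + (m + triangular i) \<le> j + triangular j" for r' m i
    proof -
      have "p ^ r' * (p ^ m * p ^ (triangular i + excess i 1 (map snd ([] :: ('a set \<times> nat) list)))) = p ^ (r' + (m + triangular i))"
        by (simp add: power_add)
      also have "\<dots> \<le> p ^ (j + triangular j)" using p_gt_1 that(2) by (intro power_increasing) auto
      finally show ?thesis using that(1) by (rule order_trans[rotated])
    qed
    note sect = section_bound[OF nA, of "[]"]
    consider "?C = F" | "?C = R" | "?C \<noteq> F" "?C \<noteq> R" by blast
    then show ?thesis
    proof cases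
      case 1
      obtain a where a: "a \<in> R" "a \<notin> H" using RnH by blast
      have ac: "a \<in> carrier G" by (rule subgroup.mem_carrier[OF sR a(1)])
      have aF: "a \<notin> F" using a RF by blast
      have "card (derived G (carrier G)) \<le> card ?A * (p ^ (j - 1) * p ^ (triangular j + excess j 1 (map snd ([] :: ('a set \<times> nat) list))))"
      proof (rule sect[OF _ F AH[OF F] H AH[OF H] _ K AH[OF K] _ _ _ _ ac aF])
        show "H \<noteq> F" "K \<noteq> F" using ne by auto
        show "card (carrier G) \<le> p ^ (j - 1) * card (centralizer_mod G ?A a)"
          using z.breadth_drop(2)[OF ac _ lowR[OF a]] aF 1 by simp
        fix x assume x: "x \<in> F" "x \<notin> H"
        obtain g y where gy: "g \<in> S" "y \<in> P" "x = g \<otimes> y" "y \<in> F" "y \<notin> H" using split[OF x] by blast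
        have yc: "y \<in> carrier G" by (rule subgroup.mem_carrier[OF sF gy(4)])
        have gc: "g \<in> carrier G" using gy(1) S subgroup.mem_carrier[OF sJ] by blast
        have hC: "hyperplane p G ?C" using F 1 by simp
        have yC: "y \<in> ?C" using gy(4) 1 by simp
        have le: "card F \<le> p ^ j * card (centralizer_mod G ?A y \<inter> F)"
          using z.breadth_drop_inside[OF hC yC F2[OF gy(2,4,5)]] 1 by simp
        have "centralizer_mod G ?A y \<inter> F \<subseteq> centralizer_mod G ?A x \<inter> F"
        proof
          fix f assume "f \<in> centralizer_mod G ?A y \<inter> F"
          then have f: "f \<in> carrier G" "cmt G y f \<in> ?A" "f \<in> F" by (auto simp: centralizer_mod_def)
          have "cmt G g f = \<one>" using cmt_eq_one_iff[OF gc f(1)] comm[OF gy(1) f(3)] by simp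
          moreover have "cmt G x f = (g \<otimes> cmt G y f \<otimes> inv g) \<otimes> cmt G g f"
            unfolding gy(3) by (rule cmt_mult_left[OF gc yc f(1)])
          moreover have "g \<otimes> cmt G y f \<otimes> inv g = cmt G y f"
            using conj_centre[OF _ gc] f(2) z.cmt_range_subset_centre by blast
          ultimately have "cmt G x f = cmt G y f" using f(1) yc by simp
          then show "f \<in> centralizer_mod G ?A x \<inter> F" using f by (simp add: centralizer_mod_def)
        qed
        then have "card (centralizer_mod G ?A y \<inter> F) \<le> card (centralizer_mod G ?A x \<inter> F)"
          using finite_sub[OF fin sF] by (intro card_mono) auto
        then show "card F \<le> p ^ j * card (centralizer_mod G ?A x \<inter> F)" using le by (meson mult_le_mono2 order_trans)
      qed (auto)
      then show ?thesis using fin_exp[of 1 "j - 1" j] cA F 1 j by simp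
    next
      case 2
      obtain x where x: "x \<in> F" "x \<notin> H" using FnH by blast
      obtain y where y: "y \<in> P" "y \<in> F" "y \<notin> H" using split[OF x] by blast
      have yc: "y \<in> carrier G" by (rule subgroup.mem_carrier[OF sF y(2)])
      have yR: "y \<notin> R" using y RF by blast
      have "card (derived G (carrier G)) \<le> card ?A * (p ^ j * p ^ (triangular (j - 1) + excess (j - 1) 1 (map snd ([] :: ('a set \<times> nat) list))))"
      proof (rule sect[OF _ R AH[OF R] H AH[OF H] _ K AH[OF K] _ _ _ _ yc yR])
        show "H \<noteq> R" "K \<noteq> R" using ne by auto
        show "card (carrier G) \<le> p ^ j * card (centralizer_mod G ?A y)"
          using z.breadth_drop(2)[OF yc _ lowF[OF y]] yR 2 by simp
        fix x assume x: "x \<in> R" "x \<notin> H"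
        have hC: "hyperplane p G ?C" using R 2 by simp
        have xC: "x \<in> ?C" using x(1) 2 by simp
        show "card R \<le> p ^ (j - 1) * card (centralizer_mod G ?A x \<inter> R)"
          using z.breadth_drop_inside[OF hC xC R2[OF x] j] 2 by simp
      qed (auto)
      then show ?thesis using fin_exp[of 1 j "j - 1"] cA R 2 j tri by simp
    next
      case 3
      \<comment> \<open>Inside \<open>R\<close>, the exceptional sets are \<open>?J\<close> and the centralizer of \<open>z\<close>, which is enlarged to a
        hyperplane there. The element outside \<open>R\<close> that is needed to pass to \<open>R\<close> is taken from \<open>F\<close>.\<close>
      have RC: "\<not> R \<subseteq> ?C" and FC: "\<not> F \<subseteq> ?C" using cen R F 3 by blast+
      have fC: "over_frattini p G ?C" by (rule z.over_frattini_centralizer[OF z(4)])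
      have "?C \<inter> R \<subset> R" using RC by blast
      then have "p * card (?C \<inter> R) \<le> card R" by (rule p_mult_card_le_psubset[OF subgroups_Inter_pair[OF sC sR] sR])
      then have "p * (p * card (?C \<inter> R)) \<le> card (carrier G)" unfolding hyperplane_card[OF R, symmetric] by (rule mult_le_mono2)
      moreover obtain w where w: "w \<in> carrier G" "w \<notin> R" using hyperplane_ne_carrier[OF R] subgroup.subset[OF sR] by blast
      ultimately obtain L where L: "hyperplane p G L" "?C \<inter> R \<subseteq> L" "w \<in> L"
        using exists_hyperplane_with[OF over_frattini_inter[OF fC hyperplane_over_frattini[OF R]], of "[w]"]
        by (auto simp: mult.assoc)
      have LR: "L \<noteq> R" using L(3) w(2) by blast
      obtain x0 where x0: "x0 \<in> F" "x0 \<notin> H" "x0 \<notin> ?C" using exists_off_two_subgroups[OF sF sH FnH sC FC] by blast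
      obtain g y where gy: "g \<in> S" "x0 = g \<otimes> y" and y: "y \<in> P" "y \<in> F" "y \<notin> H" using split[OF x0(1,2)] by blast
      have yc: "y \<in> carrier G" by (rule subgroup.mem_carrier[OF sF y(2)])
      have yR: "y \<notin> R" using y RF by blast
      have gc: "g \<in> carrier G" using gy(1) S subgroup.mem_carrier[OF sJ] by blast
      have "g \<in> ?C" using comm[OF gy(1) zF] gc by (simp add: centralizer_def)
      then have yC: "y \<notin> ?C" using x0(3) gy(2) mult_mem_iff[OF sC _ yc] by blast
      have sec: "card (derived G (carrier G)) \<le> p ^ r * (p ^ m * p ^ (triangular i + excess i 1 (map snd ([] :: ('a set \<times> nat) list))))"
        if m: "card (carrier G) \<le> p ^ m * card (centralizer_mod G ?A y)"
          and i: "\<And>x. x \<in> R \<Longrightarrow> x \<notin> H \<Longrightarrow> x \<notin> ?C \<Longrightarrow> card (carrier G) \<le> p ^ i * card (centralizer_mod G ?A x)" for m i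
        unfolding r[symmetric]
      proof (rule sect[OF _ R AH[OF R] H AH[OF H] _ L(1) AH[OF L(1)] LR _ _ _ yc yR m])
        show "H \<noteq> R" using ne by auto
        fix x assume x: "x \<in> R" "x \<notin> H" "x \<notin> L"
        have "x \<notin> ?C" using x L(2) by blast
        then show "card R \<le> p ^ i * card (centralizer_mod G ?A x \<inter> R)"
          by (intro card_restrict_le[OF subgroup_centralizer_mod[OF nA subgroup.mem_carrier[OF sR x(1)]] sR] i x)
      qed (auto)
      show ?thesis
      proof (cases "r \<le> j")
        \<comment> \<open>The dichotomy of \<open>centralizer_as_hole\<close>: for \<open>r > j\<close>, the breadths drop by more than one.\<close>
        case True
        have "card (derived G (carrier G)) \<le> p ^ r * (p ^ j * p ^ (triangular (j - 1) + excess (j - 1) 1 (map snd ([] :: ('a set \<times> nat) list))))"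
        proof (rule sec)
          show "card (carrier G) \<le> p ^ j * card (centralizer_mod G ?A y)"
            using z.breadth_drop(2)[OF yc yC lowF[OF y]] by simp
          show "card (carrier G) \<le> p ^ (j - 1) * card (centralizer_mod G ?A x)" if "x \<in> R" "x \<notin> H" "x \<notin> ?C" for x
            by (rule z.breadth_drop(2)[OF subgroup.mem_carrier[OF sR that(1)] that(3) lowR[OF that(1,2)]])
        qed
        then show ?thesis by (rule fin_exp) (use True tri in linarith)
      next
        case False
        obtain x1 where x1: "x1 \<in> R" "x1 \<notin> H" "x1 \<notin> ?C" using exists_off_two_subgroups[OF sR sH RnH sC RC] by blast
        have r2j: "Suc r \<le> 2 * j"
          by (rule z.breadth_drop_large(1)[OF subgroup.mem_carrier[OF sR x1(1)] x1(3) R2[OF x1(1,2)] r])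
        have "card (derived G (carrier G)) \<le>
          p ^ r * (p ^ (2 * Suc j - Suc r) * p ^ (triangular (2 * j - Suc r) + excess (2 * j - Suc r) 1 (map snd ([] :: ('a set \<times> nat) list))))"
        proof (rule sec)
          show "card (carrier G) \<le> p ^ (2 * Suc j - Suc r) * card (centralizer_mod G ?A y)"
            by (rule z.breadth_drop_large(2)[OF yc yC F2[OF y] r])
          show "card (carrier G) \<le> p ^ (2 * j - Suc r) * card (centralizer_mod G ?A x)"
            if "x \<in> R" "x \<notin> H" "x \<notin> ?C" for x
            by (rule z.breadth_drop_large(2)[OF subgroup.mem_carrier[OF sR that(1)] that(3) R2[OF that(1,2)] r])
        qed
        then show ?thesis
        proof (rule fin_exp)
          define i where "i = 2 * j - Suc r"
          have "triangular i + (j - 1 - i) \<le> triangular (j - 1)"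
            by (rule triangular_mono) (use False in \<open>simp add: i_def\<close>)
          moreover have "1 \<le> j - 1 - i" using False r2j by (simp add: i_def)
          moreover have "r + (2 * Suc j - Suc r) = j + j + 1" using r2j by simp
          ultimately show "r + (2 * Suc j - Suc r + triangular (2 * j - Suc r)) \<le> j + triangular j"
            unfolding i_def[symmetric] using tri by linarith
        qed
      qed
    qed
  qed
qed

end

lemma inductive_bound_derived:
  fixes G :: "'a monoid"
  assumes "2 < p" "p_grp G p" shows "inductive_bound G p N"
  using assms card_derived_le_covered[OF assms(1)] by (auto simp: inductive_bound_def inductive_bound_axioms_def)

text \<open>A variant without holes in which the breadth is known only for elements of \<open>P\<close>. It transfers to all
  elements outside \<open>F\<close>: since \<open>g \<in> S\<close> centralizes \<open>F\<close>, the centralizers of \<open>y\<close> and of \<open>g \<otimes> y\<close> have the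
  same intersection with \<open>F\<close>, which has index \<open>p\<close> in either of them if \<open>y \<notin> F\<close>. If the
  centre of \<open>F\<close> is central in \<open>G\<close>, then \<open>S\<close> does not affect breadths at all. Otherwise there is an element \<open>z\<close> of
  the second centre with centralizer \<open>F\<close>.\<close>
lemma card_derived_le_split:
  fixes G :: "'a monoid" (structure)
  assumes p3: "2 < p" and pG: "p_grp G p"
    and H: "hyperplane p G H" and K: "hyperplane p G K" and F: "hyperplane p G F"
    and P: "P \<lhd> G" and dec: "\<And>x. x \<in> carrier G \<Longrightarrow> \<exists>g\<in>S. \<exists>y\<in>P. x = g \<otimes> y"
    and S: "S \<subseteq> H" "S \<subseteq> K" "S \<subseteq> F" and comm: "\<And>g f. g \<in> S \<Longrightarrow> f \<in> F \<Longrightarrow> g \<otimes> f = f \<otimes> g"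
    and low: "\<And>y. y \<in> P \<Longrightarrow> y \<notin> H \<Longrightarrow> y \<notin> K \<Longrightarrow> breadth_le p k G y"
  shows "card (derived G (carrier G)) \<le> p ^ triangular k"
proof -
  interpret p_grp G p by (rule pG)
  interpret inductive_bound G p 0 by (rule inductive_bound_derived[OF p3 pG])
  have sH: "subgroup H G" and sF: "subgroup F G" and sK: "subgroup K G"
    using H F K by (auto intro: hyperplane_subgroup)
  have sP: "subgroup P G" using P by (rule normal_imp_subgroup)
  have Sc: "g \<in> carrier G" if "g \<in> S" for g using that S(1) subgroup.mem_carrier[OF sH] by blast
  have plain: ?thesis if b: "\<And>x. x \<in> carrier G \<Longrightarrow> x \<notin> H \<Longrightarrow> x \<notin> K \<Longrightarrow> breadth_le p k G x"
  proof -
    have "covered p k G H K []" using H K b by (simp add: covered_def)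
    from card_derived_le_covered[OF p3 pG this] show ?thesis by simp
  qed
  have off: "breadth_le p k G x" if x: "x \<in> carrier G" "x \<notin> H" "x \<notin> K" "x \<notin> F" for x
  proof -
    obtain g y where gy: "g \<in> S" "y \<in> P" "x = g \<otimes> y" using dec[OF x(1)] by blast
    have yc: "y \<in> carrier G" by (rule subgroup.mem_carrier[OF sP gy(2)])
    have g: "g \<in> H" "g \<in> K" "g \<in> F" using gy(1) S by auto
    have gc: "g \<in> carrier G" by (rule Sc[OF gy(1)])
    have y: "y \<notin> H" "y \<notin> K" "y \<notin> F"
      using x gy(3) mult_mem_iff[OF sH g(1) yc] mult_mem_iff[OF sK g(2) yc] mult_mem_iff[OF sF g(3) yc] by auto
    have cF: "p * card (centralizer G u \<inter> F) = card (centralizer G u)" if u: "u \<in> carrier G" "u \<notin> F" for u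
      by (rule card_inter_hyperplane[OF F subgroup_centralizer[OF u(1)]]) (use u in \<open>auto simp: centralizer_def\<close>)
    have "centralizer G x \<inter> F = centralizer G y \<inter> F"
    proof -
      have "f \<in> centralizer G x \<longleftrightarrow> f \<in> centralizer G y" if f: "f \<in> F" for f
      proof -
        have fc: "f \<in> carrier G" by (rule subgroup.mem_carrier[OF sF f])
        have "f \<otimes> x = (f \<otimes> g) \<otimes> y" using gy(3) fc gc yc by (simp add: m_assoc)
        also have "\<dots> = (g \<otimes> f) \<otimes> y" by (simp only: comm[OF gy(1) f])
        finally have "f \<otimes> x = g \<otimes> (f \<otimes> y)" using fc gc yc by (simp add: m_assoc)
        moreover have "x \<otimes> f = g \<otimes> (y \<otimes> f)" using gy(3) fc gc yc by (simp add: m_assoc)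
        ultimately show ?thesis using fc gc yc by (simp add: centralizer_def)
      qed
      then show ?thesis by blast
    qed
    then have "card (centralizer G x) = card (centralizer G y)" using cF[OF x(1,4)] cF[OF yc y(3)] by simp
    then show ?thesis using low[OF gy(2) y(1,2)] by (simp add: breadth_le_def)
  qed
  \<comment> \<open>the centre of \<open>F\<close>\<close>
  define N where "N = {z \<in> F. \<forall>f\<in>F. f \<otimes> z = z \<otimes> f}"
  have SN: "S \<subseteq> N"
  proof
    fix g assume g: "g \<in> S"
    have "f \<otimes> g = g \<otimes> f" if "f \<in> F" for f using comm[OF g that] by (rule sym)
    then show "g \<in> N" using g S(3) by (auto simp: N_def)
  qed
  show ?thesis
  proof (cases "F = H \<or> F = K")
    case True
    then show ?thesis using off by (intro plain) auto
  next
    case FHK: False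
    show ?thesis
    proof (cases "N \<subseteq> centre G")
      case True
      show ?thesis
      proof (rule plain)
        fix x assume x: "x \<in> carrier G" "x \<notin> H" "x \<notin> K"
        obtain g y where gy: "g \<in> S" "y \<in> P" "x = g \<otimes> y" using dec[OF x(1)] by blast
        have yc: "y \<in> carrier G" by (rule subgroup.mem_carrier[OF sP gy(2)])
        have gc: "g \<in> carrier G" by (rule Sc[OF gy(1)])
        have gZ: "g \<in> centre G" using gy(1) SN True by blast
        have "g \<in> H" "g \<in> K" using gy(1) S by auto
        then have y: "y \<notin> H" "y \<notin> K" using x gy(3) mult_mem_iff[OF sH _ yc] mult_mem_iff[OF sK _ yc] by auto
        have "f \<in> centralizer G x \<longleftrightarrow> f \<in> centralizer G y" for f
        proof (cases "f \<in> carrier G")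
          case fc: True
          have "f \<otimes> x = (f \<otimes> g) \<otimes> y" using gy(3) fc gc yc by (simp add: m_assoc)
          also have "\<dots> = (g \<otimes> f) \<otimes> y" by (simp only: centreD[OF gZ fc])
          finally have "f \<otimes> x = g \<otimes> (f \<otimes> y)" using fc gc yc by (simp add: m_assoc)
          moreover have "x \<otimes> f = g \<otimes> (y \<otimes> f)" using gy(3) fc gc yc by (simp add: m_assoc)
          ultimately show ?thesis using fc gc yc by (simp add: centralizer_def)
        qed (simp add: centralizer_def)
        then have "centralizer G x = centralizer G y" by blast
        then show "breadth_le p k G x" using low[OF gy(2) y] by (simp add: breadth_le_def)
      qed
    next
      case False
      have nF: "F \<lhd> G" by (rule hyperplane_normal[OF F])
      interpret F: normal F G by (rule nF)
      have nN: "N \<lhd> G"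
        unfolding normal_inv_iff
      proof (intro conjI ballI)
        show "subgroup N G"
        proof (rule finite_closed_subgroup[OF fin])
          show "N \<subseteq> carrier G" by (auto simp: N_def)
          have "\<one> \<in> N" by (simp add: N_def)
          then show "N \<noteq> {}" by blast
          fix u v assume u: "u \<in> N" and v: "v \<in> N"
          have uF: "u \<in> F" and vF: "v \<in> F" using u v by (auto simp: N_def)
          have "f \<otimes> (u \<otimes> v) = (u \<otimes> v) \<otimes> f" if f: "f \<in> F" for f
          proof -
            have "f \<otimes> (u \<otimes> v) = (f \<otimes> u) \<otimes> v" using f uF vF by (simp add: m_assoc)
            also have "f \<otimes> u = u \<otimes> f" using u f by (simp add: N_def)
            also have "(u \<otimes> f) \<otimes> v = u \<otimes> (f \<otimes> v)" using f uF vF by (simp add: m_assoc)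
            also have "f \<otimes> v = v \<otimes> f" using v f by (simp add: N_def)
            also have "u \<otimes> (v \<otimes> f) = (u \<otimes> v) \<otimes> f" using f uF vF by (simp add: m_assoc)
            finally show ?thesis .
          qed
          then show "u \<otimes> v \<in> N" using uF vF by (simp add: N_def)
        qed
        fix x n assume x: "x \<in> carrier G" and n: "n \<in> N"
        have nF: "n \<in> F" using n by (simp add: N_def)
        have "f \<otimes> (x \<otimes> n \<otimes> inv x) = (x \<otimes> n \<otimes> inv x) \<otimes> f" if f: "f \<in> F" for f
        proof -
          let ?f = "inv x \<otimes> f \<otimes> x"
          have fF: "?f \<in> F" by (rule F.inv_op_closed1[OF x f])
          have "f \<otimes> (x \<otimes> n \<otimes> inv x) = x \<otimes> (?f \<otimes> n) \<otimes> inv x" using x f nF by (simp add: group_word)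
          also have "?f \<otimes> n = n \<otimes> ?f" using n fF by (simp add: N_def)
          also have "x \<otimes> (n \<otimes> ?f) \<otimes> inv x = (x \<otimes> n \<otimes> inv x) \<otimes> f" using x f nF by (simp add: group_word)
          finally show ?thesis .
        qed
        then show "x \<otimes> n \<otimes> inv x \<in> N" using F.inv_op_closed2[OF x nF] by (simp add: N_def)
      qed
      obtain z where z: "z \<in> N" "z \<notin> centre G" "z [^] p \<in> centre G" and sc: "second_central G p z"
        using exists_second_central[OF nN False] by blast
      interpret z: inductive_second G p 0 z
        unfolding inductive_second_def using inductive_bound_axioms sc by blast
      have zF: "z \<in> F" using z(1) by (simp add: N_def)
      have "F \<subseteq> centralizer G z" using z(1) by (auto simp: N_def centralizer_def)
      then have CF: "centralizer G z = F"
        using subgroup_eq_carrier[OF F z.subgroup_F] z.centralizer_ne_carrier[OF z(2)] by blast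
      have cA: "card z.cmt_range = p"
      proof -
        have "card z.cmt_range * card F = p * card F" using z.card_range hyperplane_card[OF F] CF by simp
        then show ?thesis using card_sub_pos[OF fin sF] by simp
      qed
      have drop: "0 < k" "card (carrier G) \<le> p ^ (k - 1) * card (centralizer_mod G z.cmt_range x)"
        if x: "x \<in> carrier G" "x \<notin> H" "x \<notin> K" "x \<notin> F" for x
        using z.breadth_drop[OF x(1) _ off[OF x]] x(4) CF by auto
      have "\<exists>a\<in>carrier G. a \<notin> H \<and> a \<notin> K \<and> a \<notin> F \<and> (\<forall>(E, n)\<in>set ([] :: ('a set \<times> nat) list). a \<notin> E)"
        by (rule exists_off_holes[OF p3 _ _ H sK hyperplane_ne_carrier[OF K] sF hyperplane_ne_carrier[OF F]]) auto
      then have k: "0 < k" using drop(1) by blast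
      have tri: "triangular k = k + triangular (k - 1)" using k by (cases k) simp_all
      show ?thesis
      proof (cases "H = K")
        case True
        have "card (derived G (carrier G)) \<le> card z.cmt_range * p ^ (triangular (k - 1) + excess (k - 1) 1 (map snd ([] :: ('a set \<times> nat) list)))"
          by (rule quotient_bound[OF z.normal_cmt_range z.card_range_gt_1[OF z(2)] _ H z.A_hyper[OF H] F z.A_hyper[OF F]])
            (use drop(2) True in auto)
        also have "\<dots> = p ^ (1 + triangular (k - 1))" using cA by simp
        also have "\<dots> \<le> p ^ triangular k" using p_gt_1 tri k by (intro power_increasing) auto
        finally show ?thesis .
      next
        case HK: False
        show ?thesis
        proof (cases "H \<inter> K \<subseteq> F")
          case False
          have "card (derived G (carrier G)) \<le> p ^ (1 + ((k - 1) + (triangular (k - 1) +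
            excess (k - 1) 1 (map snd (take 1 ([] :: ('a set \<times> nat) list) @ map (\<lambda>(E, n). (E, n - 1)) (tl []))))))"
          proof (rule z.off_pencil_bound[OF H K, unfolded CF, OF F])
            show "card (carrier G) \<le> p ^ (k - 1) * card (centralizer_mod G z.cmt_range x)"
              if "x \<in> carrier G" "x \<notin> H" "x \<notin> K" "x \<notin> F" for x by (rule drop(2)[OF that])
          qed (use FHK HK False in auto)
          then show ?thesis using tri k by simp
        next
          case True
          obtain R1 R2 where RR: "hyperplane p G R1" "hyperplane p G R2" "R1 \<noteq> H" "R1 \<noteq> K" "R2 \<noteq> H" "R2 \<noteq> K"
            "R1 \<noteq> R2" "R1 \<inter> H = H \<inter> K" "R1 \<inter> K = H \<inter> K" "R2 \<inter> H = H \<inter> K" "R2 \<inter> K = H \<inter> K" "R1 \<inter> R2 = H \<inter> K"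
            by (rule obtain_pencil[OF p3 H K HK])
          obtain R where R: "hyperplane p G R" "R \<noteq> H" "R \<noteq> K" "R \<noteq> F" "H \<inter> K \<subseteq> R"
          proof (cases "R1 = F")
            case False
            show ?thesis by (rule that[OF RR(1,3,4) False]) (use RR(8) in blast)
          next
            case True
            show ?thesis by (rule that[OF RR(2,5,6)]) (use RR(7,10) True in blast)+
          qed
          have cJ: "p * (p * card (H \<inter> K)) = card (carrier G)"
            using card_inter_hyperplane[OF K sH hyperplane_not_subset[OF H K HK]] hyperplane_card[OF H] by simp
          have RH: "R \<inter> H = H \<inter> K" by (rule hyperplane_inter_eq[OF R(1) H R(2,5) _ cJ]) simp
          have RK: "R \<inter> K = H \<inter> K" by (rule hyperplane_inter_eq[OF R(1) K R(3,5) _ cJ]) simp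
          have RF: "R \<inter> F = H \<inter> K" by (rule hyperplane_inter_eq[OF R(1) F R(4,5) True cJ])
          have FK: "F \<inter> K = H \<inter> K" by (rule hyperplane_inter_eq[OF F K _ True _ cJ]) (use FHK in auto)
          obtain Q :: "'a monoid" and \<pi> where pq: "p_quot G p Q \<pi> z.cmt_range"
            using obtain_quotient[OF z.normal_cmt_range] .
          interpret q: p_quot G p Q \<pi> z.cmt_range by (rule pq)
          interpret Q: inductive_bound Q p 0 by (rule inductive_bound_derived[OF p3 q.Q.p_grp_axioms])
          note hyp = q.hyperplane_image[OF _ z.A_hyper]
          have sub: "\<pi> ` U \<noteq> \<pi> ` V" if "hyperplane p G U" "hyperplane p G V" "U \<noteq> V" for U V
            using q.image_subset_imp_subset[OF hyperplane_subgroup[OF that(1)] hyperplane_subgroup[OF that(2)] z.A_hyper[OF that(2)]]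
              hyperplane_not_subset[OF that] by blast
          have HKi: "\<pi> ` H \<inter> \<pi> ` K = \<pi> ` (H \<inter> K)" by (rule q.image_inter[OF sH sK z.A_hyper[OF K]])
          have "card (derived Q (carrier Q)) \<le> p ^ ((k - 1) + triangular (k - 1))"
          proof (rule Q.pencil_bound[OF hyp[OF H H] hyp[OF K K] hyp[OF F F] hyp[OF R(1) R(1)]])
            show "\<pi> ` H \<noteq> \<pi> ` K" by (rule sub[OF H K HK])
            show "\<pi> ` F \<noteq> \<pi> ` H" "\<pi> ` F \<noteq> \<pi> ` K" using sub[OF F H] sub[OF F K] FHK by auto
            show "\<pi> ` R \<noteq> \<pi> ` H" by (rule sub[OF R(1) H R(2)])
            show "\<pi> ` R \<noteq> \<pi> ` K" by (rule sub[OF R(1) K R(3)])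
            show "\<pi> ` R \<noteq> \<pi> ` F" by (rule sub[OF R(1) F R(4)])
            show "\<pi> ` H \<inter> \<pi> ` K \<subseteq> \<pi> ` F" unfolding HKi using True by (rule image_mono)
            show "\<pi> ` H \<inter> \<pi> ` K \<subseteq> \<pi> ` R" unfolding HKi using R(5) by (rule image_mono)
            show "\<pi> ` P \<lhd> Q" by (rule normal.surj_hom_normal_subgroup[OF P q.\<pi>.group_hom_axioms q.pi_surj])
            show "\<pi> ` S \<subseteq> \<pi> ` H \<inter> \<pi> ` K" unfolding HKi by (rule image_mono) (use S in blast)
            show "\<exists>g\<in>\<pi> ` S. \<exists>y\<in>\<pi> ` P. u = g \<otimes>\<^bsub>Q\<^esub> y" if u: "u \<in> carrier Q" for u
            proof -
              obtain x where x: "x \<in> carrier G" "u = \<pi> x" using u q.pi_surj by blast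
              obtain g y where gy: "g \<in> S" "y \<in> P" "x = g \<otimes> y" using dec[OF x(1)] by blast
              have "u = \<pi> g \<otimes>\<^bsub>Q\<^esub> \<pi> y" using x(2) gy Sc[OF gy(1)] subgroup.mem_carrier[OF sP gy(2)] by simp
              then show ?thesis using gy(1,2) by blast
            qed
            show "u \<otimes>\<^bsub>Q\<^esub> v = v \<otimes>\<^bsub>Q\<^esub> u" if uv: "u \<in> \<pi> ` S" "v \<in> \<pi> ` F" for u v
            proof -
              obtain g f where gf: "g \<in> S" "f \<in> F" "u = \<pi> g" "v = \<pi> f" using uv by blast
              have "\<pi> (g \<otimes> f) = \<pi> (f \<otimes> g)" using comm[OF gf(1,2)] by simp
              then show ?thesis using gf Sc[OF gf(1)] subgroup.mem_carrier[OF sF gf(2)] by simp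
            qed
            show "breadth_le p (k - 1) Q u" if u: "u \<in> \<pi> ` R" "u \<notin> \<pi> ` H" for u
            proof -
              obtain x where x: "x \<in> R" "u = \<pi> x" "x \<notin> H" using u by blast
              have xc: "x \<in> carrier G" by (rule subgroup.mem_carrier[OF hyperplane_subgroup[OF R(1)] x(1)])
              have "x \<notin> K" "x \<notin> F" using x(1,3) RK RF by auto
              then show ?thesis using q.breadth_le_image[OF xc] drop(2)[OF xc x(3)] x(2) by simp
            qed
            show "breadth_le p (Suc (k - 1)) Q u" if u: "u \<in> \<pi> ` P" "u \<in> \<pi> ` F" "u \<notin> \<pi> ` H" for u
            proof -
              have "u \<in> \<pi> ` (P \<inter> F)" using u(1,2) q.image_inter[OF sP sF z.A_hyper[OF F]] by blast
              then obtain y where y: "y \<in> P" "y \<in> F" "u = \<pi> y" by blast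
              have yc: "y \<in> carrier G" by (rule subgroup.mem_carrier[OF sF y(2)])
              have yH: "y \<notin> H" using u(3) y(3) by blast
              then have yK: "y \<notin> K" using y(2) FK by blast
              show ?thesis using q.breadth_le_imp_image[OF yc low[OF y(1) yH yK]] y(3) k by simp
            qed
          qed
          then have "p * card (derived Q (carrier Q)) \<le> p * p ^ ((k - 1) + triangular (k - 1))" by (rule mult_le_mono2)
          also have "p * p ^ ((k - 1) + triangular (k - 1)) = p ^ triangular k"
            unfolding tri using k by (cases k) (simp_all add: power_add)
          finally show ?thesis using q.card_derived_le cA by simp
        qed
      qed
    qed
  qed
qed

section \<open>The semidirect product\<close>

context p_grp begin

text \<open>In the quotient by \<open>U\<close>, the image of \<open>N\<close> is a non-trivial normal subgroup and meets the centre.\<close>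
lemma normal_central_mod:
  assumes U: "U \<lhd> G" and N: "N \<lhd> G" and UN: "U \<subset> N"
  defines "C \<equiv> {x \<in> N. \<forall>g\<in>carrier G. cmt G x g \<in> U}"
  shows "C \<lhd> G" "U \<subset> C"
proof -
  interpret U: normal U G by (rule U)
  interpret N: normal N G by (rule N)
  have UC: "U \<subseteq> C"
  proof
    fix x assume x: "x \<in> U"
    have "cmt G x g \<in> U" if g: "g \<in> carrier G" for g
    proof -
      have "x \<otimes> (g \<otimes> inv x \<otimes> inv g) \<in> U" by (rule U.m_closed[OF x U.inv_op_closed2[OF g U.m_inv_closed[OF x]]])
      then show ?thesis using x g by (simp add: m_assoc)
    qed
    then show "x \<in> C" using x UN by (auto simp: C_def)
  qed
  have sC: "subgroup C G"
  proof (rule finite_closed_subgroup[OF fin])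
    show "C \<subseteq> carrier G" by (auto simp: C_def)
    show "C \<noteq> {}" using UC U.one_closed by blast
    fix x y assume x: "x \<in> C" and y: "y \<in> C"
    have xy: "x \<in> N" "y \<in> N" using x y by (auto simp: C_def)
    have "cmt G (x \<otimes> y) g \<in> U" if g: "g \<in> carrier G" for g
    proof -
      have "(x \<otimes> cmt G y g \<otimes> inv x) \<otimes> cmt G x g \<in> U"
        by (rule U.m_closed[OF U.inv_op_closed2]) (use x y xy g in \<open>auto simp: C_def\<close>)
      then show ?thesis using cmt_mult_left[of x y g] xy g by simp
    qed
    then show "x \<otimes> y \<in> C" using xy by (simp add: C_def)
  qed
  show "C \<lhd> G"
    unfolding normal_inv_iff
  proof (intro conjI ballI sC)
    fix g x assume g: "g \<in> carrier G" and x: "x \<in> C"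
    have xc: "x \<in> carrier G" by (rule subgroup.mem_carrier[OF sC x])
    have "inv (cmt G x g) \<in> U" by (rule U.m_inv_closed) (use x g in \<open>auto simp: C_def\<close>)
    then have "cmt G g x \<in> C" using inv_cmt[OF xc g] UC by auto
    then have "cmt G g x \<otimes> x \<in> C" by (rule subgroup.m_closed[OF sC _ x])
    then show "g \<otimes> x \<otimes> inv g \<in> C" using g xc by (simp add: group_word)
  qed
  obtain Q :: "'a monoid" and \<pi> where pq: "p_quot G p Q \<pi> U" using obtain_quotient[OF U] .
  interpret q: p_quot G p Q \<pi> U by (rule pq)
  have nN: "\<pi> ` N \<lhd> Q" by (rule N.surj_hom_normal_subgroup[OF q.\<pi>.group_hom_axioms q.pi_surj])
  have "\<pi> ` N \<noteq> {\<one>\<^bsub>Q\<^esub>}"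
  proof
    assume "\<pi> ` N = {\<one>\<^bsub>Q\<^esub>}"
    then have "N \<subseteq> U" using q.pi_ker N.subset by blast
    then show False using UN by blast
  qed
  then obtain y where y: "y \<in> \<pi> ` N" "y \<noteq> \<one>\<^bsub>Q\<^esub>" "\<And>g. g \<in> carrier Q \<Longrightarrow> g \<otimes>\<^bsub>Q\<^esub> y = y \<otimes>\<^bsub>Q\<^esub> g"
    using q.Q.normal_meets_center[OF nN] by blast
  then obtain x where x: "x \<in> N" "y = \<pi> x" by blast
  have xc: "x \<in> carrier G" using x(1) by simp
  have "cmt G x g \<in> U" if g: "g \<in> carrier G" for g
  proof -
    have "cmt Q (\<pi> x) (\<pi> g) = \<one>\<^bsub>Q\<^esub>"
      using q.Q.cmt_eq_one_iff[OF q.\<pi>.hom_closed[OF xc] q.\<pi>.hom_closed[OF g]] y(3)[OF q.\<pi>.hom_closed[OF g]] x(2) by simp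
    then have "\<pi> (cmt G x g) = \<one>\<^bsub>Q\<^esub>" by (simp only: q.image_cmt[OF xc g])
    moreover have "cmt G x g \<in> carrier G" using xc g by simp
    ultimately show ?thesis using q.pi_ker by blast
  qed
  then have "x \<in> C" using x(1) by (simp add: C_def)
  moreover have "x \<notin> U" using y(2) x(2) q.pi_ker[OF xc] by simp
  ultimately show "U \<subset> C" using UC by blast
qed

text \<open>A normal section of order at most \<open>p\<close> is central.\<close>
lemma cmt_mem_if_index_le_p:
  assumes U: "U \<lhd> G" and N: "N \<lhd> G" and UN: "U \<subseteq> N" and le: "card N \<le> p * card U"
    and x: "x \<in> N" and g: "g \<in> carrier G"
  shows "cmt G x g \<in> U"
proof -
  let ?C = "{x \<in> N. \<forall>g\<in>carrier G. cmt G x g \<in> U}"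
  have sN: "subgroup N G" and sU: "subgroup U G" using N U by (auto dest: normal_imp_subgroup)
  show ?thesis
  proof (cases "U = N")
    case True
    interpret U: normal U G by (rule U)
    have xU: "x \<in> U" using x True by simp
    have "x \<otimes> (g \<otimes> inv x \<otimes> inv g) \<in> U"
      by (rule U.m_closed[OF xU U.inv_op_closed2[OF g U.m_inv_closed[OF xU]]])
    then show ?thesis using xU g by (simp add: m_assoc)
  next
    case False
    then have UN': "U \<subset> N" using UN by blast
    note C = normal_central_mod[OF U N UN']
    have "p * card U \<le> card ?C" by (rule p_mult_card_le_psubset[OF sU normal_imp_subgroup[OF C(1)] C(2)])
    then have "?C = N" using card_seteq[OF finite_sub[OF fin sN], of ?C] le by simp
    then show ?thesis using x g by blast
  qed
qed

text \<open>Take for \<open>U\<close> a maximal one among the normal subgroups properly contained in \<open>N\<close>.\<close>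
lemma exists_normal_below:
  assumes N: "N \<lhd> G" "N \<noteq> {\<one>}"
  shows "\<exists>U. U \<lhd> G \<and> U \<subset> N \<and> (\<forall>x\<in>N. \<forall>g\<in>carrier G. cmt G x g \<in> U)"
proof -
  let ?S = "{U. U \<lhd> G \<and> U \<subset> N}"
  have sN: "subgroup N G" by (rule normal_imp_subgroup[OF N(1)])
  have "finite ?S" by (rule finite_subset[of _ "Pow N"]) (use finite_sub[OF fin sN] in auto)
  moreover have "{\<one>} \<in> ?S" using one_is_normal subgroup.one_closed[OF sN] N(2) by auto
  ultimately obtain U where U: "U \<in> ?S" and mx: "\<And>V. V \<in> ?S \<Longrightarrow> U \<subseteq> V \<Longrightarrow> U = V"
    using finite_has_maximal2 by (metis (no_types, lifting))
  let ?C = "{x \<in> N. \<forall>g\<in>carrier G. cmt G x g \<in> U}"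
  have U': "U \<lhd> G" "U \<subset> N" using U by auto
  note C = normal_central_mod[OF U'(1) N(1) U'(2)]
  have "?C = N"
  proof (rule ccontr)
    assume "?C \<noteq> N"
    then have "?C \<in> ?S" using C(1) by blast
    then show False using mx C(2) by blast
  qed
  then show ?thesis using U' by blast
qed

lemma log_index_le_iff:
  assumes A: "subgroup A G" and B: "subgroup B G" "B \<subseteq> A"
  shows "log_index p G A B \<le> real k \<longleftrightarrow> card A \<le> p ^ k * card B"
proof -
  interpret GA: group "G\<lparr>carrier := A\<rparr>" by (rule subgroup_imp_group[OF A])
  let ?r = "card (rcosets\<^bsub>G\<lparr>carrier := A\<rparr>\<^esub> B)"
  have e: "?r * card B = card A" using GA.lagrange[OF subgroup_incl[OF B(1) A B(2)]] by (simp add: order_def)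
  have B0: "0 < card B" by (rule card_sub_pos[OF fin B(1)])
  have "0 < card A" by (rule card_sub_pos[OF fin A])
  then have r0: "0 < ?r" using e by (metis gr0I mult_0)
  have "log_index p G A B \<le> real k \<longleftrightarrow> real ?r \<le> real p powr real k"
    unfolding log_index_def by (rule log_le_iff) (use p_gt_1 r0 in auto)
  also have "\<dots> \<longleftrightarrow> real ?r \<le> real (p ^ k)" using p_gt_1 by (simp add: powr_realpow)
  also have "\<dots> \<longleftrightarrow> ?r \<le> p ^ k" by (rule of_nat_le_iff)
  also have "\<dots> \<longleftrightarrow> ?r * card B \<le> p ^ k * card B" using B0 by simp
  finally show ?thesis unfolding e .
qed

lemma exists_subgroup_chain:
  assumes "subgroup D G" "card D = p ^ n"
  shows "\<exists>f. (\<forall>m\<le>n. subgroup (f m) G \<and> card (f m) = p ^ m \<and> f m \<subseteq> D) \<and>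
    (\<forall>l m. l \<le> m \<longrightarrow> m \<le> n \<longrightarrow> f l \<subseteq> f m)"
  using assms
proof (induction n arbitrary: D)
  case 0
  then show ?case by (intro exI[of _ "\<lambda>_. D"]) auto
next
  case (Suc n)
  interpret D: group "G\<lparr>carrier := D\<rparr>" by (rule subgroup_imp_group[OF Suc.prems(1)])
  have "order (G\<lparr>carrier := D\<rparr>) = p ^ n * p" using Suc.prems(2) by (simp add: order_def)
  then obtain E where E: "subgroup E (G\<lparr>carrier := D\<rparr>)" "card E = p ^ n"
    using sylow_thm[OF prime_p D.is_group, of n p] finite_sub[OF fin Suc.prems(1)] by auto
  have sE: "subgroup E G" by (rule incl_subgroup[OF Suc.prems(1) E(1)])
  have ED: "E \<subseteq> D" using subgroup.subset[OF E(1)] by simp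
  obtain f where f: "\<forall>m\<le>n. subgroup (f m) G \<and> card (f m) = p ^ m \<and> f m \<subseteq> E"
    "\<forall>l m. l \<le> m \<longrightarrow> m \<le> n \<longrightarrow> f l \<subseteq> f m" using Suc.IH[OF sE E(2)] by blast
  let ?f = "f(Suc n := D)"
  show ?case
  proof (intro exI[of _ ?f] conjI allI impI)
    fix m assume "m \<le> Suc n"
    then show "subgroup (?f m) G" "card (?f m) = p ^ m" "?f m \<subseteq> D"
      using f(1) Suc.prems ED by (auto simp: le_Suc_eq)
  next
    fix l m assume lm: "l \<le> m" "m \<le> Suc n"
    show "?f l \<subseteq> ?f m"
    proof (cases "m = Suc n")
      case True
      have "f l \<subseteq> D" if "l \<le> n" using f(1) that ED by blast
      then show ?thesis using True lm by (cases "l = Suc n") auto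
    next
      case False
      then show ?thesis using lm f(2) by simp
    qed
  qed
qed

end

locale acted_group =
  fixes p :: nat and P :: "('a, 'b) monoid_scheme" and G :: "('a \<Rightarrow> 'a) set"
  assumes prime: "Factorial_Ring.prime p" and pP: "p_group p P"
    and sG: "subgroup G (AutoGroup P)" and pG: "p_group p ((AutoGroup P)\<lparr>carrier := G\<rparr>)"
begin

abbreviation "\<Gamma> \<equiv> semidirect P G"
abbreviation "\<PP> \<equiv> embP P ` carrier P"
abbreviation "\<GG> \<equiv> embG P ` G"

sublocale P: p_grp P p
  using pP prime by (auto simp: p_group_def p_grp_def p_grp_axioms_def order_def)

sublocale Aut: group "AutoGroup P" by (rule P.AutoGroup)

lemma G_hom: "g \<in> G \<Longrightarrow> g \<in> hom P P" and G_bij: "g \<in> G \<Longrightarrow> bij_betw g (carrier P) (carrier P)"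
  and G_ext: "g \<in> G \<Longrightarrow> g \<in> extensional (carrier P)"
  using subgroup.mem_carrier[OF sG, of g] by (auto simp: AutoGroup_def auto_def Bij_def)

lemma G_closed [simp]: "g \<in> G \<Longrightarrow> x \<in> carrier P \<Longrightarrow> g x \<in> carrier P"
  using G_hom[of g] by (auto simp: hom_def)

lemma G_mult: "g \<in> G \<Longrightarrow> x \<in> carrier P \<Longrightarrow> y \<in> carrier P \<Longrightarrow> g (x \<otimes>\<^bsub>P\<^esub> y) = g x \<otimes>\<^bsub>P\<^esub> g y"
  using G_hom[of g] by (auto simp: hom_def)

lemma G_inv: "g \<in> G \<Longrightarrow> x \<in> carrier P \<Longrightarrow> g (inv\<^bsub>P\<^esub> x) = inv\<^bsub>P\<^esub> (g x)"
  using group_hom.hom_inv[of P P g x] G_hom[of g] P.is_group by (simp add: group_hom_def group_hom_axioms_def)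

lemma G_one: "g \<in> G \<Longrightarrow> g \<one>\<^bsub>P\<^esub> = \<one>\<^bsub>P\<^esub>"
  using hom_one[OF G_hom] P.is_group by simp

lemma Aut_mult: "g \<in> G \<Longrightarrow> h \<in> G \<Longrightarrow> g \<otimes>\<^bsub>AutoGroup P\<^esub> h = compose (carrier P) g h"
  using subgroup.mem_carrier[OF sG] by (auto simp: AutoGroup_def BijGroup_def auto_def)

lemma Aut_one: "\<one>\<^bsub>AutoGroup P\<^esub> = (\<lambda>x\<in>carrier P. x)"
  by (simp add: AutoGroup_def BijGroup_def)

lemma one_G: "\<one>\<^bsub>AutoGroup P\<^esub> \<in> G" by (rule subgroup.one_closed[OF sG])

lemma carrier_semidirect: "carrier \<Gamma> = G \<times> carrier P"
  by (simp add: semidirect_def)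

lemma mult_semidirect: "(g, x) \<otimes>\<^bsub>\<Gamma>\<^esub> (h, y) = (g \<otimes>\<^bsub>AutoGroup P\<^esub> h, x \<otimes>\<^bsub>P\<^esub> g y)"
  by (simp add: semidirect_def)

lemma card_G: "\<exists>n. card G = p ^ n"
  using pG by (auto simp: p_group_def order_def)

sublocale \<Gamma>: p_grp \<Gamma> p
proof -
  obtain m n where "card G = p ^ m" "card (carrier P) = p ^ n" using card_G P.order_pow by blast
  then have "card (carrier \<Gamma>) = p ^ (m + n)" by (simp add: carrier_semidirect card_cartesian_product power_add)
  then show "p_grp \<Gamma> p"
    using group_semidirect[OF P.is_group sG] prime by (auto simp: p_grp_def p_grp_axioms_def)
qed

lemma embG_closed: "g \<in> G \<Longrightarrow> embG P g \<in> carrier \<Gamma>" and embP_closed: "x \<in> carrier P \<Longrightarrow> embP P x \<in> carrier \<Gamma>"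
  using one_G by (auto simp: carrier_semidirect embG_def embP_def)

lemma embP_hom: "embP P \<in> hom P \<Gamma>"
proof (rule homI)
  fix x y assume "x \<in> carrier P" "y \<in> carrier P"
  then show "embP P (x \<otimes>\<^bsub>P\<^esub> y) = embP P x \<otimes>\<^bsub>\<Gamma>\<^esub> embP P y"
    by (simp add: embP_def mult_semidirect) (simp add: Aut_one)
qed (rule embP_closed)

sublocale embP: group_hom P \<Gamma> "embP P"
  using embP_hom P.is_group \<Gamma>.is_group by (simp add: group_hom_def group_hom_axioms_def)

lemma inj_embP: "inj (embP P)" by (rule injI) (simp add: embP_def)

lemma mult_embG_embP: "g \<in> G \<Longrightarrow> x \<in> carrier P \<Longrightarrow> embG P g \<otimes>\<^bsub>\<Gamma>\<^esub> embP P x = (g, g x)"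
  using subgroup.mem_carrier[OF sG, of g] by (simp add: embG_def embP_def mult_semidirect)

lemma decompose: "u \<in> carrier \<Gamma> \<Longrightarrow> \<exists>g\<in>G. \<exists>x\<in>carrier P. u = embG P g \<otimes>\<^bsub>\<Gamma>\<^esub> embP P x"
proof -
  assume "u \<in> carrier \<Gamma>"
  then obtain g y where u: "u = (g, y)" "g \<in> G" "y \<in> carrier P" by (auto simp: carrier_semidirect)
  obtain x where "x \<in> carrier P" "y = g x" using G_bij[OF u(2)] u(3) by (auto simp: bij_betw_def)
  moreover from this have "u = embG P g \<otimes>\<^bsub>\<Gamma>\<^esub> embP P x" using mult_embG_embP[OF u(2)] u(1) by simp
  ultimately show ?thesis using u(2) by (intro bexI)
qed

lemma conj_embP: "g \<in> G \<Longrightarrow> x \<in> carrier P \<Longrightarrow>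
    embG P g \<otimes>\<^bsub>\<Gamma>\<^esub> embP P x \<otimes>\<^bsub>\<Gamma>\<^esub> inv\<^bsub>\<Gamma>\<^esub> (embG P g) = embP P (g x)"
  by (rule semidirect_conj[OF P.is_group sG])

lemma cmt_embG_embP: "g \<in> G \<Longrightarrow> x \<in> carrier P \<Longrightarrow>
    cmt \<Gamma> (embG P g) (embP P x) = embP P (g x \<otimes>\<^bsub>P\<^esub> inv\<^bsub>P\<^esub> x)"
  using conj_embP[of g x] by (simp add: embP.hom_mult embP.hom_inv)

lemma normal_if_conj:
  assumes N: "subgroup N \<Gamma>" "N \<subseteq> \<PP>"
    and G: "\<And>g n. g \<in> G \<Longrightarrow> n \<in> N \<Longrightarrow> embG P g \<otimes>\<^bsub>\<Gamma>\<^esub> n \<otimes>\<^bsub>\<Gamma>\<^esub> inv\<^bsub>\<Gamma>\<^esub> (embG P g) \<in> N"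
    and P: "\<And>x n. x \<in> carrier P \<Longrightarrow> n \<in> N \<Longrightarrow> embP P x \<otimes>\<^bsub>\<Gamma>\<^esub> n \<otimes>\<^bsub>\<Gamma>\<^esub> inv\<^bsub>\<Gamma>\<^esub> (embP P x) \<in> N"
  shows "N \<lhd> \<Gamma>"
  unfolding \<Gamma>.normal_inv_iff
proof (intro conjI ballI N(1))
  fix u n assume u: "u \<in> carrier \<Gamma>" and n: "n \<in> N"
  obtain g x where gx: "g \<in> G" "x \<in> carrier P" "u = embG P g \<otimes>\<^bsub>\<Gamma>\<^esub> embP P x" using decompose[OF u] by blast
  have nc: "n \<in> carrier \<Gamma>" by (rule subgroup.mem_carrier[OF N(1) n])
  have "u \<otimes>\<^bsub>\<Gamma>\<^esub> n \<otimes>\<^bsub>\<Gamma>\<^esub> inv\<^bsub>\<Gamma>\<^esub> u =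
    embG P g \<otimes>\<^bsub>\<Gamma>\<^esub> (embP P x \<otimes>\<^bsub>\<Gamma>\<^esub> n \<otimes>\<^bsub>\<Gamma>\<^esub> inv\<^bsub>\<Gamma>\<^esub> (embP P x)) \<otimes>\<^bsub>\<Gamma>\<^esub> inv\<^bsub>\<Gamma>\<^esub> (embG P g)"
    unfolding gx(3) using nc embG_closed[OF gx(1)] embP_closed[OF gx(2)] by (simp only: \<Gamma>.group_word \<Gamma>.m_closed \<Gamma>.inv_closed)
  then show "u \<otimes>\<^bsub>\<Gamma>\<^esub> n \<otimes>\<^bsub>\<Gamma>\<^esub> inv\<^bsub>\<Gamma>\<^esub> u \<in> N" using G[OF gx(1) P[OF gx(2) n]] by (simp only:)
qed

lemma subgroup_embP: "subgroup U P \<Longrightarrow> subgroup (embP P ` U) \<Gamma>"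
  by (rule embP.subgroup_img_is_subgroup)

lemma conj_mem_image:
  assumes U: "U \<lhd> P" and x: "x \<in> carrier P" and n: "n \<in> embP P ` U"
  shows "embP P x \<otimes>\<^bsub>\<Gamma>\<^esub> n \<otimes>\<^bsub>\<Gamma>\<^esub> inv\<^bsub>\<Gamma>\<^esub> (embP P x) \<in> embP P ` U"
proof -
  obtain u where u: "u \<in> U" "n = embP P u" using n by blast
  have uc: "u \<in> carrier P" by (rule subgroup.mem_carrier[OF normal_imp_subgroup[OF U] u(1)])
  have "embP P x \<otimes>\<^bsub>\<Gamma>\<^esub> n \<otimes>\<^bsub>\<Gamma>\<^esub> inv\<^bsub>\<Gamma>\<^esub> (embP P x) = embP P (x \<otimes>\<^bsub>P\<^esub> u \<otimes>\<^bsub>P\<^esub> inv\<^bsub>P\<^esub> x)"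
    unfolding u(2) using x uc by (simp add: embP.hom_mult embP.hom_inv)
  then show ?thesis using normal.inv_op_closed2[OF U x u(1)] by simp
qed

lemma normal_image:
  assumes U: "U \<lhd> P" and inv: "\<And>g u. g \<in> G \<Longrightarrow> u \<in> U \<Longrightarrow> g u \<in> U"
  shows "embP P ` U \<lhd> \<Gamma>"
proof (rule normal_if_conj)
  have sU: "subgroup U P" by (rule normal_imp_subgroup[OF U])
  show "subgroup (embP P ` U) \<Gamma>" by (rule subgroup_embP[OF sU])
  show "embP P ` U \<subseteq> \<PP>" using subgroup.subset[OF sU] by blast
  fix g n assume g: "g \<in> G" and "n \<in> embP P ` U"
  then obtain u where u: "u \<in> U" "n = embP P u" by blast
  show "embG P g \<otimes>\<^bsub>\<Gamma>\<^esub> n \<otimes>\<^bsub>\<Gamma>\<^esub> inv\<^bsub>\<Gamma>\<^esub> (embG P g) \<in> embP P ` U"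
    using conj_embP[OF g subgroup.mem_carrier[OF sU u(1)]] u inv[OF g u(1)] by simp
qed (rule conj_mem_image[OF U])

lemma normal_PP: "\<PP> \<lhd> \<Gamma>"
  by (rule normal_image[OF P.normal_self]) (rule G_closed)

text \<open>The group \<open>gamma2 P G\<close>, seen in the semidirect product.\<close>
abbreviation "T \<equiv> generate \<Gamma> (derived \<Gamma> \<PP> \<union> G_comm P G (carrier P))"

lemma sPP: "subgroup \<PP> \<Gamma>" by (rule normal_imp_subgroup[OF normal_PP])

lemma G_comm_closed:
  assumes N: "subgroup N \<Gamma>" and c: "\<And>g x. g \<in> G \<Longrightarrow> x \<in> U \<Longrightarrow> cmt \<Gamma> (embG P g) (embP P x) \<in> N"
  shows "G_comm P G U \<subseteq> N"
  unfolding G_comm_def comm_subgroup_def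
  by (rule \<Gamma>.generate_subgroup_incl[OF _ N]) (use c in auto)

lemma cmt_mem_G_comm: "g \<in> G \<Longrightarrow> x \<in> U \<Longrightarrow> cmt \<Gamma> (embG P g) (embP P x) \<in> G_comm P G U"
  unfolding G_comm_def comm_subgroup_def
  by (rule generate.incl, rule CollectI, intro exI conjI, rule refl, erule imageI, erule imageI)

lemma T_subset:
  assumes N: "subgroup N \<Gamma>"
    and G: "\<And>g x. g \<in> G \<Longrightarrow> x \<in> carrier P \<Longrightarrow> cmt \<Gamma> (embG P g) (embP P x) \<in> N"
    and P: "\<And>x y. x \<in> carrier P \<Longrightarrow> y \<in> carrier P \<Longrightarrow> cmt \<Gamma> (embP P x) (embP P y) \<in> N"
  shows "T \<subseteq> N"
proof (rule \<Gamma>.generate_subgroup_incl[OF _ N])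
  have "derived \<Gamma> \<PP> \<subseteq> N"
    unfolding derived_def by (rule \<Gamma>.generate_subgroup_incl[OF _ N]) (use P in auto)
  then show "derived \<Gamma> \<PP> \<union> G_comm P G (carrier P) \<subseteq> N" using G_comm_closed[OF N G] by blast
qed

lemma cmt_embP: "x \<in> carrier P \<Longrightarrow> y \<in> carrier P \<Longrightarrow> cmt \<Gamma> (embP P x) (embP P y) = embP P (cmt P x y)"
  by (simp add: embP.hom_mult embP.hom_inv)

lemma cmt_mem_PP: "g \<in> G \<Longrightarrow> x \<in> carrier P \<Longrightarrow> cmt \<Gamma> (embG P g) (embP P x) \<in> \<PP>"
  using cmt_embG_embP[of g x] imageI[of "g x \<otimes>\<^bsub>P\<^esub> inv\<^bsub>P\<^esub> x" "carrier P" "embP P"] by (simp only: G_closed P.m_closed P.inv_closed)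

lemma T_subset_PP: "T \<subseteq> \<PP>"
proof (rule T_subset[OF sPP])
  show "cmt \<Gamma> (embG P g) (embP P x) \<in> \<PP>" if "g \<in> G" "x \<in> carrier P" for g x
    by (rule cmt_mem_PP[OF that])
  show "cmt \<Gamma> (embP P x) (embP P y) \<in> \<PP>" if "x \<in> carrier P" "y \<in> carrier P" for x y
    unfolding cmt_embP[OF that] by (intro imageI P.m_closed P.inv_closed that)
qed

lemma subgroup_T: "subgroup T \<Gamma>"
proof (rule \<Gamma>.generate_is_subgroup)
  show "derived \<Gamma> \<PP> \<union> G_comm P G (carrier P) \<subseteq> carrier \<Gamma>"
    using \<Gamma>.derived_in_carrier[OF subgroup.subset[OF sPP]] subgroup.subset[OF sPP]
      G_comm_closed[OF sPP cmt_mem_PP] by blast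
qed

lemma cmt_mem_T: "g \<in> G \<Longrightarrow> x \<in> carrier P \<Longrightarrow> cmt \<Gamma> (embG P g) (embP P x) \<in> T"
  and cmt_mem_T': "x \<in> carrier P \<Longrightarrow> y \<in> carrier P \<Longrightarrow> cmt \<Gamma> (embP P x) (embP P y) \<in> T"
  using cmt_mem_G_comm[of g x "carrier P"] \<Gamma>.cmt_mem_derived[of "embP P x" \<PP> "embP P y"]
  by (auto intro: generate.incl)

lemma image_gamma2: "embP P ` gamma2 P G = T"
  using T_subset_PP unfolding gamma2_def by blast

lemma gamma2_subset: "gamma2 P G \<subseteq> carrier P" by (auto simp: gamma2_def)

lemma subgroup_gamma2: "subgroup (gamma2 P G) P"
proof (rule P.finite_closed_subgroup[OF P.fin gamma2_subset])
  have "\<one>\<^bsub>P\<^esub> \<in> gamma2 P G" using subgroup.one_closed[OF subgroup_T] by (simp add: gamma2_def embP.hom_one)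
  then show "gamma2 P G \<noteq> {}" by blast
  fix x y assume "x \<in> gamma2 P G" "y \<in> gamma2 P G"
  then show "x \<otimes>\<^bsub>P\<^esub> y \<in> gamma2 P G"
    using subgroup.m_closed[OF subgroup_T] by (auto simp: gamma2_def embP.hom_mult)
qed

lemma mem_gamma2_iff: "x \<in> carrier P \<Longrightarrow> x \<in> gamma2 P G \<longleftrightarrow> embP P x \<in> T"
  by (simp add: gamma2_def)

lemma normal_T: "T \<lhd> \<Gamma>"
proof (rule normal_if_conj[OF subgroup_T T_subset_PP])
  have step: "a \<otimes>\<^bsub>\<Gamma>\<^esub> n \<otimes>\<^bsub>\<Gamma>\<^esub> inv\<^bsub>\<Gamma>\<^esub> a \<in> T" if a: "a \<in> carrier \<Gamma>" and n: "n \<in> T" and c: "cmt \<Gamma> a n \<in> T" for a n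
  proof -
    have "cmt \<Gamma> a n \<otimes>\<^bsub>\<Gamma>\<^esub> n \<in> T" by (rule subgroup.m_closed[OF subgroup_T c n])
    then show ?thesis using a subgroup.mem_carrier[OF subgroup_T n] by (simp add: \<Gamma>.group_word)
  qed
  show "embG P g \<otimes>\<^bsub>\<Gamma>\<^esub> n \<otimes>\<^bsub>\<Gamma>\<^esub> inv\<^bsub>\<Gamma>\<^esub> (embG P g) \<in> T" if g: "g \<in> G" and n: "n \<in> T" for g n
  proof -
    obtain x where "x \<in> carrier P" "n = embP P x" using n T_subset_PP by blast
    then show ?thesis using step[OF embG_closed[OF g] n] cmt_mem_T[OF g] by simp
  qed
  show "embP P y \<otimes>\<^bsub>\<Gamma>\<^esub> n \<otimes>\<^bsub>\<Gamma>\<^esub> inv\<^bsub>\<Gamma>\<^esub> (embP P y) \<in> T" if y: "y \<in> carrier P" and n: "n \<in> T" for y n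
  proof -
    obtain x where "x \<in> carrier P" "n = embP P x" using n T_subset_PP by blast
    then show ?thesis using step[OF embP_closed[OF y] n] cmt_mem_T'[OF y] by simp
  qed
qed

lemma card_gamma2_le: "card (gamma2 P G) \<le> card (derived \<Gamma> (carrier \<Gamma>))"
proof -
  have D: "subgroup (derived \<Gamma> (carrier \<Gamma>)) \<Gamma>" by (rule \<Gamma>.derived_is_subgroup) simp
  have "T \<subseteq> derived \<Gamma> (carrier \<Gamma>)"
    by (rule T_subset[OF D]; rule \<Gamma>.cmt_mem_derived; rule embG_closed embP_closed; assumption)
  then have "card T \<le> card (derived \<Gamma> (carrier \<Gamma>))" by (intro card_mono \<Gamma>.finite_sub[OF \<Gamma>.fin D])
  then show ?thesis
    unfolding image_gamma2[symmetric] using card_image[OF inj_on_subset[OF inj_embP subset_UNIV], of "gamma2 P G"] by simp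
qed

text \<open>A subgroup \<open>U\<close> of \<open>P\<close> above \<open>gamma2 P G\<close> is invariant under \<open>G\<close>, since \<open>g y\<close> and \<open>y\<close> differ by a
  commutator.\<close>
lemma subgroup_times:
  assumes U: "subgroup U P" "gamma2 P G \<subseteq> U"
  shows "subgroup (G \<times> U) \<Gamma>"
proof (rule \<Gamma>.finite_closed_subgroup[OF \<Gamma>.fin])
  show "G \<times> U \<subseteq> carrier \<Gamma>" using subgroup.subset[OF U(1)] by (auto simp: carrier_semidirect)
  show "G \<times> U \<noteq> {}" using one_G subgroup.one_closed[OF U(1)] by blast
  have inv: "g y \<in> U" if g: "g \<in> G" and y: "y \<in> U" for g y
  proof -
    have yc: "y \<in> carrier P" by (rule subgroup.mem_carrier[OF U(1) y])
    have gy: "g y \<in> carrier P" using g yc by simp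
    have "g y \<otimes>\<^bsub>P\<^esub> inv\<^bsub>P\<^esub> y \<in> gamma2 P G"
      using cmt_mem_T[OF g yc] gy yc unfolding cmt_embG_embP[OF g yc] by (simp add: mem_gamma2_iff)
    then have "(g y \<otimes>\<^bsub>P\<^esub> inv\<^bsub>P\<^esub> y) \<otimes>\<^bsub>P\<^esub> y \<in> U" using subgroup.m_closed[OF U(1) _ y] U(2) by blast
    then show ?thesis using gy yc by (simp add: P.m_assoc)
  qed
  fix u v assume "u \<in> G \<times> U" "v \<in> G \<times> U"
  then show "u \<otimes>\<^bsub>\<Gamma>\<^esub> v \<in> G \<times> U"
    using inv subgroup.m_closed[OF U(1)] subgroup.m_closed[OF sG] by (auto simp: mult_semidirect)
qed

lemma G_breadth_le_iff: "x \<in> carrier P \<Longrightarrow> G_breadth p P G x \<le> real k \<longleftrightarrow> breadth_le p k \<Gamma> (embP P x)"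
  unfolding G_breadth_def breadth_le_def
  by (rule \<Gamma>.log_index_le_iff[OF \<Gamma>.subgroup_self \<Gamma>.subgroup_centralizer])
    (auto simp: embP_closed centralizer_def)

text \<open>By \<open>exists_normal_below\<close>, the commutators with \<open>P\<close> lie in a proper subgroup of \<open>P\<close>. This makes the
  definition of \<open>M_inv\<close> meaningful.\<close>
lemma gamma2_ne:
  assumes "carrier P \<noteq> {\<one>\<^bsub>P\<^esub>}" shows "gamma2 P G \<noteq> carrier P"
proof -
  have "\<PP> \<noteq> {\<one>\<^bsub>\<Gamma>\<^esub>}"
  proof
    assume "\<PP> = {\<one>\<^bsub>\<Gamma>\<^esub>}"
    then have "x = \<one>\<^bsub>P\<^esub>" if "x \<in> carrier P" for x
      using that inj_embP embP.hom_one by (metis imageI injD singletonD)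
    then show False using assms P.one_closed by blast
  qed
  then obtain U where U: "U \<lhd> \<Gamma>" "U \<subset> \<PP>" "\<And>x u. x \<in> \<PP> \<Longrightarrow> u \<in> carrier \<Gamma> \<Longrightarrow> cmt \<Gamma> x u \<in> U"
    using \<Gamma>.exists_normal_below[OF normal_PP] by blast
  have sU: "subgroup U \<Gamma>" by (rule normal_imp_subgroup[OF U(1)])
  have "T \<subseteq> U"
  proof (rule T_subset[OF sU])
    show "cmt \<Gamma> (embG P g) (embP P x) \<in> U" if "g \<in> G" "x \<in> carrier P" for g x
      using subgroup.m_inv_closed[OF sU U(3)[of "embP P x" "embG P g"]] that
        \<Gamma>.inv_cmt[OF embP_closed[OF that(2)] embG_closed[OF that(1)]] embG_closed by simp
    show "cmt \<Gamma> (embP P x) (embP P y) \<in> U" if "x \<in> carrier P" "y \<in> carrier P" for x y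
      by (rule U(3)) (use that embP_closed in auto)
  qed
  then have "embP P ` gamma2 P G \<noteq> \<PP>" using U(2) image_gamma2 by blast
  then show ?thesis by blast
qed

text \<open>The least integer in the definition of \<open>M_inv\<close> is a natural number: breadths are not negative, and
  a group is not the union of two proper subgroups.\<close>
lemma obtain_M_inv:
  assumes "carrier P \<noteq> {\<one>\<^bsub>P\<^esub>}"
  obtains k H K where "M_inv p P G = int k" "subgroup H P" "H \<noteq> carrier P" "gamma2 P G \<subseteq> H"
    "subgroup K P" "K \<noteq> carrier P" "gamma2 P G \<subseteq> K"
    "\<And>x. x \<in> carrier P \<Longrightarrow> x \<notin> H \<Longrightarrow> x \<notin> K \<Longrightarrow> breadth_le p k \<Gamma> (embP P x)"
proof -
  define R where "R = (\<lambda>k :: int. \<exists>H K. subgroup H P \<and> H \<noteq> carrier P \<and> gamma2 P G \<subseteq> H \<and>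
     subgroup K P \<and> K \<noteq> carrier P \<and> gamma2 P G \<subseteq> K \<and>
     {x \<in> carrier P. G_breadth p P G x > real_of_int k} \<subseteq> H \<union> K)"
  have M: "M_inv p P G = (LEAST k. R k)" by (simp add: M_inv_def R_def)
  obtain n where n: "card (carrier \<Gamma>) = p ^ n" using \<Gamma>.order_pow by blast
  have "breadth_le p n \<Gamma> (embP P x)" if "x \<in> carrier P" for x
    unfolding breadth_le_def n
    using \<Gamma>.card_sub_pos[OF \<Gamma>.fin \<Gamma>.subgroup_centralizer[OF embP_closed[OF that]]] by simp
  then have "{x \<in> carrier P. G_breadth p P G x > real_of_int (int n)} = {}"
    using G_breadth_le_iff by (auto simp: not_less)
  then have Rn: "R (int n)" unfolding R_def using subgroup_gamma2 gamma2_ne[OF assms] by blast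
  have neg: "\<not> R k" if "k < 0" for k
  proof
    assume "R k"
    then obtain H K where HK: "subgroup H P" "H \<noteq> carrier P" "subgroup K P" "K \<noteq> carrier P"
      "{x \<in> carrier P. G_breadth p P G x > real_of_int k} \<subseteq> H \<union> K" unfolding R_def by blast
    have "\<not> carrier P \<subseteq> H" "\<not> carrier P \<subseteq> K" using HK subgroup.subset by blast+
    then obtain x where x: "x \<in> carrier P" "x \<notin> H" "x \<notin> K"
      using P.exists_off_two_subgroups[OF P.subgroup_self HK(1) _ HK(3)] by blast
    have "G_breadth p P G x \<ge> 0"
    proof -
      let ?r = "card (rcosets\<^bsub>\<Gamma>\<lparr>carrier := carrier \<Gamma>\<rparr>\<^esub> (centralizer \<Gamma> (embP P x)))"
      have "?r * card (centralizer \<Gamma> (embP P x)) = card (carrier \<Gamma>)"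
        using \<Gamma>.lagrange[OF \<Gamma>.subgroup_centralizer[OF embP_closed[OF x(1)]]] by (simp add: order_def)
      moreover have "0 < card (carrier \<Gamma>)" by (rule \<Gamma>.card_sub_pos[OF \<Gamma>.fin \<Gamma>.subgroup_self])
      ultimately have "1 \<le> ?r" by (metis Suc_leI One_nat_def gr0I mult_0)
      then show ?thesis using P.p_gt_1 by (simp add: G_breadth_def log_index_def)
    qed
    then show False using HK(5) x that by force
  qed
  define k where "k = (LEAST k :: nat. R (int k))"
  have Rk: "R (int k)" unfolding k_def by (rule LeastI[of "\<lambda>k. R (int k)", OF Rn])
  have "(LEAST k. R k) = int k"
  proof (rule Least_equality[where P = R and x = "int k", OF Rk])
    fix i assume i: "R i"
    then have "0 \<le> i" using neg by (meson not_le)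
    then obtain m where m: "i = int m" by (metis nonneg_int_cases)
    then have "k \<le> m" unfolding k_def using i by (intro Least_le) simp
    then show "int k \<le> i" using m by simp
  qed
  then have "M_inv p P G = int k" by (simp add: M)
  moreover obtain H K where HK: "subgroup H P" "H \<noteq> carrier P" "gamma2 P G \<subseteq> H" "subgroup K P" "K \<noteq> carrier P"
    "gamma2 P G \<subseteq> K" "{x \<in> carrier P. G_breadth p P G x > real_of_int (int k)} \<subseteq> H \<union> K"
    using Rk unfolding R_def by blast
  moreover have "breadth_le p k \<Gamma> (embP P x)" if "x \<in> carrier P" "x \<notin> H" "x \<notin> K" for x
    using HK(7) that G_breadth_le_iff[OF that(1), of k] by force
  ultimately show ?thesis using that by blast
qed

end

section \<open>A subgroup of index at most \<open>p\<close> on which the action is trivial\<close>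

locale acted_group_index_p = acted_group +
  fixes M
  assumes p3: "2 < p" and normal_M: "M \<lhd> P"
    and index_M: "log_index p P (carrier P) M \<le> 1" and comm_M: "G_comm P G M = {\<one>\<^bsub>semidirect P G\<^esub>}"
begin

lemma sM: "subgroup M P" by (rule normal_imp_subgroup[OF normal_M])

lemma M_carrier: "m \<in> M \<Longrightarrow> m \<in> carrier P" by (rule subgroup.mem_carrier[OF sM])

lemma fix_M:
  assumes g: "g \<in> G" and m: "m \<in> M" shows "g m = m"
proof -
  have mc: "m \<in> carrier P" by (rule M_carrier[OF m])
  have gm: "g m \<in> carrier P" using g mc by simp
  have "embP P (g m \<otimes>\<^bsub>P\<^esub> inv\<^bsub>P\<^esub> m) = \<one>\<^bsub>\<Gamma>\<^esub>"
    using cmt_mem_G_comm[OF g m] unfolding comm_M cmt_embG_embP[OF g mc] by simp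
  then have "g m \<otimes>\<^bsub>P\<^esub> inv\<^bsub>P\<^esub> m = \<one>\<^bsub>P\<^esub>" using embP.hom_one inj_embP by (metis injD)
  then have "(g m \<otimes>\<^bsub>P\<^esub> inv\<^bsub>P\<^esub> m) \<otimes>\<^bsub>P\<^esub> m = m" using mc by simp
  then show ?thesis using gm mc by (simp add: P.m_assoc)
qed

lemma card_M: "card (carrier P) \<le> p * card M"
  using P.log_index_le_iff[OF P.subgroup_self sM subgroup.subset[OF sM], of 1] index_M by simp

abbreviation "\<MM> \<equiv> embP P ` M"

lemma normal_MM: "\<MM> \<lhd> \<Gamma>"
  by (rule normal_image[OF normal_M]) (simp add: fix_M)

lemma cmt_mem_MM:
  assumes x: "x \<in> carrier P" and u: "u \<in> carrier \<Gamma>"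
  shows "cmt \<Gamma> (embP P x) u \<in> \<MM>"
proof (rule \<Gamma>.cmt_mem_if_index_le_p[OF normal_MM normal_PP _ _ _ u])
  show "\<MM> \<subseteq> \<PP>" using subgroup.subset[OF sM] by (rule image_mono)
  show "card \<PP> \<le> p * card \<MM>"
    using card_M card_image[OF inj_on_subset[OF inj_embP subset_UNIV]] by metis
qed (use x in simp)

lemma displacement_mem_M:
  assumes g: "g \<in> G" and x: "x \<in> carrier P" shows "g x \<otimes>\<^bsub>P\<^esub> inv\<^bsub>P\<^esub> x \<in> M"
proof -
  have "inv\<^bsub>\<Gamma>\<^esub> (cmt \<Gamma> (embP P x) (embG P g)) \<in> \<MM>"
    by (rule subgroup.m_inv_closed[OF normal_imp_subgroup[OF normal_MM] cmt_mem_MM[OF x embG_closed[OF g]]])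
  then have "cmt \<Gamma> (embG P g) (embP P x) \<in> \<MM>"
    by (simp only: \<Gamma>.inv_cmt[OF embP_closed[OF x] embG_closed[OF g]])
  then show ?thesis unfolding cmt_embG_embP[OF g x] by (simp only: inj_image_mem_iff[OF inj_embP])
qed

lemma T_subset_MM: "T \<subseteq> \<MM>"
proof (rule T_subset[OF normal_imp_subgroup[OF normal_MM]])
  show "cmt \<Gamma> (embG P g) (embP P x) \<in> \<MM>" if "g \<in> G" "x \<in> carrier P" for g x
    unfolding cmt_embG_embP[OF that] by (rule imageI[OF displacement_mem_M[OF that]])
  show "cmt \<Gamma> (embP P x) (embP P y) \<in> \<MM>" if "x \<in> carrier P" "y \<in> carrier P" for x y
    by (rule cmt_mem_MM[OF that(1) embP_closed[OF that(2)]])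
qed

lemma gamma2_subset_M: "gamma2 P G \<subseteq> M"
  using T_subset_MM unfolding image_gamma2[symmetric] by (simp only: inj_image_subset_iff[OF inj_embP])

text \<open>An element \<open>g\<close> of \<open>G\<close> moves \<open>x\<close> by some \<open>m \<in> M\<close>. As \<open>g\<close> fixes both \<open>y\<close> and its conjugates by \<open>x\<close>,
  for \<open>y \<in> M\<close>, this \<open>m\<close> commutes with \<open>y\<close>.\<close>
lemma displacement_centralizes_M:
  assumes g: "g \<in> G" and x: "x \<in> carrier P" and y: "y \<in> M"
  shows "(g x \<otimes>\<^bsub>P\<^esub> inv\<^bsub>P\<^esub> x) \<otimes>\<^bsub>P\<^esub> y = y \<otimes>\<^bsub>P\<^esub> (g x \<otimes>\<^bsub>P\<^esub> inv\<^bsub>P\<^esub> x)"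
proof -
  let ?w = "inv\<^bsub>P\<^esub> x \<otimes>\<^bsub>P\<^esub> y \<otimes>\<^bsub>P\<^esub> x"
  have yc: "y \<in> carrier P" by (rule M_carrier[OF y])
  have gx: "g x \<in> carrier P" using g x by simp
  have "?w \<in> M" by (rule normal.inv_op_closed1[OF normal_M x y])
  then have w: "g ?w = ?w" by (rule fix_M[OF g])
  have "g ?w = inv\<^bsub>P\<^esub> (g x) \<otimes>\<^bsub>P\<^esub> y \<otimes>\<^bsub>P\<^esub> g x"
    using g x yc fix_M[OF g y] by (simp add: G_mult G_inv)
  then have "g x \<otimes>\<^bsub>P\<^esub> ?w = y \<otimes>\<^bsub>P\<^esub> g x" unfolding w using gx yc by (simp add: P.group_word)
  then have "(g x \<otimes>\<^bsub>P\<^esub> ?w) \<otimes>\<^bsub>P\<^esub> inv\<^bsub>P\<^esub> x = (y \<otimes>\<^bsub>P\<^esub> g x) \<otimes>\<^bsub>P\<^esub> inv\<^bsub>P\<^esub> x" by (simp only:)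
  then show ?thesis using gx yc x by (simp add: P.m_assoc)
qed

text \<open>Two elements of \<open>G\<close> move \<open>x\<close> by elements of \<open>M\<close> that commute with each other and are fixed by \<open>G\<close>.\<close>
lemma G_commute:
  assumes g: "g \<in> G" and h: "h \<in> G" shows "g \<otimes>\<^bsub>AutoGroup P\<^esub> h = h \<otimes>\<^bsub>AutoGroup P\<^esub> g"
proof -
  have "g (h x) = h (g x)" if x: "x \<in> carrier P" for x
  proof -
    let ?m = "g x \<otimes>\<^bsub>P\<^esub> inv\<^bsub>P\<^esub> x" and ?n = "h x \<otimes>\<^bsub>P\<^esub> inv\<^bsub>P\<^esub> x"
    have m: "?m \<in> M" and n: "?n \<in> M" using displacement_mem_M g h x by auto
    have c: "?m \<in> carrier P" "?n \<in> carrier P" "g x \<in> carrier P" "h x \<in> carrier P" using g h x by auto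
    have gx: "g x = ?m \<otimes>\<^bsub>P\<^esub> x" and hx: "h x = ?n \<otimes>\<^bsub>P\<^esub> x" using c x by (auto simp: P.m_assoc)
    have "g (h x) = g (?n \<otimes>\<^bsub>P\<^esub> x)" using hx by simp
    also have "\<dots> = ?n \<otimes>\<^bsub>P\<^esub> g x" using G_mult[OF g c(2) x] fix_M[OF g n] by simp
    also have "\<dots> = ?n \<otimes>\<^bsub>P\<^esub> (?m \<otimes>\<^bsub>P\<^esub> x)" using gx by simp
    also have "\<dots> = (?n \<otimes>\<^bsub>P\<^esub> ?m) \<otimes>\<^bsub>P\<^esub> x" by (rule P.m_assoc[symmetric, OF c(2,1) x])
    also have "?n \<otimes>\<^bsub>P\<^esub> ?m = ?m \<otimes>\<^bsub>P\<^esub> ?n" by (rule displacement_centralizes_M[OF h x m])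
    also have "(?m \<otimes>\<^bsub>P\<^esub> ?n) \<otimes>\<^bsub>P\<^esub> x = ?m \<otimes>\<^bsub>P\<^esub> (?n \<otimes>\<^bsub>P\<^esub> x)" by (rule P.m_assoc[OF c(1,2) x])
    also have "\<dots> = ?m \<otimes>\<^bsub>P\<^esub> h x" using hx by simp
    also have "\<dots> = h (?m \<otimes>\<^bsub>P\<^esub> x)" using G_mult[OF h c(1) x] fix_M[OF h m] by simp
    also have "\<dots> = h (g x)" using gx by simp
    finally show ?thesis .
  qed
  then show ?thesis unfolding Aut_mult[OF g h] Aut_mult[OF h g] compose_def by (intro restrict_ext)
qed

lemma embG_commute:
  assumes g: "g \<in> G" and h: "h \<in> G" and m: "m \<in> M"
  shows "embG P g \<otimes>\<^bsub>\<Gamma>\<^esub> (h, m) = (h, m) \<otimes>\<^bsub>\<Gamma>\<^esub> embG P g"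
  using G_commute[OF g h] fix_M[OF g m] M_carrier[OF m] G_one[OF h] by (simp add: embG_def mult_semidirect)

text \<open>As \<open>G\<close> is abelian, the commutators of the semidirect product all come from \<open>[P, P]\<close> and \<open>[G, P]\<close>.\<close>
lemma cmt_mem_T_all:
  assumes u: "u \<in> carrier \<Gamma>" and v: "v \<in> carrier \<Gamma>" shows "cmt \<Gamma> u v \<in> T"
proof -
  have sT: "subgroup T \<Gamma>" by (rule subgroup_T)
  have full: "w \<in> centralizer_mod \<Gamma> T x"
    if x: "x \<in> carrier \<Gamma>" and w: "w \<in> carrier \<Gamma>" and a: "\<And>g. g \<in> G \<Longrightarrow> cmt \<Gamma> x (embG P g) \<in> T"
      and b: "\<And>y. y \<in> carrier P \<Longrightarrow> cmt \<Gamma> x (embP P y) \<in> T" for x w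
  proof -
    have sC: "subgroup (centralizer_mod \<Gamma> T x) \<Gamma>" by (rule \<Gamma>.subgroup_centralizer_mod[OF normal_T x])
    obtain g y where gy: "g \<in> G" "y \<in> carrier P" "w = embG P g \<otimes>\<^bsub>\<Gamma>\<^esub> embP P y" using decompose[OF w] by blast
    have "embG P g \<in> centralizer_mod \<Gamma> T x" "embP P y \<in> centralizer_mod \<Gamma> T x"
      using a[OF gy(1)] b[OF gy(2)] embG_closed[OF gy(1)] embP_closed[OF gy(2)] by (simp_all only: centralizer_mod_def mem_Collect_eq simp_thms)
    then show ?thesis unfolding gy(3) by (rule subgroup.m_closed[OF sC])
  qed
  have sym: "cmt \<Gamma> b a \<in> T" if "cmt \<Gamma> a b \<in> T" "a \<in> carrier \<Gamma>" "b \<in> carrier \<Gamma>" for a b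
    using subgroup.m_inv_closed[OF sT that(1)] by (simp only: \<Gamma>.inv_cmt[OF that(2,3)])
  have gT: "cmt \<Gamma> (embG P g) w \<in> T" if g: "g \<in> G" and w: "w \<in> carrier \<Gamma>" for g w
  proof -
    have "cmt \<Gamma> (embG P g) (embG P h) \<in> T" if h: "h \<in> G" for h
    proof -
      have "embG P g \<otimes>\<^bsub>\<Gamma>\<^esub> embG P h = embG P h \<otimes>\<^bsub>\<Gamma>\<^esub> embG P g"
        using embG_commute[OF g h subgroup.one_closed[OF sM]] by (simp add: embG_def)
      then have "cmt \<Gamma> (embG P g) (embG P h) = \<one>\<^bsub>\<Gamma>\<^esub>"
        by (rule iffD2[OF \<Gamma>.cmt_eq_one_iff[OF embG_closed[OF g] embG_closed[OF h]]])
      then show ?thesis using subgroup.one_closed[OF sT] by (simp only:)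
    qed
    then have "w \<in> centralizer_mod \<Gamma> T (embG P g)"
      by (intro full[OF embG_closed[OF g] w] cmt_mem_T[OF g])
    then show ?thesis by (simp only: centralizer_mod_def mem_Collect_eq)
  qed
  have xT: "cmt \<Gamma> (embP P x) w \<in> T" if x: "x \<in> carrier P" and w: "w \<in> carrier \<Gamma>" for x w
  proof -
    have "w \<in> centralizer_mod \<Gamma> T (embP P x)"
      by (rule full[OF embP_closed[OF x] w sym[OF cmt_mem_T[OF _ x] embG_closed embP_closed[OF x]] cmt_mem_T'[OF x]])
    then show ?thesis by (simp only: centralizer_mod_def mem_Collect_eq)
  qed
  have "u \<in> centralizer_mod \<Gamma> T v"
    by (rule full[OF v u sym[OF gT[OF _ v] embG_closed v] sym[OF xT[OF _ v] embP_closed v]])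
  then have "cmt \<Gamma> v u \<in> T" by (simp only: centralizer_mod_def mem_Collect_eq)
  then show ?thesis by (rule sym[OF _ v u])
qed

lemma exists_hyperplane_times:
  assumes U: "subgroup U P" "gamma2 P G \<subseteq> U" "U \<noteq> carrier P"
  shows "\<exists>L. hyperplane p \<Gamma> L \<and> G \<times> U \<subseteq> L"
proof (rule \<Gamma>.exists_hyperplane_over_derived[OF subgroup_times[OF U(1,2)]])
  show "cmt \<Gamma> x y \<in> G \<times> U" if "x \<in> carrier \<Gamma>" "y \<in> carrier \<Gamma>" for x y
  proof -
    have "cmt \<Gamma> x y \<in> embP P ` gamma2 P G" unfolding image_gamma2 by (rule cmt_mem_T_all[OF that])
    also have "embP P ` gamma2 P G \<subseteq> G \<times> U" using U(2) one_G by (auto simp: embP_def)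
    finally show ?thesis .
  qed
  have "G \<noteq> {}" "carrier P \<noteq> {}" using one_G P.one_closed by blast+
  then show "G \<times> U \<noteq> carrier \<Gamma>" using U(3) unfolding carrier_semidirect by (simp add: times_eq_iff)
qed

text \<open>The hypotheses of \<open>card_derived_le_split\<close> hold in the semidirect product, with \<open>F = G \<times> M\<close>. If \<open>M = P\<close>,
  then \<open>G\<close> is trivial and any hyperplane can serve as \<open>F\<close>.\<close>
lemma card_gamma2_bound:
  assumes H: "subgroup H P" "H \<noteq> carrier P" "gamma2 P G \<subseteq> H"
    and K: "subgroup K P" "K \<noteq> carrier P" "gamma2 P G \<subseteq> K"
    and low: "\<And>x. x \<in> carrier P \<Longrightarrow> x \<notin> H \<Longrightarrow> x \<notin> K \<Longrightarrow> breadth_le p k \<Gamma> (embP P x)"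
  shows "card (gamma2 P G) \<le> p ^ triangular k"
proof -
  obtain L where L: "hyperplane p \<Gamma> L" "G \<times> H \<subseteq> L" using exists_hyperplane_times[OF H(1,3,2)] by blast
  obtain L' where L': "hyperplane p \<Gamma> L'" "G \<times> K \<subseteq> L'" using exists_hyperplane_times[OF K(1,3,2)] by blast
  have GG: "\<GG> \<subseteq> G \<times> U" if "subgroup U P" for U using subgroup.one_closed[OF that] by (auto simp: embG_def)
  have PP: "embP P x \<in> L" if "x \<in> H" for x using L(2) that one_G by (auto simp: embP_def)
  have PP': "embP P x \<in> L'" if "x \<in> K" for x using L'(2) that one_G by (auto simp: embP_def)
  obtain F where F: "hyperplane p \<Gamma> F" "\<GG> \<subseteq> F" "\<And>g f. g \<in> \<GG> \<Longrightarrow> f \<in> F \<Longrightarrow> g \<otimes>\<^bsub>\<Gamma>\<^esub> f = f \<otimes>\<^bsub>\<Gamma>\<^esub> g"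
  proof (cases "M = carrier P")
    case True
    have one: "g = \<one>\<^bsub>AutoGroup P\<^esub>" if g: "g \<in> G" for g
      unfolding Aut_one using G_ext[OF g] fix_M[OF g] True by (intro extensionalityI[of _ "carrier P"]) auto
    have gg: "g = \<one>\<^bsub>\<Gamma>\<^esub>" if "g \<in> \<GG>" for g using that one by (auto simp: embG_def semidirect_def)
    show ?thesis
    proof (rule that[OF L(1)])
      show "\<GG> \<subseteq> L" using GG[OF H(1)] L(2) by blast
      show "g \<otimes>\<^bsub>\<Gamma>\<^esub> f = f \<otimes>\<^bsub>\<Gamma>\<^esub> g" if "g \<in> \<GG>" "f \<in> L" for g f
        using gg[OF that(1)] subgroup.mem_carrier[OF \<Gamma>.hyperplane_subgroup[OF L(1)] that(2)] by simp
    qed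
  next
    case False
    obtain F where F: "hyperplane p \<Gamma> F" "G \<times> M \<subseteq> F" using exists_hyperplane_times[OF sM gamma2_subset_M False] by blast
    have "p * card F = card G * card (carrier P)"
      using hyperplane_card[OF F(1)] by (simp add: carrier_semidirect card_cartesian_product)
    also have "\<dots> \<le> card G * (p * card M)" using card_M by (rule mult_le_mono2)
    also have "\<dots> = p * card (G \<times> M)" by (simp add: card_cartesian_product)
    finally have "card F \<le> card (G \<times> M)" using P.p_gt_1 by simp
    then have e: "G \<times> M = F"
      using card_seteq[OF \<Gamma>.finite_sub[OF \<Gamma>.fin \<Gamma>.hyperplane_subgroup[OF F(1)]] F(2)] by blast
    show ?thesis
    proof (rule that[OF F(1)])
      show "\<GG> \<subseteq> F" using GG[OF sM] e by blast
      show "g \<otimes>\<^bsub>\<Gamma>\<^esub> f = f \<otimes>\<^bsub>\<Gamma>\<^esub> g" if "g \<in> \<GG>" "f \<in> F" for g f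
        using that embG_commute unfolding e[symmetric] by auto
    qed
  qed
  have "card (derived \<Gamma> (carrier \<Gamma>)) \<le> p ^ triangular k"
  proof (rule card_derived_le_split[OF p3 \<Gamma>.p_grp_axioms L(1) L'(1) F(1) normal_PP _ _ _ F(2) F(3)])
    show "\<exists>g\<in>\<GG>. \<exists>y\<in>\<PP>. u = g \<otimes>\<^bsub>\<Gamma>\<^esub> y" if "u \<in> carrier \<Gamma>" for u using decompose[OF that] by blast
    show "\<GG> \<subseteq> L" "\<GG> \<subseteq> L'" using GG[OF H(1)] GG[OF K(1)] L(2) L'(2) by blast+
    show "breadth_le p k \<Gamma> y" if "y \<in> \<PP>" "y \<notin> L" "y \<notin> L'" for y
      using that low PP PP' by blast
  qed
  then show ?thesis using card_gamma2_le by (rule order_trans[rotated])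
qed

lemma G_comm_below_M:
  assumes "U \<subseteq> M" shows "G_comm P G U \<subseteq> {\<one>\<^bsub>\<Gamma>\<^esub>}"
proof (rule G_comm_closed[OF \<Gamma>.triv_subgroup])
  fix g x assume g: "g \<in> G" and x: "x \<in> U"
  have "x \<in> M" using x assms by blast
  then show "cmt \<Gamma> (embG P g) (embP P x) \<in> {\<one>\<^bsub>\<Gamma>\<^esub>}"
    using cmt_mem_G_comm[OF g, of x M] comm_M by blast
qed

text \<open>The \<open>i\<close>-th member of the series has order \<open>p ^ min n (triangular (k + 1 - i))\<close>, where \<open>p ^ n\<close> is the
  order of \<open>gamma2 P G\<close>: consecutive exponents then differ by at most \<open>k + 1 - i\<close>, and the bound
  \<open>n \<le> triangular k\<close> makes the series begin with \<open>gamma2 P G\<close>.\<close>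
theorem exists_series:
  "\<exists>N C. N \<ge> 1 \<and> G_central_series P G N C \<and>
     C 0 = carrier P \<and> C 1 = gamma2 P G \<and> C N = {\<one>\<^bsub>P\<^esub>} \<and>
     (\<forall>i. 1 \<le> i \<and> i \<le> N - 1 \<longrightarrow>
        log_index p P (C i) (C (i + 1)) \<le> real_of_int (M_inv p P G) - real i + 1)"
proof (cases "carrier P = {\<one>\<^bsub>P\<^esub>}")
  case True
  have g2: "gamma2 P G = {\<one>\<^bsub>P\<^esub>}"
    using gamma2_subset subgroup.one_closed[OF subgroup_gamma2] True by blast
  let ?C = "\<lambda>_ :: nat. {\<one>\<^bsub>P\<^esub>}"
  have "M = {\<one>\<^bsub>P\<^esub>}" using subgroup.subset[OF sM] subgroup.one_closed[OF sM] True by blast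
  then have "G_comm P G {\<one>\<^bsub>P\<^esub>} \<subseteq> embP P ` {\<one>\<^bsub>P\<^esub>}"
    using comm_M embP.hom_one by simp
  then have "G_central_series P G 1 ?C"
    unfolding G_central_series_def using True P.triv_subgroup by auto
  then show ?thesis using True g2 by (intro exI[of _ 1] exI[of _ ?C]) auto
next
  case False
  obtain k H K where k: "M_inv p P G = int k" and H: "subgroup H P" "H \<noteq> carrier P" "gamma2 P G \<subseteq> H"
    and K: "subgroup K P" "K \<noteq> carrier P" "gamma2 P G \<subseteq> K"
    and low: "\<And>x. x \<in> carrier P \<Longrightarrow> x \<notin> H \<Longrightarrow> x \<notin> K \<Longrightarrow> breadth_le p k \<Gamma> (embP P x)"
    using obtain_M_inv[OF False] by metis
  obtain n where n: "card (gamma2 P G) = p ^ n" using P.card_power[OF subgroup_gamma2] .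
  have "p ^ n \<le> p ^ triangular k" using card_gamma2_bound[OF H K low] n by simp
  then have nk: "n \<le> triangular k" using P.p_gt_1 by (rule power_le_imp_le_exp[rotated])
  obtain f where f: "\<And>m. m \<le> n \<Longrightarrow> subgroup (f m) P \<and> card (f m) = p ^ m \<and> f m \<subseteq> gamma2 P G"
    and fm: "\<And>l m. l \<le> m \<Longrightarrow> m \<le> n \<Longrightarrow> f l \<subseteq> f m"
    using P.exists_subgroup_chain[OF subgroup_gamma2 n] by blast
  define e where "e = (\<lambda>i. min n (triangular (Suc k - i)))"
  define C where "C = (\<lambda>i :: nat. if i = 0 then carrier P else f (e i))"
  have en: "e i \<le> n" for i by (simp add: e_def)
  have finP: "finite U" if "subgroup U P" for U by (rule P.finite_sub[OF P.fin that])
  have C1: "C 1 = gamma2 P G"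
  proof -
    have "f n = gamma2 P G" using card_subset_eq[OF finP[OF subgroup_gamma2]] f[of n] n by auto
    then show ?thesis using nk by (simp add: C_def e_def min_def)
  qed
  have CN: "C (Suc k) = {\<one>\<^bsub>P\<^esub>}"
  proof -
    have "card (f 0) = 1" using f[of 0] by simp
    then obtain c where c: "f 0 = {c}" by (rule card_1_singletonE)
    then have "f 0 = {\<one>\<^bsub>P\<^esub>}" using subgroup.one_closed[of "f 0" P] f[of 0] by simp
    then show ?thesis by (simp add: C_def e_def)
  qed
  have emono: "e (Suc i) \<le> e i" if "i \<le> k" for i
  proof -
    have "triangular (k - i) \<le> triangular (Suc (k - i))" by simp
    then show ?thesis using that by (simp add: e_def Suc_diff_le min.coboundedI2 del: triangular.simps)
  qed
  have sub: "subgroup (C i) P" for i using f[OF en] P.subgroup_self by (simp add: C_def)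
  have dec: "C (Suc i) \<subseteq> C i" if "i \<le> k" for i
  proof (cases "i = 0")
    case True
    have "C (Suc i) \<subseteq> carrier P" by (rule subgroup.subset[OF sub])
    then show ?thesis using True by (simp add: C_def)
  next
    case False
    then show ?thesis using fm[OF emono[OF that] en] by (simp add: C_def)
  qed
  have "G_central_series P G (Suc k) C"
    unfolding G_central_series_def
  proof (intro conjI allI impI sub CN)
    show "C 0 = carrier P" by (simp add: C_def)
    fix i assume i: "i < Suc k"
    show "C (Suc i) \<subseteq> C i" by (rule dec) (use i in simp)
    show "G_comm P G (C i) \<subseteq> embP P ` C (Suc i)"
    proof (cases "i = 0")
      case True
      have "G_comm P G (carrier P) \<subseteq> T"
        by (rule G_comm_closed[OF subgroup_T cmt_mem_T])
      then show ?thesis using True C1 image_gamma2 by (simp add: C_def)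
    next
      case False
      have "C i \<subseteq> M" using False f[OF en, of i] gamma2_subset_M by (auto simp: C_def)
      then have "G_comm P G (C i) \<subseteq> {\<one>\<^bsub>\<Gamma>\<^esub>}" by (rule G_comm_below_M)
      also have "\<dots> \<subseteq> embP P ` C (Suc i)" using subgroup.one_closed[OF subgroup_embP[OF sub]] by blast
      finally show ?thesis .
    qed
  qed
  moreover have "log_index p P (C i) (C (i + 1)) \<le> real_of_int (M_inv p P G) - real i + 1" if i: "1 \<le> i" "i \<le> k" for i
  proof -
    have "triangular (Suc k - i) = (Suc k - i) + triangular (k - i)" using i by (simp add: Suc_diff_le)
    moreover have "min n (a + b) \<le> a + min n b" for a b by linarith
    ultimately have "e i \<le> (Suc k - i) + e (Suc i)" by (simp only: e_def diff_Suc_Suc)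
    then have "p ^ e i \<le> p ^ ((Suc k - i) + e (Suc i))" using P.p_gt_1 by (intro power_increasing) auto
    moreover have "card (C i) = p ^ e i" "card (C (Suc i)) = p ^ e (Suc i)"
      using f[OF en, of i] f[OF en, of "Suc i"] i by (simp_all add: C_def)
    ultimately have "card (C i) \<le> p ^ (Suc k - i) * card (C (Suc i))" by (simp only: power_add)
    then have "log_index p P (C i) (C (Suc i)) \<le> real (Suc k - i)"
      using P.log_index_le_iff[OF sub sub dec[OF i(2)]] by simp
    then show ?thesis using k i by (simp add: of_nat_diff)
  qed
  ultimately show ?thesis using C1 CN by (intro exI[of _ "Suc k"] exI[of _ C]) (auto simp: C_def)
qed

end

theorem theorem1:
  fixes p :: nat
    and P :: "('a, 'b) monoid_scheme"
    and G :: "('a \<Rightarrow> 'a) set"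
    and M :: "'a set"
  assumes "Factorial_Ring.prime p" and "p > 2"
    and "p_group p P"
    and "subgroup G (AutoGroup P)"
    and "p_group p ((AutoGroup P)\<lparr>carrier := G\<rparr>)"
    and "M \<lhd> P"
    and "G_invariant G M"
    and "log_index p P (carrier P) M \<le> 1"
    and "G_comm P G M = {\<one>\<^bsub>semidirect P G\<^esub>}"
  shows "\<exists>N C. N \<ge> 1 \<and> G_central_series P G N C \<and>
           C 0 = carrier P \<and> C 1 = gamma2 P G \<and> C N = {\<one>\<^bsub>P\<^esub>} \<and>
           (\<forall>i. 1 \<le> i \<and> i \<le> N - 1 \<longrightarrow>
              log_index p P (C i) (C (i + 1)) \<le> real_of_int (M_inv p P G) - real i + 1)"
proof -
  interpret acted_group_index_p p P G M
    using assms by (simp add: acted_group_index_p_def acted_group_index_p_axioms_def acted_group_def)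
  show ?thesis by (rule exists_series)
qed

end
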